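(* Let $\xi$ be a Lévy process that has no positive jumps, let $\psi(u)=\log\mathbb{E}e^{u\xi(1)}$ for $u\ge0$, and let $\theta_+,\theta_-\ge0$ satisfy $\psi(1)=\theta_--\theta_+$. Let $\eta$ be the Lévy–Brown–Resnick process generated by $\xi,\theta_+,\theta_-$ (constructed in the context). For $T>0$ let $\Theta(T)>0$ be the number such that $$\mathbb{P}\Big[\sup_{t\in[0,T]}\eta(t)-\log\Theta(T)\le x\Big]=\exp(-e^{-x}),\qquad x\in\mathbb{R}.$$ Then the extremal index $\Theta:=\lim_{T\to\infty}\Theta(T)/T$ of $\eta$ is given by $$\Theta=\begin{cases}\psi'(1),&\text{if }\theta_+=0,\\[1mm] \dfrac{\psi^{-1}(\theta_-)}{\psi^{-1}(\theta_-)-1}\,\theta_+,&\text{if }\theta_+>0.\end{cases}$$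
   Context: A Lévy process has no positive jumps (is spectrally negative) if, equivalently, its Lévy measure is concentrated on the negative half-axis. For such a process $\xi$, $\psi(u)=\log\mathbb{E}e^{u\xi(1)}$ is finite for all $u\ge0$. Let $\psi^{-1}(0)$ be the largest solution of $\psi(u)=0$. The function $\psi:[\psi^{-1}(0),\infty)\to[0,\infty)$ is strictly increasing and continuous, and the inverse function is denoted by $\psi^{-1}$. Construction of $\eta$. Let $p_t(x,dy)$ be the transition kernel of $\xi$ (law of $x+\xi(t)$). Let $L^+$ be $\xi$ killed at rate $\theta_-$ (killed means set to $-\infty$ from an independent exponential time with rate $\theta_-$ on; no killing if $\theta_-=0$), with subprobability transition kernel $q_t^+(x,dy)=e^{-\theta_-t}p_t(x,dy)$ on $\mathbb{R}$. Let $L^-$ be the (killed) Lévy process started at $0$ whose subprobability transition kernel $q_t^-$ is given by $e^{-x}dx\,q_t^-(x,dy)=e^{-y}dy\,q_t^+(y,dx)$; its killing rate is $\theta_+$, and after killing it equals $-\infty$. $L^+$ is taken càdlàg and $L^-$ left-continuous with right limits. With $L^+,L^-$ independent, put $L(t)=L^+(t)$ for $t\ge0$ and $L(t)=L^-(-t)$ for $t<0$. Let $\pi_0=\sum_i\delta_{U_i}$ be a Poisson point process (PPP) on $\mathbb{R}$ with intensity $e^{-u}du$; $\pi_+=\sum_i\delta_{(\tilde T_i^+,\tilde U_i^+)}$ a PPP on $(0,\infty)\times\mathbb{R}$ with intensity $\theta_+dt\times e^{-u}du$; $\pi_-=\sum_i\delta_{(\tilde T_i^-,\tilde U_i^-)}$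 a PPP on $(-\infty,0)\times\mathbb{R}$ with intensity $\theta_-dt\times e^{-u}du$ (a PPP with zero intensity is empty). Let $L_1,L_2,\ldots$ be copies of $L$, $\tilde L_1^+,\tilde L_2^+,\ldots$ copies of $L^+$, $\tilde L_1^-,\tilde L_2^-,\ldots$ copies of $L^-$, with $\pi_0,\pi_+,\pi_-,L_i,\tilde L_i^+,\tilde L_i^-$ ($i\in\mathbb{N}$) all independent. Define, for $t\in\mathbb{R}$: $V_i(t)=U_i+L_i(t)$; $\tilde V_i^+(t)=-\infty$ for $t<\tilde T_i^+$ and $\tilde V_i^+(t)=\tilde U_i^++\tilde L_i^+(t-\tilde T_i^+)$ for $t\ge\tilde T_i^+$; $\tilde V_i^-(t)=\tilde U_i^-+\tilde L_i^-(\tilde T_i^--t)$ for $t<\tilde T_i^-$ and $\tilde V_i^-(t)=-\infty$ for $t\ge\tilde T_i^-$. The Lévy–Brown–Resnick process is $\eta(t)=\max\{V_i(t),\tilde V_i^+(t),\tilde V_i^-(t)\colon i\in\mathbb{N}\}$, $t\in\mathbb{R}$. It is stationary and max-stable, and by max-stability $\Theta(T)$ exists. *)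

theory Defs
  imports "HOL-Probability.Probability"
begin

section \<open>Levy processes\<close>

definition cadlag :: "(real \<Rightarrow> 'b::topological_space) \<Rightarrow> bool" where
  "cadlag f \<longleftrightarrow> (\<forall>t\<ge>0. (f \<longlongrightarrow> f t) (at_right t) \<and> (t > 0 \<longrightarrow> (\<exists>l. (f \<longlongrightarrow> l) (at_left t))))"

definition caglad :: "(real \<Rightarrow> 'b::topological_space) \<Rightarrow> bool" where
  "caglad f \<longleftrightarrow> (\<forall>t\<ge>0. (\<exists>l. (f \<longlongrightarrow> l) (at_right t)) \<and> (t > 0 \<longrightarrow> (f \<longlongrightarrow> f t) (at_left t)))"

text \<open>The time parameter of the processes \<open>X t\<close> ranges over \<open>t \<ge> 0\<close>; values at negative times
  are never used. Stochastic continuity follows from the other clauses.\<close>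

definition levy_process :: "'a measure \<Rightarrow> (real \<Rightarrow> 'a \<Rightarrow> real) \<Rightarrow> bool" where
  "levy_process N X \<longleftrightarrow>
     prob_space N \<and>
     (\<forall>t\<ge>0. X t \<in> borel_measurable N) \<and>
     (AE w in N. X 0 w = 0) \<and>
     (\<forall>(t :: nat \<Rightarrow> real) n. 0 \<le> t 0 \<and> (\<forall>i<n. t i \<le> t (Suc i)) \<longrightarrow>
        prob_space.indep_vars N (\<lambda>_. borel) (\<lambda>i w. X (t (Suc i)) w - X (t i) w) {..<n}) \<and>
     (\<forall>s\<ge>0. \<forall>h\<ge>0. distr N borel (\<lambda>w. X (s + h) w - X s w) = distr N borel (X h)) \<and>
     (AE w in N. cadlag (\<lambda>t. X t w))"

definition no_positive_jumps :: "'a measure \<Rightarrow> (real \<Rightarrow> 'a \<Rightarrow> real) \<Rightarrow> bool" where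
  "no_positive_jumps N X \<longleftrightarrow>
     (AE w in N. \<forall>t>0. \<forall>l. ((\<lambda>s. X s w) \<longlongrightarrow> l) (at_left t) \<longrightarrow> X t w \<le> l)"

definition nonincreasing_paths :: "'a measure \<Rightarrow> (real \<Rightarrow> 'a \<Rightarrow> real) \<Rightarrow> bool" where
  "nonincreasing_paths N X \<longleftrightarrow> (AE w in N. \<forall>s t. 0 \<le> s \<longrightarrow> s \<le> t \<longrightarrow> X t w \<le> X s w)"

definition laplace_exponent :: "'a measure \<Rightarrow> (real \<Rightarrow> 'a \<Rightarrow> real) \<Rightarrow> real \<Rightarrow> real" where
  "laplace_exponent N X u = ln (\<integral>w. exp (u * X 1 w) \<partial>N)"

text \<open>For the Laplace exponent \<open>\<psi>\<close> of a spectrally negative Levy process whose paths are not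
  nonincreasing, \<open>largest_root \<psi>\<close> is \<open>\<psi>\<^sup>-\<^sup>1(0)\<close> and \<open>\<psi>\<close> maps \<open>{largest_root \<psi>..}\<close>
  bijectively onto \<open>{0..}\<close>.\<close>

definition largest_root :: "(real \<Rightarrow> real) \<Rightarrow> real" where
  "largest_root \<psi> = (GREATEST u. 0 \<le> u \<and> \<psi> u = 0)"

definition psi_inverse :: "(real \<Rightarrow> real) \<Rightarrow> real \<Rightarrow> real" where
  "psi_inverse \<psi> = the_inv_into {largest_root \<psi>..} \<psi>"


section \<open>Killed Levy processes\<close>

definition killing_time :: "real \<Rightarrow> ereal measure" where
  "killing_time \<theta> =
     (if \<theta> = 0 then return borel \<infinity>
      else distr (density lborel (exponential_density \<theta>)) borel ereal)"

definition killed :: "(real \<Rightarrow> 'a \<Rightarrow> real) \<Rightarrow> real \<Rightarrow> 'a \<times> ereal \<Rightarrow> ereal" where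
  "killed X t v = (if ereal t < snd v then ereal (X t (fst v)) else - \<infinity>)"

text \<open>\<open>Y\<close>, defined on \<open>M\<close>, has the law of \<open>X\<close>, defined on \<open>N\<close>, killed at rate \<open>\<theta>\<close>. Only
  finite-dimensional distributions enter, so this does not depend on whether the value at the killing
  time itself (or at a jump time) is the left or the right limit; regularity of the paths of \<open>Y\<close>
  is a separate requirement.\<close>

definition copy_of_killed ::
    "'w measure \<Rightarrow> (real \<Rightarrow> 'w \<Rightarrow> ereal) \<Rightarrow> 'a measure \<Rightarrow> (real \<Rightarrow> 'a \<Rightarrow> real) \<Rightarrow> real \<Rightarrow> bool" where
  "copy_of_killed M Y N X \<theta> \<longleftrightarrow>
     (\<forall>t\<ge>0. Y t \<in> borel_measurable M) \<and>
     distr M (PiM {0..} (\<lambda>_. borel)) (\<lambda>w. \<lambda>t\<in>{0..}. Y t w) =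
     distr (N \<Otimes>\<^sub>M killing_time \<theta>) (PiM {0..} (\<lambda>_. borel)) (\<lambda>v. \<lambda>t\<in>{0..}. killed X t v)"

text \<open>The subprobability kernel \<open>q\<^sub>t(x, dy) = e\<^bsup>-\<theta>t\<^esup> P(x + X(t) \<in> dy)\<close> on the reals.\<close>

definition killed_kernel ::
    "'a measure \<Rightarrow> (real \<Rightarrow> 'a \<Rightarrow> real) \<Rightarrow> real \<Rightarrow> real \<Rightarrow> real \<Rightarrow> real measure" where
  "killed_kernel N X \<theta> t x = scale_measure (ennreal (exp (- \<theta> * t))) (distr N borel (\<lambda>w. x + X t w))"

definition exp_intensity :: "real measure" where
  "exp_intensity = density lborel (\<lambda>u. ennreal (exp (- u)))"

text \<open>\<open>e\<^bsup>-x\<^esup> dx q'\<^sub>t(x, dy) = e\<^bsup>-y\<^esup> dy q\<^sub>t(y, dx)\<close> as measures in \<open>(x, y)\<close> on the plane, for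
  kernels \<open>q\<close>, \<open>q'\<close>.\<close>

definition dual_kernels ::
    "(real \<Rightarrow> real \<Rightarrow> real measure) \<Rightarrow> (real \<Rightarrow> real \<Rightarrow> real measure) \<Rightarrow> bool" where
  "dual_kernels q q' \<longleftrightarrow>
     (\<forall>t\<ge>0. \<forall>A\<in>sets (borel \<Otimes>\<^sub>M borel).
        (\<integral>\<^sup>+x. (\<integral>\<^sup>+y. indicator A (x, y) \<partial>q' t x) \<partial>exp_intensity) =
        (\<integral>\<^sup>+y. (\<integral>\<^sup>+x. indicator A (x, y) \<partial>q t y) \<partial>exp_intensity))"


section \<open>Poisson point processes\<close>

definition num_points :: "nat set \<Rightarrow> (nat \<Rightarrow> 'w \<Rightarrow> 's) \<Rightarrow> 's set \<Rightarrow> 'w \<Rightarrow> ennreal" where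
  "num_points I P B w = emeasure (count_space UNIV) {i\<in>I. P i w \<in> B}"

text \<open>\<open>\<Sum>\<^bsub>i\<in>I\<^esub> \<delta>\<^bsub>P i\<^esub>\<close> is a Poisson point process with intensity \<open>\<mu>\<close>.\<close>

definition poisson_point_process ::
    "'w measure \<Rightarrow> nat set \<Rightarrow> (nat \<Rightarrow> 'w \<Rightarrow> 's) \<Rightarrow> 's measure \<Rightarrow> bool" where
  "poisson_point_process M I P \<mu> \<longleftrightarrow>
     (\<forall>i\<in>I. P i \<in> measurable M \<mu>) \<and>
     (\<forall>B\<in>sets \<mu>. emeasure \<mu> B < \<infinity> \<longrightarrow>
        (\<forall>k::nat. measure M {w\<in>space M. num_points I P B w = of_nat k} =
                  measure \<mu> B ^ k / fact k * exp (- measure \<mu> B))) \<and>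
     (\<forall>B\<in>sets \<mu>. emeasure \<mu> B = \<infinity> \<longrightarrow> (AE w in M. num_points I P B w = \<infinity>)) \<and>
     (\<forall>B::nat \<Rightarrow> 's set. range B \<subseteq> sets \<mu> \<and> disjoint_family B \<longrightarrow>
        prob_space.indep_vars M (\<lambda>_. borel) (\<lambda>j. num_points I P (B j)) UNIV)"


section \<open>The Levy--Brown--Resnick process\<close>

text \<open>A Poisson process on a half-line times the reals with intensity \<open>\<theta> dt \<times> e\<^bsup>-u\<^esup> du\<close> has
  infinitely many points if \<open>\<theta> > 0\<close> and none if \<open>\<theta> = 0\<close>.\<close>

definition point_indices :: "real \<Rightarrow> nat set" where
  "point_indices \<theta> = (if \<theta> = 0 then {} else UNIV)"

definition birth_intensity :: "real \<Rightarrow> real set \<Rightarrow> (real \<times> real) measure" where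
  "birth_intensity \<theta> S = density (restrict_space lborel S) (\<lambda>_. ennreal \<theta>) \<Otimes>\<^sub>M exp_intensity"

definition two_sided :: "(real \<Rightarrow> 'w \<Rightarrow> ereal) \<Rightarrow> (real \<Rightarrow> 'w \<Rightarrow> ereal) \<Rightarrow> real \<Rightarrow> 'w \<Rightarrow> ereal" where
  "two_sided Lp Lm t w = (if t \<ge> 0 then Lp t w else Lm (- t) w)"

definition lbr_process ::
    "real \<Rightarrow> real \<Rightarrow> (nat \<Rightarrow> 'w \<Rightarrow> real) \<Rightarrow> (nat \<Rightarrow> 'w \<Rightarrow> real \<times> real) \<Rightarrow> (nat \<Rightarrow> 'w \<Rightarrow> real \<times> real) \<Rightarrow>
     (nat \<Rightarrow> real \<Rightarrow> 'w \<Rightarrow> ereal) \<Rightarrow> (nat \<Rightarrow> real \<Rightarrow> 'w \<Rightarrow> ereal) \<Rightarrow>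
     (nat \<Rightarrow> real \<Rightarrow> 'w \<Rightarrow> ereal) \<Rightarrow> (nat \<Rightarrow> real \<Rightarrow> 'w \<Rightarrow> ereal) \<Rightarrow> real \<Rightarrow> 'w \<Rightarrow> ereal" where
  "lbr_process \<theta>p \<theta>m U Bp Bm Lp Lm LBp LBm t w =
     (let V = (\<lambda>i. ereal (U i w) + two_sided (Lp i) (Lm i) t w);
          Vp = (\<lambda>i. case Bp i w of (T, u) \<Rightarrow> if t < T then - \<infinity> else ereal u + LBp i (t - T) w);
          Vm = (\<lambda>i. case Bm i w of (T, u) \<Rightarrow> if t < T then ereal u + LBm i (T - t) w else - \<infinity>)
      in Sup (range V \<union> Vp ` point_indices \<theta>p \<union> Vm ` point_indices \<theta>m))"

definition events_of :: "'w measure \<Rightarrow> 's measure \<Rightarrow> 'i set \<Rightarrow> ('i \<Rightarrow> 'w \<Rightarrow> 's) \<Rightarrow> 'w set set" where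
  "events_of M S J Y = sigma_sets (space M) {Y j -` A \<inter> space M | j A. j \<in> J \<and> A \<in> sets S}"

datatype ingredient =
    Points | Births_plus | Births_minus
  | Path_plus nat | Path_minus nat | Birth_path_plus nat | Birth_path_minus nat

text \<open>\<open>\<xi>\<close> is the generating Levy process and \<open>\<xi>'\<close> the Levy process which, killed at rate \<open>\<theta>p\<close>, has
  the dual kernel. \<open>U\<close>, \<open>Bp\<close>, \<open>Bm\<close> enumerate the points of the three Poisson processes, \<open>Lp\<close> and
  \<open>Lm\<close> are the two halves of the paths attached to the points of \<open>U\<close>, and \<open>LBp\<close>, \<open>LBm\<close> are the paths
  attached to the points of \<open>Bp\<close>, \<open>Bm\<close>. Independence of a Poisson process from the paths is
  independence of its whole enumeration, so that the paths are independent marks.\<close>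

locale levy_brown_resnick = prob_space M for M :: "'w measure" +
  fixes N :: "'a measure" and \<xi> :: "real \<Rightarrow> 'a \<Rightarrow> real"
    and N' :: "'b measure" and \<xi>' :: "real \<Rightarrow> 'b \<Rightarrow> real"
    and \<theta>p \<theta>m :: real
    and U :: "nat \<Rightarrow> 'w \<Rightarrow> real"
    and Bp Bm :: "nat \<Rightarrow> 'w \<Rightarrow> real \<times> real"
    and Lp Lm LBp LBm :: "nat \<Rightarrow> real \<Rightarrow> 'w \<Rightarrow> ereal"
  assumes rates: "0 \<le> \<theta>p" "0 \<le> \<theta>m"
    and levy: "levy_process N \<xi>"
    and levy_dual: "levy_process N' \<xi>'"
    and dual: "dual_kernels (killed_kernel N \<xi> \<theta>m) (killed_kernel N' \<xi>' \<theta>p)"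
    and ppp: "poisson_point_process M UNIV U exp_intensity"
    and ppp_plus: "poisson_point_process M (point_indices \<theta>p) Bp (birth_intensity \<theta>p {0<..})"
    and ppp_minus: "poisson_point_process M (point_indices \<theta>m) Bm (birth_intensity \<theta>m {..<0})"
    and law_Lp: "\<And>i. copy_of_killed M (Lp i) N \<xi> \<theta>m"
    and law_LBp: "\<And>i. copy_of_killed M (LBp i) N \<xi> \<theta>m"
    and law_Lm: "\<And>i. copy_of_killed M (Lm i) N' \<xi>' \<theta>p"
    and law_LBm: "\<And>i. copy_of_killed M (LBm i) N' \<xi>' \<theta>p"
    and paths_plus: "\<And>i w. w \<in> space M \<Longrightarrow> cadlag (\<lambda>t. Lp i t w) \<and> cadlag (\<lambda>t. LBp i t w)"
    and paths_minus: "\<And>i w. w \<in> space M \<Longrightarrow> caglad (\<lambda>t. Lm i t w) \<and> caglad (\<lambda>t. LBm i t w)"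
    and independent: "indep_sets (\<lambda>k. case k of
            Points \<Rightarrow> events_of M borel UNIV U
          | Births_plus \<Rightarrow> events_of M borel (point_indices \<theta>p) Bp
          | Births_minus \<Rightarrow> events_of M borel (point_indices \<theta>m) Bm
          | Path_plus i \<Rightarrow> events_of M borel {0..} (Lp i)
          | Path_minus i \<Rightarrow> events_of M borel {0..} (Lm i)
          | Birth_path_plus i \<Rightarrow> events_of M borel {0..} (LBp i)
          | Birth_path_minus i \<Rightarrow> events_of M borel {0..} (LBm i)) UNIV"

end

theory Submission
  imports Defs
begin

text \<open>
  On \<open>[0, T]\<close> only the paths issued from the points of \<open>U\<close> and of \<open>Bp\<close> matter, so the void probability
  of the marked Poisson processes gives
  \<open>\<theta>p (T - s) g(s) \<le> \<Theta>(T) \<le> g(T) + \<theta>p T g(\<infinity>)\<close>, where \<open>g(t)\<close> is the mean of the exponential of the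
  maximum over \<open>[0, t]\<close> of \<open>\<xi>\<close> killed at rate \<open>\<theta>m\<close>; for \<open>\<theta>p = 0\<close> one has \<open>\<Theta> = g\<close>.

  To evaluate \<open>g\<close>, put \<open>\<psi>(q) = \<theta>m\<close> and tilt by the martingale \<open>e\<^bsup>q\<xi>(t) - \<theta>m t\<^esup>\<close>. Along a dyadic grid the
  maximum increases only at records, where it equals \<open>\<xi>\<close>; hence \<open>g(t) - 1\<close> is the tilted mean of
  \<open>\<Sum> e\<^bsup>-qM\<^esup> \<Delta>e\<^bsup>M\<^esup>\<close>. As \<open>\<xi>\<close> has no positive jumps, \<open>M\<close> is continuous and the sum tends to
  \<open>\<integral> e\<^bsup>(1-q)s\<^esup> ds\<close> over \<open>[0, M(t)]\<close>. For \<open>q > 1\<close> this lies between \<open>(1 - e\<^bsup>-(q-1)\<xi>(t)\<^esup>)/(q - 1)\<close> and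
  \<open>1/(q - 1)\<close>, so \<open>g(\<infinity>) = q/(q - 1)\<close>. For \<open>q = 1\<close> it is \<open>M(t)\<close>, whose tilted mean is at least
  \<open>\<psi>'(1) t\<close> because \<open>M(t) \<ge> \<xi>(t)\<close>, and at most \<open>c t + O(1)\<close> for every \<open>c > \<psi>'(1)\<close>, by a second tilt.
\<close>


section \<open>Poisson point processes with independent marks\<close>

text \<open>All tilting is done under the original law: a tilted mean is an ordinary integral with
  the weight \<open>esscher\<close> in it, and continuous time enters only through dyadic grids, so
  neither a change of measure nor a stochastic integral is set up. The price is that finiteness of
  the exponential moments has to be proved by hand, from the tail of the maximum over a short
  interval.

  For the lower bound on Theta(T) only births up to T - s count, each followed for a time s; for the
  upper bound every birth is followed for ever. The slopes agree once s tends to infinity, and the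
  points of \<open>U\<close> contribute at most g(infinity), which division by T removes. If
  \<theta>p > 0, then \<psi>(1) < \<theta>m, hence q > 1 and g is bounded. If \<theta>p = 0, only
  \<open>U\<close> is left and q = 1 is the borderline at which the integral of e to the power (1 -
  q)s stops being bounded: g grows linearly, and its slope has to be squeezed between difference
  quotients of \<psi> on the two sides of 1.\<close>

lemma (in prob_space) poisson_pgf:
  fixes X :: "'a \<Rightarrow> ennreal"
  assumes [measurable]: "X \<in> borel_measurable M"
    and X: "\<And>k::nat. prob {w\<in>space M. X w = of_nat k} = m ^ k / fact k * exp (- m)"
    and "0 \<le> m" "0 \<le> c"
  shows "(\<integral>\<^sup>+w. (\<Sum>k. ennreal (c ^ k) * indicator {of_nat k} (X w)) \<partial>M) = ennreal (exp (- (m * (1 - c))))"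
proof -
  \<comment> \<open>The inner sum is \<open>c ^ X w\<close> where \<open>X w\<close> is a natural
    number and 0 elsewhere; it stands in for a power with an exponent in
    \<open>ennreal\<close>.\<close>
  have "(\<integral>\<^sup>+w. (\<Sum>k. ennreal (c ^ k) * indicator {of_nat k} (X w)) \<partial>M)
      = (\<Sum>k. \<integral>\<^sup>+w. ennreal (c ^ k) * indicator {of_nat k} (X w) \<partial>M)"
    by (subst nn_integral_suminf) auto
  also have "\<dots> = (\<Sum>k. ennreal (c ^ k * (m ^ k / fact k * exp (- m))))"
  proof (rule suminf_cong)
    fix k :: nat
    have "(\<integral>\<^sup>+w. ennreal (c ^ k) * indicator {of_nat k} (X w) \<partial>M)
       = (\<integral>\<^sup>+w. ennreal (c ^ k) * indicator {w\<in>space M. X w = of_nat k} w \<partial>M)"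
      by (intro nn_integral_cong) (auto simp: indicator_def)
    also have "\<dots> = ennreal (c ^ k) * emeasure M {w\<in>space M. X w = of_nat k}"
      by (subst nn_integral_cmult_indicator) auto
    also have "\<dots> = ennreal (c ^ k * (m ^ k / fact k * exp (- m)))"
      using assms(3,4) X[of k] by (simp only: emeasure_eq_measure) (rule ennreal_mult[symmetric], auto)
    finally show "(\<integral>\<^sup>+w. ennreal (c ^ k) * indicator {of_nat k} (X w) \<partial>M) = ennreal (c ^ k * (m ^ k / fact k * exp (- m)))" .
  qed
  also have "\<dots> = ennreal (exp (- (m * (1 - c))))"
  proof (rule suminf_ennreal_eq)
    have "(\<lambda>k. (c * m) ^ k /\<^sub>R fact k) sums exp (c * m)" by (rule exp_converges)
    then have "(\<lambda>k. exp (- m) * ((c * m) ^ k /\<^sub>R fact k)) sums (exp (- m) * exp (c * m))" by (rule sums_mult)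
    then show "(\<lambda>k. c ^ k * (m ^ k / fact k * exp (- m))) sums exp (- (m * (1 - c)))"
      by (simp add: exp_add[symmetric] algebra_simps power_mult_distrib divide_inverse)
  qed (use assms(3,4) in auto)
  finally show ?thesis .
qed

text \<open>At \<open>c = 1\<close> the generating function is the probability that \<open>X\<close>
  is a natural number, and its value there is \<open>exp 0\<close>.\<close>

lemma (in prob_space) poisson_finite_AE:
  fixes X :: "'a \<Rightarrow> ennreal"
  assumes [measurable]: "X \<in> borel_measurable M"
    and X: "\<And>k::nat. prob {w\<in>space M. X w = of_nat k} = m ^ k / fact k * exp (- m)"
    and "0 \<le> m"
  shows "AE w in M. \<exists>k::nat. X w = of_nat k"
proof -
  have "1 = (\<integral>\<^sup>+w. (\<Sum>k. ennreal (1 ^ k) * indicator {of_nat k} (X w)) \<partial>M)"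
    by (subst poisson_pgf[OF assms]) auto
  also have "\<dots> = (\<integral>\<^sup>+w. indicator {w\<in>space M. \<exists>k::nat. X w = of_nat k} w \<partial>M)"
  proof (intro nn_integral_cong)
    fix w assume w: "w \<in> space M"
    show "(\<Sum>k. ennreal (1 ^ k) * indicator {of_nat k} (X w)) = (indicator {w\<in>space M. \<exists>k::nat. X w = of_nat k} w :: ennreal)"
    proof (cases "\<exists>k::nat. X w = of_nat k")
      case True
      then obtain j :: nat where j: "X w = of_nat j" by auto
      have "(\<Sum>k. ennreal (1 ^ k) * indicator {of_nat k} (X w)) = (\<Sum>k\<in>{j}. ennreal (1 ^ k) * indicator {of_nat k} (X w))"
        by (rule suminf_finite) (auto simp: j indicator_def)
      then show ?thesis using w j by auto
    qed (auto simp: indicator_def)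
  qed
  also have "\<dots> = emeasure M {w\<in>space M. \<exists>k::nat. X w = of_nat k}"
    by (rule nn_integral_indicator) measurable
  finally have "emeasure M {w\<in>space M. \<exists>k::nat. X w = of_nat k} = 1" by simp
  then have "prob {w\<in>space M. \<exists>k::nat. X w = of_nat k} = 1" by (simp add: emeasure_eq_measure)
  then show ?thesis by (subst (asm) prob_Collect_eq_1) auto
qed

text \<open>Almost surely each \<open>B j\<close> contains finitely many points, so the products
  over the first \<open>n\<close> points become constant in \<open>n\<close>. Dominated convergence,
  independence of the counts and \<open>poisson_pgf\<close> do the rest. The limit in
  \<open>n\<close> stands for the product over all points.\<close>

lemma (in prob_space) poisson_laplace_finite:
  fixes c :: "nat \<Rightarrow> real"
  assumes ppp: "poisson_point_process M UNIV P \<mu>"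
    and B: "range B \<subseteq> sets \<mu>" "disjoint_family B" "\<And>j. emeasure \<mu> (B j) < \<infinity>"
    and c: "\<And>j. 0 \<le> c j" "\<And>j. c j \<le> 1"
  shows "(\<lambda>n. \<integral>\<^sup>+w. ennreal (\<Prod>i<n. \<Prod>j<k. if P i w \<in> B j then c j else 1) \<partial>M)
    \<longlonglongrightarrow> ennreal (exp (- (\<Sum>j<k. measure \<mu> (B j) * (1 - c j))))"
proof -
  let ?F = "\<lambda>n w. \<Prod>i<n. \<Prod>j<k. if P i w \<in> B j then c j else 1"
  let ?N = "\<lambda>j. num_points UNIV P (B j)"
  let ?H = "\<lambda>j (x::ennreal). (\<Sum>k. ennreal (c j ^ k) * indicator {of_nat k} x)"
  have P[measurable]: "P i \<in> measurable M \<mu>" for i using ppp by (auto simp: poisson_point_process_def)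
  have Bm[measurable]: "B j \<in> sets \<mu>" for j using B by auto
  have ind: "indep_vars (\<lambda>_. borel) ?N UNIV"
    using ppp B by (auto simp: poisson_point_process_def)
  then have Nm[measurable]: "?N j \<in> borel_measurable M" for j by (auto simp: indep_vars_def)
  have Np: "prob {w\<in>space M. ?N j w = of_nat k} = measure \<mu> (B j) ^ k / fact k * exp (- measure \<mu> (B j))" for j k
    using ppp B by (auto simp: poisson_point_process_def)
  have "(\<lambda>n. \<integral>\<^sup>+w. ennreal (?F n w) \<partial>M)
     \<longlonglongrightarrow> (\<integral>\<^sup>+w. (\<Prod>j<k. ?H j (?N j w)) \<partial>M)"
  proof (rule nn_integral_dominated_convergence[where w="\<lambda>_. 1"])
    show "AE w in M. ennreal (?F n w) \<le> 1" for n
      using c by (auto intro!: AE_I2 prod_le_1 prod_nonneg)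
    have "AE w in M. \<forall>j. \<exists>k::nat. ?N j w = of_nat k"
      unfolding AE_all_countable by (intro allI poisson_finite_AE[OF _ Np]) auto
    then show "AE w in M. (\<lambda>n. ennreal (?F n w)) \<longlonglongrightarrow> (\<Prod>j<k. ?H j (?N j w))"
    proof eventually_elim
      fix w assume "\<forall>j. \<exists>k::nat. ?N j w = of_nat k"
      then obtain q where q: "\<And>j. ?N j w = of_nat (q j)" by metis
      have fin: "finite {i. P i w \<in> B j}" and card: "card {i. P i w \<in> B j} = q j" for j
      proof -
        show f: "finite {i. P i w \<in> B j}"
        proof (rule ccontr)
          assume "infinite {i. P i w \<in> B j}"
          then have "?N j w = \<infinity>" by (simp add: num_points_def)
          then show False using q[of j] by simp
        qed
        show "card {i. P i w \<in> B j} = q j"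
          using q[of j] f by (simp add: num_points_def)
      qed
      have H: "?H j (?N j w) = ennreal (c j ^ q j)" for j
      proof -
        have "?H j (?N j w) = (\<Sum>k\<in>{q j}. ennreal (c j ^ k) * indicator {of_nat k} (?N j w))"
          by (rule suminf_finite) (auto simp: q indicator_def)
        then show ?thesis by (simp add: q)
      qed
      have "(\<lambda>n. (?F n w)) \<longlonglongrightarrow> (\<Prod>j<k. c j ^ q j)"
      proof -
        have "(\<lambda>n. \<Prod>j<k. \<Prod>i<n. if P i w \<in> B j then c j else 1) \<longlonglongrightarrow> (\<Prod>j<k. c j ^ q j)"
        proof (intro tendsto_prod tendsto_eventually)
          fix j
          obtain n0 where n0: "{i. P i w \<in> B j} \<subseteq> {..<n0}"
            using fin[of j] by (meson finite_nat_bounded lessThan_iff)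
          have "(\<Prod>i<n. if P i w \<in> B j then c j else 1) = c j ^ q j" if "n \<ge> n0" for n
          proof -
            have "(\<Prod>i<n. if P i w \<in> B j then c j else 1) = (\<Prod>i\<in>{i. P i w \<in> B j}. c j)"
              using n0 that by (intro prod.mono_neutral_cong_right) auto
            then show ?thesis by (simp add: card)
          qed
          then show "\<forall>\<^sub>F n in sequentially. (\<Prod>i<n. if P i w \<in> B j then c j else 1) = c j ^ q j"
            by (auto simp: eventually_sequentially)
        qed
        moreover have "(?F n w) = (\<Prod>j<k. \<Prod>i<n. if P i w \<in> B j then c j else 1)" for n
          by (rule prod.swap)
        ultimately show ?thesis by simp
      qed
      then have "(\<lambda>n. ennreal (?F n w)) \<longlonglongrightarrow> ennreal (\<Prod>j<k. c j ^ q j)"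
        by (rule tendsto_ennrealI)
      also have "ennreal (\<Prod>j<k. c j ^ q j) = (\<Prod>j<k. ?H j (?N j w))"
        unfolding H using c by (simp add: prod_ennreal)
      finally show "(\<lambda>n. ennreal (?F n w)) \<longlonglongrightarrow> (\<Prod>j<k. ?H j (?N j w))" .
    qed
  qed (auto simp: emeasure_space_1)
  also have "(\<integral>\<^sup>+w. (\<Prod>j<k. ?H j (?N j w)) \<partial>M) = (\<Prod>j<k. \<integral>\<^sup>+w. ?H j (?N j w) \<partial>M)"
  proof (rule indep_vars_nn_integral)
    have "indep_vars (\<lambda>_. borel) (\<lambda>j. ?H j \<circ> ?N j) {..<k}"
      by (rule indep_vars_compose[OF indep_vars_subset[OF ind]]) auto
    then show "indep_vars (\<lambda>_. borel) (\<lambda>j w. ?H j (?N j w)) {..<k}" by (simp add: comp_def)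
  qed auto
  also have "\<dots> = (\<Prod>j<k. ennreal (exp (- (measure \<mu> (B j) * (1 - c j)))))"
    using c by (intro prod.cong refl poisson_pgf[OF _ Np]) auto
  also have "\<dots> = ennreal (exp (- (\<Sum>j<k. measure \<mu> (B j) * (1 - c j))))"
    by (simp add: prod_ennreal exp_sum flip: sum_negf)
  finally show ?thesis .
qed

lemma (in prob_space) poisson_laplace_simple:
  fixes f :: "'s \<Rightarrow> real"
  assumes ppp: "poisson_point_process M UNIV P \<mu>"
    and f: "simple_function \<mu> f" "\<And>p. 0 \<le> f p" "\<And>p. f p \<le> 1"
    and fin: "emeasure \<mu> {p\<in>space \<mu>. f p \<noteq> 1} < \<infinity>"
    and v: "(\<integral>\<^sup>+p. ennreal (1 - f p) \<partial>\<mu>) = ennreal v" "0 \<le> v"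
  shows "(\<lambda>n. \<integral>\<^sup>+w. ennreal (\<Prod>i<n. f (P i w)) \<partial>M) \<longlonglongrightarrow> ennreal (exp (- v))"
proof -
  have P[measurable]: "P i \<in> measurable M \<mu>" for i using ppp by (auto simp: poisson_point_process_def)
  have fm: "f -` {a} \<inter> space \<mu> \<in> sets \<mu>" for a using f(1) by (auto dest: simple_functionD)
  define C where "C = f ` space \<mu> - {1}"
  have "finite C" using f(1) by (auto simp: C_def simple_function_def)
  then obtain h :: "nat \<Rightarrow> real" where h: "bij_betw h {..<card C} C"
    using ex_bij_betw_nat_finite by (metis lessThan_atLeast0)
  define k where "k = card C"
  \<comment> \<open>The level sets of \<open>f\<close> with values other than 1 come first; the
    sequences are then padded with the value 1 and the empty set, because the previous lemma takes
    families indexed by all naturals.\<close>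
  define c where "c j = (if j < k then h j else 1)" for j
  define B where "B j = (if j < k then f -` {h j} \<inter> space \<mu> else {})" for j
  have hC: "h j \<in> C" if "j < k" for j using h that by (auto simp: bij_betw_def k_def)
  have hinj: "h i = h j \<Longrightarrow> i = j" if "i < k" "j < k" for i j
    using h that by (auto simp: bij_betw_def k_def inj_on_def)
  have Bfin: "emeasure \<mu> (B j) < \<infinity>" for j
  proof -
    have "emeasure \<mu> (B j) \<le> emeasure \<mu> {p\<in>space \<mu>. f p \<noteq> 1}"
    proof (rule emeasure_mono)
      show "B j \<subseteq> {p\<in>space \<mu>. f p \<noteq> 1}" using hC by (auto simp: B_def C_def)
      have "f \<in> borel_measurable \<mu>" using f(1) by (rule borel_measurable_simple_function)
      then show "{p\<in>space \<mu>. f p \<noteq> 1} \<in> sets \<mu>" by measurable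
    qed
    then show ?thesis using fin by (rule le_less_trans)
  qed
  have Bs: "range B \<subseteq> sets \<mu>" using fm by (auto simp: B_def)
  have Bd: "disjoint_family B" by (auto simp: disjoint_family_on_def B_def dest: hinj)
  have c01: "0 \<le> c j" "c j \<le> 1" for j
    using f(2,3) hC[of j] by (auto simp: c_def C_def)
  have fB: "f p = (\<Prod>j<k. if p \<in> B j then c j else 1)" 
      and fB': "ennreal (1 - f p) = (\<Sum>j<k. ennreal (1 - c j) * indicator (B j) p)" if p: "p \<in> space \<mu>" for p
  proof -
    have *: "f p = (\<Prod>j<k. if p \<in> B j then c j else 1) \<and> ennreal (1 - f p) = (\<Sum>j<k. ennreal (1 - c j) * indicator (B j) p)"
    proof (cases "f p = 1")
      case True
      then have "p \<notin> B j" for j using hC by (auto simp: B_def C_def)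
      then show ?thesis using True by simp
    next
      case False
      then have "f p \<in> C" using p by (auto simp: C_def)
      then obtain j where j: "j < k" "h j = f p" using h by (force simp: bij_betw_def k_def)
      have pB: "p \<in> B i \<longleftrightarrow> i = j" if "i < k" for i
        using j p that hinj[of i j] by (auto simp: B_def)
      have "(\<Prod>i<k. if p \<in> B i then c i else 1) = (\<Prod>i<k. if i = j then c j else 1)"
        by (intro prod.cong) (auto simp: pB)
      moreover have "(\<Sum>i<k. ennreal (1 - c i) * indicator (B i) p) = (\<Sum>i<k. if i = j then ennreal (1 - c j) else 0)"
        by (intro sum.cong) (auto simp: pB)
      ultimately show ?thesis using j by (simp add: c_def)
    qed
    show "f p = (\<Prod>j<k. if p \<in> B j then c j else 1)" "ennreal (1 - f p) = (\<Sum>j<k. ennreal (1 - c j) * indicator (B j) p)"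
      using * by auto
  qed
  have "ennreal v = (\<integral>\<^sup>+p. (\<Sum>j<k. ennreal (1 - c j) * indicator (B j) p) \<partial>\<mu>)"
    unfolding v(1)[symmetric] by (intro nn_integral_cong fB')
  also have "\<dots> = (\<Sum>j<k. ennreal (1 - c j) * emeasure \<mu> (B j))"
    using Bs by (subst nn_integral_sum) (auto simp: nn_integral_cmult_indicator intro!: borel_measurable_times borel_measurable_indicator)
  also have "\<dots> = (\<Sum>j<k. ennreal (measure \<mu> (B j) * (1 - c j)))"
    using Bfin c01 by (intro sum.cong) (auto simp: emeasure_eq_ennreal_measure ennreal_mult' mult.commute less_top)
  also have "\<dots> = ennreal (\<Sum>j<k. measure \<mu> (B j) * (1 - c j))"
    using c01 by (intro sum_ennreal) auto
  finally have "v = (\<Sum>j<k. measure \<mu> (B j) * (1 - c j))"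
    using v(2) c01 by (simp add: sum_nonneg)
  moreover have "(\<integral>\<^sup>+w. ennreal (\<Prod>i<n. f (P i w)) \<partial>M) = (\<integral>\<^sup>+w. ennreal (\<Prod>i<n. \<Prod>j<k. if P i w \<in> B j then c j else 1) \<partial>M)" for n
    by (intro nn_integral_cong) (simp add: fB[OF measurable_space[OF P]] cong: prod.cong)
  ultimately show ?thesis
    using poisson_laplace_finite[OF ppp Bs Bd Bfin c01, where k=k] by simp
qed

text \<open>Simple functions supported on sets of finite measure increase to \<open>1 - f\<close>,
  so the functions \<open>g j\<close>, covered by the simple case, decrease to \<open>f\<close>. Two
  limits must be exchanged, over the points \<open>n\<close> and over the approximation
  \<open>j\<close>; both are decreasing, hence infima, and these commute.\<close>

lemma (in prob_space) poisson_laplace: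
  fixes f :: "'s \<Rightarrow> real"
  assumes ppp: "poisson_point_process M UNIV P \<mu>"
    and sf: "sigma_finite_measure \<mu>"
    and f: "f \<in> borel_measurable \<mu>" "\<And>p. 0 \<le> f p" "\<And>p. f p \<le> 1"
    and v: "(\<integral>\<^sup>+p. ennreal (1 - f p) \<partial>\<mu>) = ennreal v" "0 \<le> v"
  shows "(\<lambda>n. \<integral>\<^sup>+w. ennreal (\<Prod>i<n. f (P i w)) \<partial>M) \<longlonglongrightarrow> ennreal (exp (- v))"
proof -
  have P[measurable]: "P i \<in> measurable M \<mu>" for i using ppp by (auto simp: poisson_point_process_def)
  note f(1)[measurable]
  interpret sigma_finite_measure \<mu> by fact
  obtain A :: "nat \<Rightarrow> 's set" where A: "range A \<subseteq> sets \<mu>" "(\<Union>i. A i) = space \<mu>"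
      "\<And>i. emeasure \<mu> (A i) \<noteq> \<infinity>" "incseq A"
    by (rule sigma_finite_incseq) blast
  have Am[measurable]: "A i \<in> sets \<mu>" for i using A by auto
  have "(\<lambda>p. ennreal (1 - f p)) \<in> borel_measurable \<mu>" by measurable
  from borel_measurable_implies_simple_function_sequence'[OF this]
  obtain s where s: "\<And>i. simple_function \<mu> (s i)" "incseq s" "\<And>i x. s i x < top"
    "\<And>x. (SUP i. s i x) = ennreal (1 - f x)" by blast
  define t where "t j p = s j p * indicator (A j) p" for j p
  have t_simple: "simple_function \<mu> (t j)" for j
    unfolding t_def by (intro simple_function_mult s simple_function_indicator) auto
  have t_inc: "incseq t"
    unfolding incseq_def le_fun_def t_def
    by (intro allI impI mult_mono) (use s(2) A(4) in \<open>auto simp: incseq_def le_fun_def indicator_def subset_iff\<close>)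
  have t_le: "t j p \<le> ennreal (1 - f p)" for j p
    using SUP_upper[of j UNIV "\<lambda>i. s i p"] by (auto simp: t_def s(4) indicator_def)
  then have t_le1: "t j p \<le> 1" for j p
    by (rule order_trans) (use f(2)[of p] in simp)
  have t_lim: "(\<lambda>j. t j p) \<longlonglongrightarrow> ennreal (1 - f p)" if p: "p \<in> space \<mu>" for p
  proof -
    obtain i where i: "p \<in> A i" using A(2) p by auto
    have "(\<lambda>j. s j p) \<longlonglongrightarrow> ennreal (1 - f p)"
      using LIMSEQ_SUP[of "\<lambda>j. s j p"] s(2) by (auto simp: s(4) incseq_def le_fun_def)
    moreover have "\<forall>\<^sub>F j in sequentially. t j p = s j p"
      using eventually_ge_at_top[of i] 
    proof eventually_elim
      case (elim j)
      then have "p \<in> A j" using i A(4) by (auto simp: incseq_def)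
      then show ?case by (simp add: t_def)
    qed
    ultimately show ?thesis by (simp add: tendsto_cong)
  qed
  define g where "g j p = 1 - enn2real (t j p)" for j p
  have t_real: "enn2real (t j p) \<le> 1 - f p" for j p
    using t_le[of j p] f(3)[of p] by (metis diff_ge_0_iff_ge enn2real_leI)
  have t_top: "t j p < top" for j p using t_le1[of j p] by (rule le_less_trans) simp
  have g01: "0 \<le> g j p" "g j p \<le> 1" for j p
    using t_real[of j p] f(2)[of p] by (auto simp: g_def)
  have eg: "ennreal (1 - g j p) = t j p" for j p
    using t_top[of j p] by (simp add: g_def)
  have t_mono: "t j p \<le> t j' p" if "j \<le> j'" for j j' p
    using t_inc that by (auto simp: incseq_def le_fun_def)
  have g_dec: "g j' p \<le> g j p" if "j \<le> j'" for j j' p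
    using t_mono[OF that, of p] t_top by (simp add: g_def enn2real_mono)
  have g_lim: "(\<lambda>j. g j p) \<longlonglongrightarrow> f p" if "p \<in> space \<mu>" for p
  proof -
    have "(\<lambda>j. enn2real (t j p)) \<longlonglongrightarrow> 1 - f p"
      using t_lim[OF that] f(3)[of p] by (intro tendsto_enn2real) auto
    from tendsto_diff[OF tendsto_const[of 1] this] show ?thesis by (simp add: g_def)
  qed
  have g_simple: "simple_function \<mu> (g j)" for j
    unfolding g_def by (rule simple_function_compose1[OF t_simple, where g="\<lambda>x. 1 - enn2real x"])
  then have [measurable]: "g j \<in> borel_measurable \<mu>" for j by (rule borel_measurable_simple_function)
  define V where "V j = enn2real (\<integral>\<^sup>+p. t j p \<partial>\<mu>)" for j
  have "(\<integral>\<^sup>+p. t j p \<partial>\<mu>) \<le> ennreal v" for j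
    unfolding v(1)[symmetric] by (intro nn_integral_mono t_le)
  then have V: "(\<integral>\<^sup>+p. ennreal (1 - g j p) \<partial>\<mu>) = ennreal (V j)" for j
    unfolding eg V_def by (metis ennreal_enn2real ennreal_less_top le_less_trans)
  have "(\<lambda>j. ennreal (V j)) \<longlonglongrightarrow> ennreal v"
    unfolding v(1)[symmetric] V[symmetric] eg
    by (rule nn_integral_dominated_convergence[where w="\<lambda>p. ennreal (1 - f p)"])
      (use t_lim t_simple t_le v in \<open>auto simp: borel_measurable_simple_function\<close>)
  then have "V \<longlonglongrightarrow> v"
    using v(2) by (subst (asm) tendsto_ennreal_iff) (auto simp: V_def)
  then have lim_exp: "(\<lambda>j. ennreal (exp (- V j))) \<longlonglongrightarrow> ennreal (exp (- v))"
    by (intro tendsto_ennrealI tendsto_exp tendsto_minus)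
  define a where "a n j = (\<integral>\<^sup>+w. ennreal (\<Prod>i<n. g j (P i w)) \<partial>M)" for n j
  have dec_j: "decseq (a n)" for n
    unfolding a_def decseq_def
    by (intro allI impI nn_integral_mono ennreal_leI prod_mono conjI g_dec g01)
  have prod_dec: "(\<Prod>i<Suc n. h i) \<le> (\<Prod>i<n. h i)" if "\<And>i. 0 \<le> h i" "\<And>i. h i \<le> 1" for n and h :: "nat \<Rightarrow> real"
    using that by (simp add: mult_left_le prod_nonneg)
  have dec_n: "decseq (\<lambda>n. a n j)" for j
    unfolding a_def by (intro decseq_SucI nn_integral_mono ennreal_leI prod_dec g01)
  have dec: "decseq (\<lambda>n. \<integral>\<^sup>+w. ennreal (\<Prod>i<n. f (P i w)) \<partial>M)"
    by (intro decseq_SucI nn_integral_mono ennreal_leI prod_dec f)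
  have lim_n: "(\<lambda>n. a n j) \<longlonglongrightarrow> ennreal (exp (- V j))" for j
    unfolding a_def
  proof (rule poisson_laplace_simple[OF ppp g_simple g01 _ V])
    have "emeasure \<mu> {p \<in> space \<mu>. g j p \<noteq> 1} \<le> emeasure \<mu> (A j)"
      by (intro emeasure_mono) (auto simp: g_def t_def indicator_def split: if_splits)
    then show "emeasure \<mu> {p \<in> space \<mu>. g j p \<noteq> 1} < \<infinity>"
      using A(3)[of j] by (simp add: le_less_trans less_top)
    show "0 \<le> V j" by (simp add: V_def)
  qed
  have lim_j: "a n \<longlonglongrightarrow> (\<integral>\<^sup>+w. ennreal (\<Prod>i<n. f (P i w)) \<partial>M)" for n
    unfolding a_def
  proof (rule nn_integral_dominated_convergence[where w="\<lambda>_. 1"])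
    show "AE w in M. ennreal (\<Prod>i<n. g j (P i w)) \<le> 1" for j
      using g01 by (auto intro!: AE_I2 prod_le_1)
    show "AE w in M. (\<lambda>j. ennreal (\<Prod>i<n. g j (P i w))) \<longlonglongrightarrow> ennreal (\<Prod>i<n. f (P i w))"
      by (intro AE_I2 tendsto_ennrealI tendsto_prod g_lim measurable_space[OF P])
  qed (auto simp: emeasure_space_1)
  have "(INF n. \<integral>\<^sup>+w. ennreal (\<Prod>i<n. f (P i w)) \<partial>M) = (INF n. INF j. a n j)"
    using LIMSEQ_unique[OF LIMSEQ_INF[OF dec_j] lim_j] by simp
  also have "\<dots> = (INF j. INF n. a n j)" by (rule INF_commute)
  also have "\<dots> = (INF j. ennreal (exp (- V j)))"
    using LIMSEQ_unique[OF LIMSEQ_INF[OF dec_n] lim_n] by simp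
  also have "\<dots> = ennreal (exp (- v))"
  proof -
    have "ennreal (exp (- V j)) = (INF n. a n j)" for j
      using LIMSEQ_unique[OF LIMSEQ_INF[OF dec_n] lim_n] by simp
    then have "decseq (\<lambda>j. ennreal (exp (- V j)))"
      using dec_j by (simp add: decseq_def INF_mono')
    from LIMSEQ_unique[OF LIMSEQ_INF[OF this] lim_exp] show ?thesis .
  qed
  finally show ?thesis using LIMSEQ_INF[OF dec] by simp
qed

text \<open>Given the points, the marks are independent with law \<open>\<nu>\<close>, so pair
  \<open>i\<close> avoids \<open>K\<close> with probability \<open>f (P i)\<close>, where
  \<open>f p\<close> is the mass outside the section of \<open>K\<close> at \<open>p\<close>. The
  void probability is therefore the Laplace functional of the unmarked process at \<open>f\<close>,
  and the marked process itself need not be shown to be Poisson.\<close>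

lemma (in prob_space) marked_poisson_void:
  fixes Z :: "nat \<Rightarrow> 'a \<Rightarrow> ereal" and P :: "nat \<Rightarrow> 'a \<Rightarrow> 's"
  assumes ppp: "poisson_point_process M UNIV P \<mu>"
    and sf: "sigma_finite_measure \<mu>"
    and Z: "indep_vars (\<lambda>_. borel) Z UNIV" "\<And>i. distr M borel (Z i) = \<nu>"
    and ind: "distr M (PiM UNIV (\<lambda>_. \<mu>) \<Otimes>\<^sub>M PiM UNIV (\<lambda>_. borel)) (\<lambda>w. (\<lambda>i. P i w, \<lambda>i. Z i w))
      = distr M (PiM UNIV (\<lambda>_. \<mu>)) (\<lambda>w i. P i w) \<Otimes>\<^sub>M distr M (PiM UNIV (\<lambda>_. borel)) (\<lambda>w i. Z i w)"
    and K[measurable]: "K \<in> sets (\<mu> \<Otimes>\<^sub>M borel)"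
    and v: "(\<integral>\<^sup>+p. emeasure \<nu> {z. (p, z) \<in> K} \<partial>\<mu>) = ennreal v" "0 \<le> v"
  shows "prob {w\<in>space M. \<forall>i. (P i w, Z i w) \<notin> K} = exp (- v)"
proof -
  let ?A = "\<lambda>n. {w\<in>space M. \<forall>i<n. (P i w, Z i w) \<notin> K}"
  have [measurable]: "P i \<in> measurable M \<mu>" for i using ppp by (auto simp: poisson_point_process_def)
  have Zm[measurable]: "Z i \<in> borel_measurable M" for i using Z(1) by (auto simp: indep_vars_def)
  have sets_\<nu>[measurable_cong]: "sets \<nu> = sets borel" using Z(2)[of 0, symmetric] by simp
  interpret \<nu>: prob_space \<nu> unfolding Z(2)[of 0, symmetric] by (rule prob_space_distr) simp
  have sl: "{z. (p, z) \<in> K} \<in> sets \<nu>" for p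
    using sets_Pair1[OF K, of p] by (simp add: sets_\<nu> vimage_def)
  have sp: "space \<nu> = UNIV" using sets_eq_imp_space_eq[OF sets_\<nu>] by simp
  define f where "f p = 1 - measure \<nu> {z. (p, z) \<in> K}" for p
  have f01: "0 \<le> f p" "f p \<le> 1" for p by (auto simp: f_def)
  have fc: "ennreal (f p) = (\<integral>\<^sup>+z. indicator (- K) (p, z) \<partial>\<nu>)" for p
  proof -
    have "f p = measure \<nu> (space \<nu> - {z. (p, z) \<in> K})" using sl by (simp add: f_def \<nu>.prob_compl)
    then have "ennreal (f p) = emeasure \<nu> (space \<nu> - {z. (p, z) \<in> K})" by (simp add: \<nu>.emeasure_eq_measure)
    also have "\<dots> = (\<integral>\<^sup>+z. indicator (space \<nu> - {z. (p, z) \<in> K}) z \<partial>\<nu>)"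
      using sl by (intro nn_integral_indicator[symmetric] sets.Diff) auto
    also have "\<dots> = (\<integral>\<^sup>+z. indicator (- K) (p, z) \<partial>\<nu>)"
      by (intro nn_integral_cong) (auto simp: indicator_def sp)
    finally show ?thesis .
  qed
  have m1: "(\<lambda>p. emeasure \<nu> {z. (p, z) \<in> K}) \<in> borel_measurable \<mu>"
  proof -
    have "K \<in> sets (\<mu> \<Otimes>\<^sub>M \<nu>)" using K by (simp cong: sets_pair_measure_cong add: sets_\<nu>)
    from \<nu>.measurable_emeasure_Pair[OF this] show ?thesis by (simp add: vimage_def)
  qed
  then have fm[measurable]: "f \<in> borel_measurable \<mu>"
    unfolding f_def measure_def by measurable
  have "(\<integral>\<^sup>+p. ennreal (1 - f p) \<partial>\<mu>) = ennreal v"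
    unfolding v(1)[symmetric] f_def by (simp add: \<nu>.emeasure_eq_measure)
  note lap = poisson_laplace[OF ppp sf fm f01 this v(2)]
  have "(\<integral>\<^sup>+w. ennreal (\<Prod>i<n. f (P i w)) \<partial>M) = emeasure M (?A n)" for n
  proof (cases "n = 0")
    case False
    define J where "J = {..<n}"
    have J: "finite J" "J \<noteq> {}" using False by (auto simp: J_def lessThan_empty_iff)
    let ?Ps = "\<lambda>w i. P i w" and ?Zs = "\<lambda>w i. Z i w"
    let ?Q = "distr M (PiM UNIV (\<lambda>_. \<mu>)) ?Ps" and ?R = "distr M (PiM UNIV (\<lambda>_. borel)) ?Zs"
    have [measurable]: "?Ps \<in> measurable M (PiM UNIV (\<lambda>_. \<mu>))"
      by (rule measurable_PiM_single') (auto simp: space_PiM PiE_iff intro: measurable_space[of _ M])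
    have Zsm[measurable]: "?Zs \<in> measurable M (PiM UNIV (\<lambda>_. borel))"
      by (rule measurable_PiM_single') auto
    interpret Q: prob_space ?Q by (rule prob_space_distr) measurable
    interpret R: prob_space ?R by (rule prob_space_distr) measurable
    have Km: "(\<lambda>x. indicator (- K) (fst x i, snd x i) :: ennreal) \<in> borel_measurable (PiM UNIV (\<lambda>_. \<mu>) \<Otimes>\<^sub>M PiM UNIV (\<lambda>_. borel))"
      if "i \<in> J" for i
    proof -
      have "(\<lambda>x. (fst x i, snd x i)) \<in> (PiM UNIV (\<lambda>_. \<mu>) \<Otimes>\<^sub>M PiM UNIV (\<lambda>_. borel)) \<rightarrow>\<^sub>M \<mu> \<Otimes>\<^sub>M (borel :: ereal measure)"
        by (intro measurable_Pair measurable_compose[OF measurable_fst] measurable_compose[OF measurable_snd]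
            measurable_component_singleton UNIV_I that)
      moreover have "(indicator (- K) :: _ \<Rightarrow> ennreal) \<in> borel_measurable (\<mu> \<Otimes>\<^sub>M borel)"
      proof -
        have "(indicator (- K) :: _ \<Rightarrow> ennreal) \<in> borel_measurable (\<mu> \<Otimes>\<^sub>M borel) \<longleftrightarrow>
          (indicator (space (\<mu> \<Otimes>\<^sub>M borel) - K) :: _ \<Rightarrow> ennreal) \<in> borel_measurable (\<mu> \<Otimes>\<^sub>M borel)"
          by (rule measurable_cong) (auto simp: indicator_def)
        then show ?thesis using K by (simp add: borel_measurable_indicator)
      qed
      ultimately show ?thesis by (rule measurable_compose)
    qed
    have setm: "(?A n) \<in> events" by measurable
    have "emeasure M (?A n)
       = (\<integral>\<^sup>+w. (\<Prod>i\<in>J. indicator (- K) (P i w, Z i w)) \<partial>M)"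
    proof -
      have "(\<integral>\<^sup>+w. (\<Prod>i\<in>J. indicator (- K) (P i w, Z i w)) \<partial>M) = (\<integral>\<^sup>+w. indicator (?A n) w \<partial>M)"
      proof (intro nn_integral_cong)
        fix w assume w: "w \<in> space M"
        show "(\<Prod>i\<in>J. indicator (- K) (P i w, Z i w)) = (indicator (?A n) w :: ennreal)"
          using w by (cases "\<forall>i<n. (P i w, Z i w) \<notin> K") (auto simp: J_def prod_zero_iff indicator_def intro!: prod.neutral)
      qed
      then show ?thesis using setm by simp
    qed
    also have "\<dots> = (\<integral>\<^sup>+x. (\<Prod>i\<in>J. indicator (- K) (fst x i, snd x i)) \<partial>distr M (PiM UNIV (\<lambda>_. \<mu>) \<Otimes>\<^sub>M PiM UNIV (\<lambda>_. borel)) (\<lambda>w. (?Ps w, ?Zs w)))"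
    proof -
      have "(\<lambda>w. (?Ps w, ?Zs w)) \<in> M \<rightarrow>\<^sub>M PiM UNIV (\<lambda>_. \<mu>) \<Otimes>\<^sub>M PiM UNIV (\<lambda>_. borel)" by measurable
      moreover have "(\<lambda>x. (\<Prod>i\<in>J. indicator (- K) (fst x i, snd x i)) :: ennreal)
          \<in> borel_measurable (PiM UNIV (\<lambda>_. \<mu>) \<Otimes>\<^sub>M PiM UNIV (\<lambda>_. borel))"
        by (intro borel_measurable_prod_ennreal Km)
      ultimately show ?thesis by (simp add: nn_integral_distr)
    qed
    \<comment> \<open>Points and marks are independent as whole sequences, so the joint law is a
      product and the marks can be integrated out first with the points frozen.\<close>
    also have "\<dots> = (\<integral>\<^sup>+p. \<integral>\<^sup>+z. (\<Prod>i\<in>J. indicator (- K) (p i, z i)) \<partial>?R \<partial>?Q)"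
    proof -
      have s: "sets (?Q \<Otimes>\<^sub>M ?R) = sets (PiM UNIV (\<lambda>_. \<mu>) \<Otimes>\<^sub>M PiM UNIV (\<lambda>_. borel))"
        by (intro sets_pair_measure_cong) auto
      have "(\<lambda>x. (\<Prod>i\<in>J. indicator (- K) (fst x i, snd x i)) :: ennreal) \<in> borel_measurable (?Q \<Otimes>\<^sub>M ?R)"
        unfolding measurable_cong_sets[OF s refl] by (intro borel_measurable_prod_ennreal Km)
      from R.nn_integral_fst[OF this] show ?thesis unfolding ind by simp
    qed
    also have "\<dots> = (\<integral>\<^sup>+p. (\<Prod>i\<in>J. ennreal (f (p i))) \<partial>?Q)"
    proof (intro nn_integral_cong)
      fix p
      have i1: "(\<lambda>z. indicator (- K) (q, z) :: ennreal) \<in> borel_measurable borel" for q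
      proof -
        have "(\<lambda>z. indicator (- K) (q, z) :: ennreal) = indicator (space \<nu> - {z. (q, z) \<in> K})"
          by (auto simp: indicator_def sp)
        also have "\<dots> \<in> borel_measurable \<nu>" using sl by (intro borel_measurable_indicator sets.Diff) auto
        finally show ?thesis by (simp cong: measurable_cong_sets add: sets_\<nu>)
      qed
      have "(\<lambda>z. (\<Prod>i\<in>J. indicator (- K) (p i, z i)) :: ennreal) \<in> borel_measurable (PiM UNIV (\<lambda>_. borel))"
      proof (rule borel_measurable_prod_ennreal)
        fix i :: nat
        have "(\<lambda>z. z i) \<in> measurable (PiM UNIV (\<lambda>_. borel)) (borel :: ereal measure)"
          by (rule measurable_component_singleton) simp
        from measurable_compose[OF this i1]
        show "(\<lambda>z. indicator (- K) (p i, z i) :: ennreal) \<in> borel_measurable (PiM UNIV (\<lambda>_. borel))" .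
      qed
      then have "(\<integral>\<^sup>+z. (\<Prod>i\<in>J. indicator (- K) (p i, z i)) \<partial>?R) = (\<integral>\<^sup>+w. (\<Prod>i\<in>J. indicator (- K) (p i, Z i w)) \<partial>M)"
        by (simp add: nn_integral_distr)
      also have "\<dots> = (\<Prod>i\<in>J. \<integral>\<^sup>+w. indicator (- K) (p i, Z i w) \<partial>M)"
      proof (rule indep_vars_nn_integral[OF J(1)])
        have "indep_vars (\<lambda>_. borel) (\<lambda>i. (\<lambda>z. indicator (- K) (p i, z) :: ennreal) \<circ> Z i) J"
          by (rule indep_vars_compose[OF indep_vars_subset[OF Z(1)]]) (auto intro: i1)
        then show "indep_vars (\<lambda>_. borel) (\<lambda>i w. indicator (- K) (p i, Z i w) :: ennreal) J" by (simp add: comp_def)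
      qed simp
      also have "\<dots> = (\<Prod>i\<in>J. ennreal (f (p i)))"
      proof (rule prod.cong[OF refl])
        fix i :: nat
        have "ennreal (f (p i)) = (\<integral>\<^sup>+z. indicator (- K) (p i, z) \<partial>distr M borel (Z i))" by (simp only: fc Z(2))
        also have "\<dots> = (\<integral>\<^sup>+w. indicator (- K) (p i, Z i w) \<partial>M)" by (simp add: nn_integral_distr i1)
        finally show "(\<integral>\<^sup>+w. indicator (- K) (p i, Z i w) \<partial>M) = ennreal (f (p i))" by simp
      qed
      finally show "(\<integral>\<^sup>+z. (\<Prod>i\<in>J. indicator (- K) (p i, z i)) \<partial>?R) = (\<Prod>i\<in>J. ennreal (f (p i)))" .
    qed
    also have "\<dots> = (\<integral>\<^sup>+w. (\<Prod>i\<in>J. ennreal (f (P i w))) \<partial>M)"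
      by (subst nn_integral_distr) auto
    also have "\<dots> = (\<integral>\<^sup>+w. ennreal (\<Prod>i<n. f (P i w)) \<partial>M)"
      using f01 by (simp add: prod_ennreal J_def)
    finally show ?thesis by simp
  qed (simp add: emeasure_space_1)
  with lap have "(\<lambda>n. emeasure M (?A n)) \<longlonglongrightarrow> ennreal (exp (- v))" by simp
  moreover have "(\<lambda>n. emeasure M (?A n)) \<longlonglongrightarrow> emeasure M (\<Inter>n. (?A n))"
  proof (rule Lim_emeasure_decseq)
    have "(?A n) \<in> events" for n by measurable
    then show "range (\<lambda>n. (?A n)) \<subseteq> events" by blast
    show "decseq (\<lambda>n. (?A n))"
      unfolding decseq_def by (blast intro: less_le_trans)
  qed simp
  moreover have "(\<Inter>n. (?A n)) = {w\<in>space M. \<forall>i. (P i w, Z i w) \<notin> K}"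
    using lessI by blast
  ultimately have "emeasure M {w\<in>space M. \<forall>i. (P i w, Z i w) \<notin> K} = ennreal (exp (- v))"
    by (simp add: LIMSEQ_unique)
  then show ?thesis by (simp add: measure_def)
qed

section \<open>Independent sigma-algebras and the variables measurable with respect to them\<close>

lemma (in prob_space) indep_setsD_vars:
  assumes "indep_sets (\<lambda>i. sets (G i)) I"
    and "\<And>i. i \<in> I \<Longrightarrow> space (G i) = space M"
    and X: "\<And>i. i \<in> I \<Longrightarrow> X i \<in> measurable (G i) (M' i)"
  shows "indep_vars M' X I"
proof -
  have G: "sets (G i) \<subseteq> events" if "i \<in> I" for i
    using assms(1) that by (auto simp: indep_sets_def)
  have "{X i -` A \<inter> space M |A. A \<in> sets (M' i)} \<subseteq> sets (G i)" if "i \<in> I" for i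
    using measurable_sets[OF X[OF that]] assms(2)[OF that] by auto
  moreover have "X i \<in> measurable M (M' i)" if "i \<in> I" for i
    using X[OF that] G[OF that] assms(2)[OF that] by (auto simp: measurable_def)
  ultimately show ?thesis
    unfolding indep_vars_def2 using indep_sets_mono_sets[OF assms(1)] by auto
qed

lemma (in prob_space) indep_setD_joint_distr:
  assumes ind: "indep_set (sets G) (sets H)"
    and sp: "space G = space M" "space H = space M"
    and X: "X \<in> measurable G S" and Y: "Y \<in> measurable H T"
  shows "distr M (S \<Otimes>\<^sub>M T) (\<lambda>w. (X w, Y w)) = distr M S X \<Otimes>\<^sub>M distr M T Y"
proof -
  have sub: "sets G \<subseteq> events" "sets H \<subseteq> events" using ind by (auto simp: indep_sets2_eq)
  have Xm[measurable]: "X \<in> measurable M S" and Ym[measurable]: "Y \<in> measurable M T"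
    using X Y sub sp by (auto simp: measurable_def)
  interpret DX: prob_space "distr M S X" by (rule prob_space_distr) simp
  interpret DY: prob_space "distr M T Y" by (rule prob_space_distr) simp
  show ?thesis
  proof (rule pair_measure_eqI[symmetric])
    fix A B assume "A \<in> sets (distr M S X)" "B \<in> sets (distr M T Y)"
    then have AB: "A \<in> sets S" "B \<in> sets T" by auto
    have "X -` A \<inter> space M \<in> sets G" "Y -` B \<inter> space M \<in> sets H"
      using measurable_sets[OF X AB(1)] measurable_sets[OF Y AB(2)] sp by auto
    then have "prob ((X -` A \<inter> space M) \<inter> (Y -` B \<inter> space M)) = prob (X -` A \<inter> space M) * prob (Y -` B \<inter> space M)"
      using ind by (auto simp: indep_sets2_eq)
    moreover have "(\<lambda>w. (X w, Y w)) -` (A \<times> B) \<inter> space M = (X -` A \<inter> space M) \<inter> (Y -` B \<inter> space M)" by auto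
    ultimately show "emeasure (distr M S X) A * emeasure (distr M T Y) B = emeasure (distr M (S \<Otimes>\<^sub>M T) (\<lambda>w. (X w, Y w))) (A \<times> B)"
      using AB by (simp add: emeasure_distr emeasure_eq_measure ennreal_mult')
  qed (auto intro: DX.sigma_finite_measure_axioms DY.sigma_finite_measure_axioms)
qed

text \<open>Allows an event family to be used as a measurable space: \<open>sigma\<close> adds no
  events, so independence of the families carries over.\<close>

lemma events_of_sigma:
  "sets (sigma (space M) (events_of M S J Y)) = events_of M S J Y"
proof -
  have "events_of M S J Y \<subseteq> Pow (space M)"
    unfolding events_of_def by (intro subsetI PowI) (drule sigma_sets_into_sp[rotated], auto)
  moreover have "sigma_sets (space M) (events_of M S J Y) = events_of M S J Y"
    unfolding events_of_def by (rule sigma_sets_sigma_sets_eq) auto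
  ultimately show ?thesis by simp
qed

lemma measurable_coordinates_events_of:
  assumes "\<And>j. j \<in> J \<Longrightarrow> Y j \<in> space M \<rightarrow> space S" "j \<in> J"
  shows "Y j \<in> measurable (sigma (space M) (events_of M S J Y)) S"
proof (rule measurableI)
  fix A assume "A \<in> sets S"
  then have "Y j -` A \<inter> space M \<in> events_of M S J Y"
    using assms(2) unfolding events_of_def by (intro sigma_sets.Basic) auto
  then show "Y j -` A \<inter> space (sigma (space M) (events_of M S J Y)) \<in> sets (sigma (space M) (events_of M S J Y))"
    by (simp add: events_of_sigma space_measure_of_conv)
qed (use assms in \<open>auto simp: space_measure_of_conv\<close>)

section \<open>Running maxima of random walks\<close>

primrec run_max :: "(nat \<Rightarrow> real) \<Rightarrow> nat \<Rightarrow> real" where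
  "run_max s 0 = s 0"
| "run_max s (Suc k) = max (run_max s k) (s (Suc k))"

definition psum :: "(nat \<Rightarrow> real) \<Rightarrow> nat \<Rightarrow> real" where
  "psum y k = (\<Sum>i<k. y i)"

lemma psum_0 [simp]: "psum y 0 = 0"
  and psum_Suc [simp]: "psum y (Suc k) = psum y k + y k"
  by (simp_all add: psum_def)

lemma run_max_ge: "j \<le> k \<Longrightarrow> s j \<le> run_max s k"
  by (induction k) (auto simp: le_Suc_eq)

lemma run_max_le_iff: "run_max s k \<le> x \<longleftrightarrow> (\<forall>j\<le>k. s j \<le> x)"
  by (induction k) (auto simp: le_Suc_eq)

lemma run_max_cong: "(\<And>j. j \<le> k \<Longrightarrow> s j = s' j) \<Longrightarrow> run_max s k = run_max s' k"
  by (induction k) auto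

lemma psum_cong: "(\<And>i. i < k \<Longrightarrow> y i = y' i) \<Longrightarrow> psum y k = psum y' k"
  by (simp add: psum_def)

text \<open>The dichotomy behind every change of weight below: whenever the increment of the running
  maximum is nonzero, an exponential of the walk may be replaced by one of the maximum.\<close>

lemma run_max_record:
  "run_max s (Suc k) = s (Suc k) \<or> run_max s (Suc k) = run_max s k"
  by auto

lemma psum_restrict: "k \<le> n \<Longrightarrow> psum (restrict y {..<n}) k = psum y k"
  by (rule psum_cong) auto

lemma run_max_restrict:
  "k \<le> n \<Longrightarrow> run_max (psum (\<lambda>i. restrict y {..<n} i - c)) k = run_max (psum (\<lambda>i. y i - c)) k"
  "k \<le> n \<Longrightarrow> run_max (psum (restrict y {..<n})) k = run_max (psum y) k"
  by (auto intro!: run_max_cong psum_cong)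

lemma measurable_psum_PiM:
  "k \<le> n \<Longrightarrow> (\<lambda>y. psum (\<lambda>i. y i - c) k) \<in> borel_measurable (PiM {..<n} (\<lambda>_. borel))"
  "k \<le> n \<Longrightarrow> (\<lambda>y. psum y k) \<in> borel_measurable (PiM {..<n} (\<lambda>_. borel))"
  unfolding psum_def
  by (intro borel_measurable_sum borel_measurable_diff measurable_component_singleton; simp)+

lemma measurable_run_max:
  "(\<And>j. j \<le> k \<Longrightarrow> (\<lambda>y. s y j) \<in> borel_measurable M) \<Longrightarrow> (\<lambda>y. run_max (s y) k) \<in> borel_measurable M"
  by (induction k) auto

text \<open>The right side is the integral of \<open>exp (- (p * s))\<close> over
  \<open>[a, b]\<close>, the left side the smallest value of the integrand times the length. The
  next lemma is the counterpart with the largest value.\<close>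

lemma exp_record_upper:
  fixes a b p :: real
  assumes "a \<le> b" "0 < p"
  shows "exp (- (p * b)) * (b - a) \<le> (exp (- (p * a)) - exp (- (p * b))) / p"
proof -
  have "1 + p * (b - a) \<le> exp (p * (b - a))" by (rule exp_ge_add_one_self)
  then have "exp (- (p * b)) * (1 + p * (b - a)) \<le> exp (- (p * b)) * exp (p * (b - a))"
    by (rule mult_left_mono) simp
  also have "exp (- (p * b)) * exp (p * (b - a)) = exp (- (p * a))"
    by (simp add: exp_add[symmetric] algebra_simps)
  finally show ?thesis using assms by (simp add: field_simps)
qed

lemma exp_record_lower:
  fixes a b p :: real
  assumes "a \<le> b" "0 < p"
  shows "(exp (- (p * a)) - exp (- (p * b))) / p \<le> exp (- (p * a)) * (b - a)"
proof -
  have "1 - p * (b - a) \<le> exp (- (p * (b - a)))" using exp_ge_add_one_self[of "- (p * (b - a))"] by linarith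
  then have "exp (- (p * a)) * (1 - p * (b - a)) \<le> exp (- (p * a)) * exp (- (p * (b - a)))"
    by (rule mult_left_mono) simp
  also have "exp (- (p * a)) * exp (- (p * (b - a))) = exp (- (p * b))"
    by (simp add: exp_add[symmetric] algebra_simps)
  finally show ?thesis using assms by (simp add: field_simps)
qed

text \<open>\<open>record_limit q m\<close> is \<open>\<integral>\<^sub>0\<^sup>m e\<^bsup>(1-q)s\<^esup> ds\<close>, the limit of \<open>record_sum\<close> as the jumps of the running
  maximum become small.\<close>

definition record_limit :: "real \<Rightarrow> real \<Rightarrow> real" where
  "record_limit q m = (if q = 1 then m else (1 - exp (- ((q - 1) * m))) / (q - 1))"

definition record_sum :: "real \<Rightarrow> (nat \<Rightarrow> real) \<Rightarrow> nat \<Rightarrow> real" where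
  "record_sum q s K = (\<Sum>k<K. exp (- (q * run_max s (Suc k))) * (exp (run_max s (Suc k)) - exp (run_max s k)))"

text \<open>A term of \<open>record_sum\<close> is
  \<open>exp (- ((q - 1) * b)) * (1 - exp (- (b - a)))\<close>. By
  \<open>1 - exp (- x) \<le> x\<close> it is at most the value at \<open>b\<close> of the integrand
  of \<open>record_limit\<close> times the length of \<open>[a, b]\<close>, a lower Riemann sum
  since \<open>q \<ge> 1\<close>.\<close>

lemma record_limit_step_upper:
  assumes "a \<le> b" "1 \<le> q"
  shows "exp (- (q * b)) * (exp b - exp a) \<le> record_limit q b - record_limit q a"
proof -
  have *: "exp (- (q * b)) * (exp b - exp a) = exp (- ((q - 1) * b)) * (1 - exp (- (b - a)))"
    by (simp add: algebra_simps exp_add[symmetric])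
  have "1 - exp (- (b - a)) \<le> b - a" using exp_ge_add_one_self[of "- (b - a)"] by linarith
  then have **: "exp (- (q * b)) * (exp b - exp a) \<le> exp (- ((q - 1) * b)) * (b - a)"
    unfolding * by (rule mult_left_mono) simp
  show ?thesis
  proof (cases "q = 1")
    case False
    then have q: "0 < q - 1" using assms by simp
    note **
    also have "exp (- ((q - 1) * b)) * (b - a) \<le> (exp (- ((q - 1) * a)) - exp (- ((q - 1) * b))) / (q - 1)"
      by (rule exp_record_upper[OF assms(1) q])
    finally show ?thesis using False by (simp add: record_limit_def diff_divide_distrib[symmetric])
  qed (use ** in \<open>simp add: record_limit_def\<close>)
qed

text \<open>The integral is at most its value at \<open>a\<close> times the length. Moving the
  factor \<open>exp (- (q * a))\<close> to \<open>b\<close> then costs at most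
  \<open>exp (q * \<delta>)\<close>, which disappears as the jumps of the maximum become
  small.\<close>

lemma record_limit_step_lower:
  assumes "a \<le> b" "b - a \<le> \<delta>" "1 \<le> q"
  shows "exp (- (q * \<delta>)) * (record_limit q b - record_limit q a) \<le> exp (- (q * b)) * (exp b - exp a)"
proof -
  have "record_limit q b - record_limit q a \<le> exp (- ((q - 1) * a)) * (b - a)"
  proof (cases "q = 1")
    case False
    then have q: "0 < q - 1" using assms by simp
    from exp_record_lower[OF assms(1) q] False show ?thesis
      by (simp add: record_limit_def diff_divide_distrib[symmetric])
  qed (simp add: record_limit_def)
  also have "\<dots> \<le> exp (- ((q - 1) * a)) * (exp (b - a) - 1)"
    using exp_ge_add_one_self[of "b - a"] by (intro mult_left_mono) (linarith, simp)
  also have "\<dots> = exp (- (q * a)) * (exp b - exp a)"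
    by (simp add: algebra_simps exp_add[symmetric])
  also have "\<dots> \<le> (exp (q * \<delta>) * exp (- (q * b))) * (exp b - exp a)"
  proof (rule mult_right_mono)
    have "q * (b - a) \<le> q * \<delta>" using assms by (intro mult_left_mono) auto
    then show "exp (- (q * a)) \<le> exp (q * \<delta>) * exp (- (q * b))"
      by (simp add: exp_add[symmetric] algebra_simps)
  qed (use assms in simp)
  finally have "exp (- (q * \<delta>)) * (record_limit q b - record_limit q a)
      \<le> exp (- (q * \<delta>)) * ((exp (q * \<delta>) * exp (- (q * b))) * (exp b - exp a))"
    by (rule mult_left_mono) simp
  also have "\<dots> = exp (- (q * b)) * (exp b - exp a)" by (simp add: exp_minus field_simps)
  finally show ?thesis .
qed

lemma record_limit_mono: "a \<le> b \<Longrightarrow> 1 \<le> q \<Longrightarrow> record_limit q a \<le> record_limit q b"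
  using record_limit_step_upper[of a b q] by (smt (verit) exp_le_cancel_iff mult_nonneg_nonneg exp_ge_zero)

lemma record_limit_0 [simp]: "record_limit q 0 = 0"
  by (simp add: record_limit_def)

lemma run_max_Suc_ge: "run_max s k \<le> run_max s (Suc k)"
  by simp

lemma record_sum_le:
  assumes "1 \<le> q" "s 0 = 0"
  shows "record_sum q s K \<le> record_limit q (run_max s K)"
proof -
  have "record_sum q s K \<le> (\<Sum>k<K. record_limit q (run_max s (Suc k)) - record_limit q (run_max s k))"
    unfolding record_sum_def by (intro sum_mono record_limit_step_upper run_max_Suc_ge assms)
  also have "\<dots> = record_limit q (run_max s K)"
    by (subst sum_lessThan_telescope) (use assms in simp)
  finally show ?thesis .
qed

lemma record_sum_ge:
  assumes "1 \<le> q" "s 0 = 0" and \<delta>: "0 \<le> \<delta>" "\<And>k. k < K \<Longrightarrow> s (Suc k) - s k \<le> \<delta>"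
  shows "exp (- (q * \<delta>)) * record_limit q (run_max s K) \<le> record_sum q s K"
proof -
  have "exp (- (q * \<delta>)) * record_limit q (run_max s K)
      = exp (- (q * \<delta>)) * (\<Sum>k<K. record_limit q (run_max s (Suc k)) - record_limit q (run_max s k))"
    by (subst sum_lessThan_telescope) (use assms in simp)
  also have "\<dots> \<le> record_sum q s K"
    unfolding record_sum_def sum_distrib_left
  proof (intro sum_mono record_limit_step_lower run_max_Suc_ge assms)
    \<comment> \<open>A new maximum is reached by one step from \<open>s k\<close>, which is at most
      the old maximum.\<close>
    fix k assume "k \<in> {..<K}"
    then show "run_max s (Suc k) - run_max s k \<le> \<delta>"
      using \<delta>(1) \<delta>(2)[of k] run_max_ge[of k k s] by auto
  qed
  finally show ?thesis .
qed

section \<open>Exponential tilting of random walks by weights\<close>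

lemma (in prob_space) nn_integral_indep_mult:
  fixes F G :: "'a \<Rightarrow> ennreal"
  assumes "indep_var borel F borel G"
  shows "(\<integral>\<^sup>+w. F w * G w \<partial>M) = (\<integral>\<^sup>+w. F w \<partial>M) * (\<integral>\<^sup>+w. G w \<partial>M)"
proof -
  have *: "(\<lambda>b. case b of True \<Rightarrow> borel | False \<Rightarrow> borel) = (\<lambda>_. borel)" by (auto split: bool.split)
  have "indep_vars (\<lambda>_. borel) (case_bool F G) UNIV"
    using assms unfolding indep_var_def * .
  from indep_vars_nn_integral[OF _ this] show ?thesis by (simp add: UNIV_bool mult.commute)
qed

text \<open>The invariance of \<open>F\<close> under \<open>restrict\<close> to
  \<open>{..<k}\<close> expresses that \<open>F\<close> depends on the first \<open>k\<close> steps
  only; it is the form in which "known before step \<open>k\<close>" appears from here on.\<close>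

lemma (in prob_space) indep_past_step:
  assumes X: "indep_vars (\<lambda>_. borel) (X :: nat \<Rightarrow> 'a \<Rightarrow> real) {..<K}" and k: "k < K"
    and F: "F \<in> borel_measurable (PiM {..<k} (\<lambda>_. borel))" "\<And>y. F (restrict y {..<k}) = F y"
    and G: "G \<in> borel_measurable borel"
  shows "(\<integral>\<^sup>+w. F (\<lambda>i. X i w) * G (X k w) \<partial>M) = (\<integral>\<^sup>+w. F (\<lambda>i. X i w) \<partial>M) * (\<integral>\<^sup>+w. G (X k w) \<partial>M)"
proof (rule nn_integral_indep_mult)
  have "indep_var (PiM {..<k} (\<lambda>_. borel)) (\<lambda>w. restrict (\<lambda>i. X i w) {..<k}) (PiM {k} (\<lambda>_. borel)) (\<lambda>w. restrict (\<lambda>i. X i w) {k})"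
    by (rule indep_var_restrict[OF X]) (use k in auto)
  then have "indep_var borel (F \<circ> (\<lambda>w. restrict (\<lambda>i. X i w) {..<k})) borel ((\<lambda>y. G (y k)) \<circ> (\<lambda>w. restrict (\<lambda>i. X i w) {k}))"
    by (rule indep_var_compose[OF _ F(1) measurable_compose[OF measurable_component_singleton[of k "{k}" "\<lambda>_. borel"] G]]) simp
  then show "indep_var borel (\<lambda>w. F (\<lambda>i. X i w)) borel (\<lambda>w. G (X k w))"
    by (simp add: comp_def F(2))
qed

text \<open>The density, on the first \<open>k\<close> steps, of the Esscher transform with
  parameter \<open>u\<close>, provided that \<open>\<phi>\<close> is the mean of
  \<open>exp (u * y i)\<close> for each step.\<close>

definition esscher :: "real \<Rightarrow> real \<Rightarrow> nat \<Rightarrow> (nat \<Rightarrow> real) \<Rightarrow> real" where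
  "esscher u \<phi> k y = (1 / \<phi>) ^ k * exp (u * psum y k)"

lemma esscher_0 [simp]: "esscher u \<phi> 0 y = 1"
  by (simp add: esscher_def)

lemma esscher_Suc: "esscher u \<phi> (Suc k) y = esscher u \<phi> k y * (exp (u * y k) / \<phi>)"
  by (simp add: esscher_def ring_distribs exp_add)

lemma esscher_pos: "0 < \<phi> \<Longrightarrow> 0 < esscher u \<phi> k y"
  by (simp add: esscher_def)

lemma esscher_restrict: "k \<le> n \<Longrightarrow> esscher u \<phi> k (restrict y {..<n}) = esscher u \<phi> k y"
  by (simp add: esscher_def psum_restrict)

lemma measurable_esscher:
  "k \<le> n \<Longrightarrow> (\<lambda>y. esscher u \<phi> k y) \<in> borel_measurable (PiM {..<n} (\<lambda>_. borel))"
  unfolding esscher_def by (intro borel_measurable_times borel_measurable_const borel_measurable_exp measurable_compose[OF _ borel_measurable_exp] measurable_psum_PiM)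

context prob_space begin

context
  fixes X :: "nat \<Rightarrow> 'a \<Rightarrow> real" and K :: nat and u \<phi> :: real
  assumes X: "indep_vars (\<lambda>_. borel) X {..<K}"
    and mgf: "\<And>i. i < K \<Longrightarrow> (\<integral>\<^sup>+w. ennreal (exp (u * X i w)) \<partial>M) = ennreal \<phi>"
    and \<phi>: "0 < \<phi>"
begin

text \<open>The martingale property of the weight in integrated form: the factor acquired at step
  \<open>k\<close> has mean 1 and is independent of the past.\<close>

lemma esscher_step:
  assumes k: "k < K"
    and F: "F \<in> borel_measurable (PiM {..<k} (\<lambda>_. borel))" "\<And>y. F (restrict y {..<k}) = F y"
  shows "(\<integral>\<^sup>+w. ennreal (esscher u \<phi> (Suc k) (\<lambda>i. X i w)) * F (\<lambda>i. X i w) \<partial>M)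
       = (\<integral>\<^sup>+w. ennreal (esscher u \<phi> k (\<lambda>i. X i w)) * F (\<lambda>i. X i w) \<partial>M)"
proof -
  have "(\<integral>\<^sup>+w. ennreal (esscher u \<phi> (Suc k) (\<lambda>i. X i w)) * F (\<lambda>i. X i w) \<partial>M)
     = (\<integral>\<^sup>+w. (ennreal (esscher u \<phi> k (\<lambda>i. X i w)) * F (\<lambda>i. X i w)) * ennreal (exp (u * X k w) / \<phi>) \<partial>M)"
  proof (intro nn_integral_cong)
    fix w
    have "ennreal (esscher u \<phi> (Suc k) (\<lambda>i. X i w)) = ennreal (esscher u \<phi> k (\<lambda>i. X i w)) * ennreal (exp (u * X k w) / \<phi>)"
      unfolding esscher_Suc by (rule ennreal_mult') (use esscher_pos[OF \<phi>] in \<open>simp add: less_imp_le\<close>)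
    then show "ennreal (esscher u \<phi> (Suc k) (\<lambda>i. X i w)) * F (\<lambda>i. X i w)
        = (ennreal (esscher u \<phi> k (\<lambda>i. X i w)) * F (\<lambda>i. X i w)) * ennreal (exp (u * X k w) / \<phi>)"
      by (simp only: mult_ac)
  qed
  also have "\<dots> = (\<integral>\<^sup>+w. ennreal (esscher u \<phi> k (\<lambda>i. X i w)) * F (\<lambda>i. X i w) \<partial>M) * (\<integral>\<^sup>+w. ennreal (exp (u * X k w) / \<phi>) \<partial>M)"
    by (rule indep_past_step[OF X k, where F="\<lambda>y. ennreal (esscher u \<phi> k y) * F y"])
      (use F in \<open>auto simp: esscher_restrict intro!: borel_measurable_times_ennreal measurable_compose[OF measurable_esscher]\<close>)
  also have "(\<integral>\<^sup>+w. ennreal (exp (u * X k w) / \<phi>) \<partial>M) = 1"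
  proof -
    have [measurable]: "X k \<in> borel_measurable M" using X k by (auto simp: indep_vars_def)
    have "(\<integral>\<^sup>+w. ennreal (exp (u * X k w) / \<phi>) \<partial>M) = (\<integral>\<^sup>+w. ennreal (exp (u * X k w)) * ennreal (1 / \<phi>) \<partial>M)"
      using \<phi> by (intro nn_integral_cong) (simp add: ennreal_mult'[symmetric])
    also have "\<dots> = ennreal \<phi> * ennreal (1 / \<phi>)"
      by (subst nn_integral_multc) (auto simp: mgf[OF k])
    also have "\<dots> = 1" using \<phi> by (simp add: ennreal_mult'[symmetric])
    finally show ?thesis .
  qed
  finally show ?thesis by simp
qed

lemma esscher_mean: "k \<le> K \<Longrightarrow> (\<integral>\<^sup>+w. ennreal (esscher u \<phi> k (\<lambda>i. X i w)) \<partial>M) = 1"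
proof (induction k)
  case (Suc k)
  then show ?case using esscher_step[of k "\<lambda>_. 1"] by simp
qed (simp add: emeasure_space_1)

text \<open>As \<open>b j\<close> is determined by the first \<open>Suc j\<close> steps, the
  martingale property allows its weight to be taken at the common later time \<open>k\<close>; the
  separate integrals then merge into one tilted mean of a sum along the path.\<close>

lemma esscher_tower:
  assumes b: "\<And>k. b k \<in> borel_measurable (PiM {..<Suc k} (\<lambda>_. borel))" "\<And>k y. b k (restrict y {..<Suc k}) = b k y"
    and "k \<le> K"
  shows "(\<Sum>j<k. \<integral>\<^sup>+w. ennreal (esscher u \<phi> (Suc j) (\<lambda>i. X i w)) * b j (\<lambda>i. X i w) \<partial>M)
       = (\<integral>\<^sup>+w. ennreal (esscher u \<phi> k (\<lambda>i. X i w)) * (\<Sum>j<k. b j (\<lambda>i. X i w)) \<partial>M)"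
  using assms(3)
proof (induction k)
  case (Suc k)
  have bl: "b j (restrict y {..<n}) = b j y" if "j < n" for j n y
    using b(2)[of j "restrict y {..<n}"] b(2)[of j y] that by (simp add: Int_absorb1)
  have bn: "b j \<in> borel_measurable (PiM {..<n} (\<lambda>_. borel))" if "j < n" for j n
  proof -
    have "(\<lambda>y. b j (restrict y {..<Suc j})) \<in> borel_measurable (PiM {..<n} (\<lambda>_. borel))"
      by (rule measurable_compose[OF measurable_restrict_subset b(1)]) (use that in auto)
    then show ?thesis by (simp add: b(2))
  qed
  have Xm: "X i \<in> borel_measurable M" if "i < K" for i using X that by (auto simp: indep_vars_def)
  have restr: "(\<lambda>w. restrict (\<lambda>i. X i w) {..<Suc k}) \<in> measurable M (PiM {..<Suc k} (\<lambda>_. borel))"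
    by (intro measurable_restrict Xm) (use Suc in auto)
  have m1: "(\<lambda>w. ennreal (esscher u \<phi> (Suc k) (\<lambda>i. X i w))) \<in> borel_measurable M"
    using measurable_compose[OF measurable_compose[OF restr measurable_esscher[OF order_refl]] measurable_ennreal]
    by (simp add: esscher_restrict)
  have m2: "(\<lambda>w. b j (\<lambda>i. X i w)) \<in> borel_measurable M" if "j < Suc k" for j
    using measurable_compose[OF restr bn[OF that]] bl[OF that] by simp
  have "(\<integral>\<^sup>+w. ennreal (esscher u \<phi> (Suc k) (\<lambda>i. X i w)) * (\<Sum>j<Suc k. b j (\<lambda>i. X i w)) \<partial>M)
    = (\<integral>\<^sup>+w. ennreal (esscher u \<phi> (Suc k) (\<lambda>i. X i w)) * (\<Sum>j<k. b j (\<lambda>i. X i w)) \<partial>M)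
     + (\<integral>\<^sup>+w. ennreal (esscher u \<phi> (Suc k) (\<lambda>i. X i w)) * b k (\<lambda>i. X i w) \<partial>M)"
    by (subst nn_integral_add[symmetric])
      (auto simp: distrib_left intro!: borel_measurable_times_ennreal borel_measurable_sum m1 m2)
  also have "(\<integral>\<^sup>+w. ennreal (esscher u \<phi> (Suc k) (\<lambda>i. X i w)) * (\<Sum>j<k. b j (\<lambda>i. X i w)) \<partial>M)
      = (\<integral>\<^sup>+w. ennreal (esscher u \<phi> k (\<lambda>i. X i w)) * (\<Sum>j<k. b j (\<lambda>i. X i w)) \<partial>M)"
    by (rule esscher_step[where F="\<lambda>y. \<Sum>j<k. b j y"])
      (use Suc in \<open>auto simp: bl intro!: borel_measurable_sum bn\<close>)
  finally show ?case using Suc by simp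
qed simp

end

text \<open>In the application \<open>(1 / \<phi>) ^ Suc k\<close> is the probability that killing
  has not occurred by step \<open>Suc k\<close>, so the left side is the mean growth of the
  exponential of the killed maximum.\<close>

lemma walk_exp_max_identity:
  assumes X: "indep_vars (\<lambda>_. borel) X {..<K}"
    and mgf: "\<And>i. i < K \<Longrightarrow> (\<integral>\<^sup>+w. ennreal (exp (q * X i w)) \<partial>M) = ennreal \<phi>"
    and \<phi>: "0 < \<phi>"
  shows "(\<Sum>k<K. \<integral>\<^sup>+w. ennreal ((1 / \<phi>) ^ Suc k * (exp (run_max (psum (\<lambda>i. X i w)) (Suc k)) - exp (run_max (psum (\<lambda>i. X i w)) k))) \<partial>M)
    = (\<integral>\<^sup>+w. ennreal (esscher q \<phi> K (\<lambda>i. X i w)) * ennreal (record_sum q (psum (\<lambda>i. X i w)) K) \<partial>M)"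
proof -
  define b where "b k y = ennreal (exp (- (q * run_max (psum y) (Suc k))) * (exp (run_max (psum y) (Suc k)) - exp (run_max (psum y) k)))" for k y
  have rm: "(\<lambda>y. run_max (psum y) j) \<in> borel_measurable (PiM {..<Suc k} (\<lambda>_. borel))" if "j \<le> Suc k" for j k
    by (intro measurable_run_max measurable_psum_PiM) (use that in simp)
  have bm: "b k \<in> borel_measurable (PiM {..<Suc k} (\<lambda>_. borel))" for k
    unfolding b_def using rm[of k k] rm[of "Suc k" k] by measurable
  have bl: "b k (restrict y {..<Suc k}) = b k y" for k y
    unfolding b_def by (simp only: run_max_restrict le_Suc_eq order_refl simp_thms)
  have "ennreal ((1 / \<phi>) ^ Suc k * (exp (run_max (psum y) (Suc k)) - exp (run_max (psum y) k)))
      = ennreal (esscher q \<phi> (Suc k) y) * b k y" for k y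
  proof -
    \<comment> \<open>At a record the walk equals its maximum and the exponentials with factor
      \<open>q\<close> cancel; otherwise the increment makes both sides 0.\<close>
    have "(1 / \<phi>) ^ Suc k * (exp (run_max (psum y) (Suc k)) - exp (run_max (psum y) k))
      = esscher q \<phi> (Suc k) y * (exp (- (q * run_max (psum y) (Suc k))) * (exp (run_max (psum y) (Suc k)) - exp (run_max (psum y) k)))"
      using run_max_record[of "psum y" k]
      by (elim disjE) (simp_all only: esscher_def diff_self mult_zero_right, simp add: exp_minus)
    then show ?thesis unfolding b_def using esscher_pos[OF \<phi>, of q "Suc k" y] by (simp only: ennreal_mult' less_imp_le)
  qed
  then have "(\<Sum>k<K. \<integral>\<^sup>+w. ennreal ((1 / \<phi>) ^ Suc k * (exp (run_max (psum (\<lambda>i. X i w)) (Suc k)) - exp (run_max (psum (\<lambda>i. X i w)) k))) \<partial>M)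
    = (\<Sum>k<K. \<integral>\<^sup>+w. ennreal (esscher q \<phi> (Suc k) (\<lambda>i. X i w)) * b k (\<lambda>i. X i w) \<partial>M)"
    by (simp only:)
  also have "\<dots> = (\<integral>\<^sup>+w. ennreal (esscher q \<phi> K (\<lambda>i. X i w)) * (\<Sum>j<K. b j (\<lambda>i. X i w)) \<partial>M)"
    by (rule esscher_tower[OF X mgf \<phi> bm bl order_refl])
  also have "\<dots> = (\<integral>\<^sup>+w. ennreal (esscher q \<phi> K (\<lambda>i. X i w)) * ennreal (record_sum q (psum (\<lambda>i. X i w)) K) \<partial>M)"
    unfolding b_def record_sum_def by (subst sum_ennreal) auto
  finally show ?thesis .
qed

text \<open>The maximum is at most \<open>c K\<close> plus the maximum \<open>R\<close> of the walk with drift \<open>-c\<close>. At the records of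
  \<open>R\<close> the weight \<open>e\<^bsup>S\<^esup> / \<phi>\<^sup>k\<close> is dominated by \<open>e\<^bsup>(1+v)S\<^esup> / \<phi>'\<^sup>k\<close> times \<open>e\<^bsup>-vR\<^esup>\<close>.\<close>

lemma walk_tilted_max_bound:
  assumes X: "indep_vars (\<lambda>_. borel) X {..<K}"
    and mgf: "\<And>i. i < K \<Longrightarrow> (\<integral>\<^sup>+w. ennreal (exp (1 * X i w)) \<partial>M) = ennreal \<phi>" "0 < \<phi>"
    and mgf': "\<And>i. i < K \<Longrightarrow> (\<integral>\<^sup>+w. ennreal (exp ((1 + v) * X i w)) \<partial>M) = ennreal \<phi>'" "0 < \<phi>'"
    and v: "0 < v" "0 \<le> c" "\<phi>' \<le> \<phi> * exp (v * c)"
  shows "(\<integral>\<^sup>+w. ennreal (esscher 1 \<phi> K (\<lambda>i. X i w)) * ennreal (run_max (psum (\<lambda>i. X i w)) K) \<partial>M) \<le> ennreal (c * K + 1 / v)"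
proof -
  define R where "R k y = run_max (psum (\<lambda>i. y i - c)) k" for k y
  have Rr: "R (Suc k) y = psum y (Suc k) - c * Suc k \<or> R (Suc k) y = R k y" for k y
    using run_max_record[of "psum (\<lambda>i. y i - c)" k] unfolding R_def by (simp add: psum_def sum_subtractf algebra_simps)
  have R0: "R 0 y = 0" for y by (simp add: R_def)
  have Rmono: "R k y \<le> R (Suc k) y" for k y unfolding R_def by (rule run_max_Suc_ge)
  define b1 where "b1 k y = ennreal (R (Suc k) y - R k y)" for k y
  define b2 where "b2 k y = ennreal (exp (- (v * R (Suc k) y)) * (R (Suc k) y - R k y))" for k y
  have rm: "R j \<in> borel_measurable (PiM {..<Suc k} (\<lambda>_. borel))" if "j \<le> Suc k" for j k
    unfolding R_def by (intro measurable_run_max measurable_psum_PiM) (use that in simp)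
  have bm: "b1 k \<in> borel_measurable (PiM {..<Suc k} (\<lambda>_. borel))" "b2 k \<in> borel_measurable (PiM {..<Suc k} (\<lambda>_. borel))" for k
    unfolding b1_def b2_def using rm[of k k] rm[of "Suc k" k] by measurable
  have bl: "b1 k (restrict y {..<Suc k}) = b1 k y" "b2 k (restrict y {..<Suc k}) = b2 k y" for k y
    unfolding b1_def b2_def R_def by (simp_all only: run_max_restrict le_Suc_eq order_refl simp_thms)
  have "(\<Sum>j<K. b1 j y) = ennreal (R K y)" for y
  proof -
    have "(\<Sum>j<K. b1 j y) = ennreal (\<Sum>j<K. R (Suc j) y - R j y)"
      unfolding b1_def using Rmono by (intro sum_ennreal) simp
    then show ?thesis by (simp only: sum_lessThan_telescope[where f="\<lambda>j. R j y"] R0) simp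
  qed
  then have "(\<integral>\<^sup>+w. ennreal (esscher 1 \<phi> K (\<lambda>i. X i w)) * ennreal (R K (\<lambda>i. X i w)) \<partial>M)
    = (\<Sum>k<K. \<integral>\<^sup>+w. ennreal (esscher 1 \<phi> (Suc k) (\<lambda>i. X i w)) * b1 k (\<lambda>i. X i w) \<partial>M)"
    using esscher_tower[OF X mgf(1) mgf(2) bm(1) bl(1) order_refl] by simp
  also have "\<dots> \<le> (\<Sum>k<K. \<integral>\<^sup>+w. ennreal (esscher (1 + v) \<phi>' (Suc k) (\<lambda>i. X i w)) * b2 k (\<lambda>i. X i w) \<partial>M)"
  proof (intro sum_mono nn_integral_mono)
    fix k w
    let ?y = "\<lambda>i. X i w"
    have "esscher 1 \<phi> (Suc k) ?y * (R (Suc k) ?y - R k ?y)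
      \<le> esscher (1 + v) \<phi>' (Suc k) ?y * (exp (- (v * R (Suc k) ?y)) * (R (Suc k) ?y - R k ?y))"
      using Rr[of k ?y]
    proof
      assume r: "R (Suc k) ?y = psum ?y (Suc k) - c * Suc k"
      \<comment> \<open>The hypothesis on \<open>\<phi>'\<close> bounds \<open>1 / \<phi>\<close> by
        \<open>exp (v * c) / \<phi>'\<close>. The surplus \<open>exp (v * (c * Suc k))\<close> is
        absorbed below, because at a record
        \<open>c * Suc k = psum ?y (Suc k) - R (Suc k) ?y\<close>.\<close>
      have "(1 / \<phi>) ^ Suc k \<le> (exp (v * c) / \<phi>') ^ Suc k"
        using v mgf(2) mgf'(2) by (intro power_mono) (auto simp: field_simps)
      also have "\<dots> = (1 / \<phi>') ^ Suc k * exp (v * (c * Suc k))"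
        by (simp only: power_divide exp_of_nat_mult[symmetric] power_one) (simp add: algebra_simps)
      finally have "esscher 1 \<phi> (Suc k) ?y \<le> (1 / \<phi>') ^ Suc k * exp (v * (c * Suc k)) * exp (psum ?y (Suc k))"
        unfolding esscher_def by (simp only: mult_1) (rule mult_right_mono, auto)
      also have "\<dots> = esscher (1 + v) \<phi>' (Suc k) ?y * exp (- (v * R (Suc k) ?y))"
        unfolding esscher_def r mult.assoc exp_add[symmetric] by (simp only: ring_distribs) (simp add: algebra_simps)
      finally show ?thesis using Rmono[of k ?y] by (simp only: mult.assoc[symmetric]) (rule mult_right_mono, auto)
    qed simp
    then show "ennreal (esscher 1 \<phi> (Suc k) ?y) * b1 k ?y \<le> ennreal (esscher (1 + v) \<phi>' (Suc k) ?y) * b2 k ?y"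
      unfolding b1_def b2_def using esscher_pos[OF mgf(2)] esscher_pos[OF mgf'(2)] 
      by (simp only: ennreal_mult'[symmetric] less_imp_le ennreal_leI)
  qed
  also have "\<dots> = (\<integral>\<^sup>+w. ennreal (esscher (1 + v) \<phi>' K (\<lambda>i. X i w)) * (\<Sum>j<K. b2 j (\<lambda>i. X i w)) \<partial>M)"
    by (rule esscher_tower[OF X mgf'(1) mgf'(2) bm(2) bl(2) order_refl])
  \<comment> \<open>On every path the sum of the \<open>b2 j\<close> is a lower Riemann sum for the
    integral of \<open>exp (- (v * s))\<close> over \<open>[0, R K]\<close>, hence at most
    \<open>1 / v\<close>; the total mass of the weight is 1.\<close>
  also have "\<dots> \<le> (\<integral>\<^sup>+w. ennreal (esscher (1 + v) \<phi>' K (\<lambda>i. X i w)) * ennreal (1 / v) \<partial>M)"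
  proof (intro nn_integral_mono mult_left_mono)
    fix w
    let ?y = "\<lambda>i. X i w"
    have "(\<Sum>j<K. b2 j ?y) = ennreal (\<Sum>j<K. exp (- (v * R (Suc j) ?y)) * (R (Suc j) ?y - R j ?y))"
      unfolding b2_def using Rmono by (intro sum_ennreal mult_nonneg_nonneg) auto
    also have "\<dots> \<le> ennreal (\<Sum>j<K. (exp (- (v * R j ?y)) - exp (- (v * R (Suc j) ?y))) / v)"
      by (intro ennreal_leI sum_mono exp_record_upper Rmono v)
    also have "(\<Sum>j<K. (exp (- (v * R j ?y)) - exp (- (v * R (Suc j) ?y))) / v) = (1 - exp (- (v * R K ?y))) / v"
      by (simp only: sum_divide_distrib[symmetric] sum_lessThan_telescope'[where f="\<lambda>j. exp (- (v * R j ?y))"] R0) simp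
    also have "\<dots> \<le> 1 / v" using v by (intro divide_right_mono) auto
    finally show "(\<Sum>j<K. b2 j ?y) \<le> ennreal (1 / v)" by (simp add: ennreal_leI)
  qed simp
  also have "\<dots> = ennreal (1 / v)"
  proof -
    have "(\<lambda>w. ennreal (esscher (1 + v) \<phi>' K (\<lambda>i. X i w))) \<in> borel_measurable M"
    proof -
      have "(\<lambda>w. restrict (\<lambda>i. X i w) {..<K}) \<in> measurable M (PiM {..<K} (\<lambda>_. borel))"
        by (intro measurable_restrict) (use X in \<open>auto simp: indep_vars_def\<close>)
      from measurable_compose[OF measurable_compose[OF this measurable_esscher[OF order_refl]] measurable_ennreal]
      show ?thesis by (simp add: esscher_restrict)
    qed
    then show ?thesis by (subst nn_integral_multc) (auto simp: esscher_mean[OF X mgf'(1) mgf'(2)])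
  qed
  finally have *: "(\<integral>\<^sup>+w. ennreal (esscher 1 \<phi> K (\<lambda>i. X i w)) * ennreal (R K (\<lambda>i. X i w)) \<partial>M) \<le> ennreal (1 / v)" .
  have le: "run_max (psum y) K \<le> c * K + R K y" for y
    unfolding run_max_le_iff
  proof (intro allI impI)
    fix j assume j: "j \<le> K"
    have "psum y j - c * j = psum (\<lambda>i. y i - c) j" by (simp add: psum_def sum_subtractf)
    also have "\<dots> \<le> R K y" unfolding R_def using j by (rule run_max_ge)
    moreover have "c * j \<le> c * K" using j v by (intro mult_left_mono) auto
    ultimately show "psum y j \<le> c * K + R K y" by simp
  qed
  have R0': "0 \<le> R K y" for y using run_max_ge[of 0 K "psum (\<lambda>i. y i - c)"] by (simp add: R_def)
  have m: "(\<lambda>w. restrict (\<lambda>i. X i w) {..<K}) \<in> measurable M (PiM {..<K} (\<lambda>_. borel))"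
    by (intro measurable_restrict) (use X in \<open>auto simp: indep_vars_def\<close>)
  have m1: "(\<lambda>w. ennreal (esscher 1 \<phi> K (\<lambda>i. X i w))) \<in> borel_measurable M"
    using measurable_compose[OF measurable_compose[OF m measurable_esscher[OF order_refl]] measurable_ennreal]
    by (simp add: esscher_restrict)
  have m2: "(\<lambda>w. ennreal (R K (\<lambda>i. X i w))) \<in> borel_measurable M"
  proof -
    have "R K \<in> borel_measurable (PiM {..<K} (\<lambda>_. borel))"
      unfolding R_def by (intro measurable_run_max measurable_psum_PiM) simp
    from measurable_compose[OF measurable_compose[OF m this] measurable_ennreal]
    show ?thesis unfolding R_def by (simp only: run_max_restrict order_refl)
  qed
  have "(\<integral>\<^sup>+w. ennreal (esscher 1 \<phi> K (\<lambda>i. X i w)) * ennreal (run_max (psum (\<lambda>i. X i w)) K) \<partial>M)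
    \<le> (\<integral>\<^sup>+w. ennreal (esscher 1 \<phi> K (\<lambda>i. X i w)) * ennreal (c * K) + ennreal (esscher 1 \<phi> K (\<lambda>i. X i w)) * ennreal (R K (\<lambda>i. X i w)) \<partial>M)"
    using v R0' by (intro nn_integral_mono) (simp only: distrib_left[symmetric] ennreal_plus[symmetric] mult_nonneg_nonneg of_nat_0_le_iff, intro mult_left_mono ennreal_leI le, simp)
  also have "\<dots> = ennreal (c * K) + (\<integral>\<^sup>+w. ennreal (esscher 1 \<phi> K (\<lambda>i. X i w)) * ennreal (R K (\<lambda>i. X i w)) \<partial>M)"
    using m1 m2 by (subst nn_integral_add) (auto simp: nn_integral_multc esscher_mean[OF X mgf(1) mgf(2)])
  also have "\<dots> \<le> ennreal (c * K) + ennreal (1 / v)" by (intro add_left_mono *)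
  also have "\<dots> = ennreal (c * K + 1 / v)" using v by (intro ennreal_plus[symmetric]) auto
  finally show ?thesis .
qed


section \<open>Restarting a random walk at its first passage\<close>

lemma iid_shift_distr:
  assumes X: "indep_vars (\<lambda>_. borel) (X :: nat \<Rightarrow> 'a \<Rightarrow> real) {..<K}"
    and D: "\<And>i. i < K \<Longrightarrow> distr M borel (X i) = D"
    and k: "k + n \<le> K" "n \<noteq> 0"
  shows "distr M (PiM {..<n} (\<lambda>_. borel)) (\<lambda>w. \<lambda>i\<in>{..<n}. X (k + i) w) = PiM {..<n} (\<lambda>_. D)"
proof -
  have "indep_vars (\<lambda>_. borel) (\<lambda>i. X (k + i)) {..<n}"
  proof -
    have "indep_vars (\<lambda>j. PiM {k + j} (\<lambda>_. borel)) (\<lambda>j w. restrict (\<lambda>i. X i w) {k + j}) {..<n}"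
      by (rule indep_vars_restrict[OF X]) (use k in \<open>auto simp: disjoint_family_on_def\<close>)
    then have "indep_vars (\<lambda>_. borel) (\<lambda>j. (\<lambda>y. y (k + j)) \<circ> (\<lambda>w. restrict (\<lambda>i. X i w) {k + j})) {..<n}"
      by (rule indep_vars_compose) (rule measurable_component_singleton, simp)
    then show ?thesis by (simp add: comp_def)
  qed
  then have "distr M (PiM {..<n} (\<lambda>_. borel)) (\<lambda>w. \<lambda>i\<in>{..<n}. X (k + i) w) = PiM {..<n} (\<lambda>i. distr M borel (X (k + i)))"
    using X k by (subst (asm) indep_vars_iff_distr_eq_PiM') (auto simp: indep_vars_def lessThan_empty_iff)
  also have "\<dots> = PiM {..<n} (\<lambda>_. D)"
    using k by (intro PiM_cong) (auto simp: D)
  finally show ?thesis .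
qed

text \<open>Restart at the first passage over \<open>a\<close>: with steps at most 1 it overshoots \<open>a\<close> by at most 1.\<close>

lemma walk_overshoot:
  assumes X: "indep_vars (\<lambda>_. borel) (X :: nat \<Rightarrow> 'a \<Rightarrow> real) {..<K}"
    and D: "\<And>i. i < K \<Longrightarrow> distr M borel (X i) = D"
    and a: "0 \<le> a"
  shows "prob {w\<in>space M. \<exists>j\<le>K. psum (\<lambda>i. X i w) j > a + 2}
     \<le> prob {w\<in>space M. \<exists>i<K. X i w > 1}
      + prob {w\<in>space M. \<exists>j\<le>K. psum (\<lambda>i. X i w) j > a} * prob {w\<in>space M. \<exists>j\<le>K. psum (\<lambda>i. X i w) j > 1}"
proof -
  define S where "S j w = psum (\<lambda>i. X i w) j" for j w
  define p where "p = prob {w\<in>space M. \<exists>j\<le>K. S j w > 1}"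
  have Sadd: "S (k + n) w = S k w + psum (\<lambda>i. X (k + i) w) n" for k n w
    by (induction n) (auto simp: S_def)
  have Xm: "X i \<in> borel_measurable M" if "i < K" for i using X that by (auto simp: indep_vars_def)
  have Sm: "S j \<in> borel_measurable M" if "j \<le> K" for j
    unfolding S_def psum_def by (intro borel_measurable_sum Xm) (use that in auto)
  \<comment> \<open>The indices are clamped at \<open>K\<close>, since only the steps
    \<open>X i\<close> with \<open>i < K\<close> are known to be measurable.\<close>
  have [measurable]: "S (min j K) \<in> borel_measurable M" for j by (rule Sm) simp
  have Sev: "{w\<in>space M. \<exists>j\<le>K. S j w > c} \<in> events" for c
  proof -
    have "{w\<in>space M. \<exists>j\<le>K. S j w > c} = {w\<in>space M. \<exists>j\<le>K. S (min j K) w > c}"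
      by (simp add: min_absorb1 cong: conj_cong)
    also have "\<dots> \<in> events" by measurable
    finally show ?thesis .
  qed
  \<comment> \<open>\<open>T k\<close>: the first passage over \<open>a\<close> happens at step
    \<open>k\<close>. \<open>F k\<close>: the walk restarted at step \<open>k\<close> gains more
    than 1 in the steps that remain.\<close>
  define T where "T k = {w\<in>space M. S k w > a \<and> (\<forall>j<k. S j w \<le> a)}" for k
  define F where "F k = {w\<in>space M. \<exists>j\<le>K - k. psum (\<lambda>i. X (k + i) w) j > 1}" for k
  \<comment> \<open>The restarted walk has the law of the first \<open>K - k\<close> steps, and
    these are among the \<open>K\<close> steps that define \<open>p\<close>.\<close>
  have Fp: "prob (F k) \<le> p" if k: "k \<le> K" for k
  proof (cases "k = K")
    case False
    then have k0: "K - k \<noteq> 0" using k by simp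
    define A where "A = {y\<in>space (PiM {..<K - k} (\<lambda>_. borel :: real measure)). \<exists>j\<le>K - k. psum y j > 1}"
    have "(\<lambda>y. psum y j) \<in> borel_measurable (PiM {..<K - k} (\<lambda>_. borel))" if "j \<le> K - k" for j
      by (rule measurable_psum_PiM(2)) fact
    then have A: "A \<in> sets (PiM {..<K - k} (\<lambda>_. borel))" unfolding A_def by measurable
    have r: "(\<lambda>w. \<lambda>i\<in>{..<K - k}. X (l + i) w) \<in> measurable M (PiM {..<K - k} (\<lambda>_. borel))" if "l \<le> k" for l
      by (intro measurable_restrict Xm) (use that k in auto)
    have "psum (\<lambda>i\<in>{..<K - k}. X (l + i) w) j = psum (\<lambda>i. X (l + i) w) j" if "j \<le> K - k" for j l w
      by (rule psum_restrict) (rule that)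
    then have pre: "(\<lambda>w. \<lambda>i\<in>{..<K - k}. X (l + i) w) -` A \<inter> space M = {w\<in>space M. \<exists>j\<le>K - k. psum (\<lambda>i. X (l + i) w) j > 1}" for l
      by (auto simp: A_def space_PiM PiE_iff)
    have "prob (F k) = measure (distr M (PiM {..<K - k} (\<lambda>_. borel)) (\<lambda>w. \<lambda>i\<in>{..<K - k}. X (k + i) w)) A"
      by (subst measure_distr[OF r A]) (simp_all add: pre F_def)
    also have "\<dots> = measure (distr M (PiM {..<K - k} (\<lambda>_. borel)) (\<lambda>w. \<lambda>i\<in>{..<K - k}. X (0 + i) w)) A"
      by (subst (1 2) iid_shift_distr[OF X D]) (use k k0 in auto)
    also have "\<dots> = prob {w\<in>space M. \<exists>j\<le>K - k. psum (\<lambda>i. X (0 + i) w) j > 1}"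
      by (subst measure_distr[OF r A]) (rule le0, simp only: pre)
    also have "\<dots> \<le> p"
      unfolding p_def
    proof (rule finite_measure_mono)
      show "{w\<in>space M. \<exists>j\<le>K - k. psum (\<lambda>i. X (0 + i) w) j > 1} \<subseteq> {w\<in>space M. \<exists>j\<le>K. S j w > 1}"
        unfolding S_def add_0 by (blast intro: le_trans[OF _ diff_le_self])
    qed (rule Sev)
    finally show ?thesis .
  qed (simp add: F_def p_def)
  have Tm: "T k \<in> events" if "k \<le> K" for k
  proof -
    have "T k = {w\<in>space M. S (min k K) w > a \<and> (\<forall>j<k. S (min j K) w \<le> a)}"
      unfolding T_def using that by (simp add: min_absorb1 cong: conj_cong)
    also have "\<dots> \<in> events" by measurable
    finally show ?thesis .
  qed
  have TF: "prob (T k \<inter> F k) = prob (T k) * prob (F k)" if k: "k \<le> K" for k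
  proof -
    have ind: "indep_var (PiM {..<k} (\<lambda>_. borel)) (\<lambda>w. restrict (\<lambda>i. X i w) {..<k}) (PiM {k..<K} (\<lambda>_. borel)) (\<lambda>w. restrict (\<lambda>i. X i w) {k..<K})"
      by (rule indep_var_restrict[OF X]) (use k in auto)
    define A where "A = {y\<in>space (PiM {..<k} (\<lambda>_. borel :: real measure)). psum y k > a \<and> (\<forall>j<k. psum y j \<le> a)}"
    define B where "B = {y\<in>space (PiM {k..<K} (\<lambda>_. borel :: real measure)). \<exists>j\<le>K - k. psum (\<lambda>i. y (k + i)) j > 1}"
    have m1: "(\<lambda>y. psum y j) \<in> borel_measurable (PiM {..<k} (\<lambda>_. borel))" if "j \<le> k" for j
      by (rule measurable_psum_PiM(2)) fact
    have A: "A \<in> sets (PiM {..<k} (\<lambda>_. borel))" unfolding A_def using m1 by measurable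
    have m2: "(\<lambda>y. psum (\<lambda>i. y (k + i)) j) \<in> borel_measurable (PiM {k..<K} (\<lambda>_. borel))" if "j \<le> K - k" for j
      unfolding psum_def by (intro borel_measurable_sum measurable_component_singleton) (use that in auto)
    have B: "B \<in> sets (PiM {k..<K} (\<lambda>_. borel))" unfolding B_def using m2 by measurable
    have preA: "(\<lambda>w. restrict (\<lambda>i. X i w) {..<k}) -` A \<inter> space M = T k"
      by (auto simp: A_def T_def S_def space_PiM PiE_iff psum_restrict)
    have "psum (\<lambda>i. restrict (\<lambda>i. X i w) {k..<K} (k + i)) j = psum (\<lambda>i. X (k + i) w) j" if "j \<le> K - k" for j w
      by (rule psum_cong) (use that in auto)
    then have preB: "(\<lambda>w. restrict (\<lambda>i. X i w) {k..<K}) -` B \<inter> space M = F k"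
      by (auto simp: B_def F_def space_PiM PiE_iff)
    have "(\<lambda>w. (restrict (\<lambda>i. X i w) {..<k}, restrict (\<lambda>i. X i w) {k..<K})) -` (A \<times> B) \<inter> space M = T k \<inter> F k"
      unfolding preA[symmetric] preB[symmetric] by auto
    with indep_varD[OF ind A B] show ?thesis by (simp only: preA preB)
  qed
  have Fm: "F k \<in> events" if "k \<le> K" for k
  proof -
    have "F k = {w\<in>space M. \<exists>j\<le>K - k. S (min (k + j) K) w - S (min k K) w > 1}"
      unfolding F_def using that by (simp add: Sadd min_absorb1 cong: conj_cong)
    also have "\<dots> \<in> events" by measurable
    finally show ?thesis .
  qed
  have bad: "{w\<in>space M. \<exists>i<K. X i w > 1} \<in> events" using Xm by measurable
  \<comment> \<open>If no step exceeds 1, the walk is at most at \<open>a + 1\<close> when it first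
    passes \<open>a\<close>, so reaching a level above \<open>a + 2\<close> takes a further gain of
    more than 1.\<close>
  have sub: "{w\<in>space M. \<exists>j\<le>K. S j w > a + 2} \<subseteq> {w\<in>space M. \<exists>i<K. X i w > 1} \<union> (\<Union>k\<in>{..K}. T k \<inter> F k)"
  proof
    fix w assume "w \<in> {w\<in>space M. \<exists>j\<le>K. S j w > a + 2}"
    then obtain j where w: "w \<in> space M" and j: "j \<le> K" "S j w > a + 2" by auto
    show "w \<in> {w\<in>space M. \<exists>i<K. X i w > 1} \<union> (\<Union>k\<in>{..K}. T k \<inter> F k)"
    proof (cases "\<exists>i<K. X i w > 1")
      case False
      define k where "k = (LEAST k. S k w > a)"
      have ka: "S k w > a" unfolding k_def by (rule LeastI[of _ j]) (use j in simp)
      have kj: "k \<le> j" unfolding k_def by (rule Least_le) (use j in simp)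
      have kl: "S i w \<le> a" if "i < k" for i using not_less_Least[of i "\<lambda>k. S k w > a"] that unfolding k_def by (simp only: not_less)
      have "k \<noteq> 0"
      proof
        assume "k = 0"
        then show False using ka a by (simp add: S_def)
      qed
      then obtain k' where k': "k = Suc k'" by (cases k) auto
      have "S k w = S k' w + X k' w" by (simp add: k' S_def)
      moreover have "S k' w \<le> a" using kl[of k'] k' by simp
      moreover have "k' < K" using k' kj j(1) by simp
      then have "X k' w \<le> 1" using False by (meson not_le)
      ultimately have Sk: "S k w \<le> a + 1" by simp
      have "psum (\<lambda>i. X (k + i) w) (j - k) = S j w - S k w"
        using Sadd[of k "j - k" w] kj by simp
      then have "psum (\<lambda>i. X (k + i) w) (j - k) > 1" using Sk j by simp
      moreover have "j - k \<le> K - k" using j by simp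
      ultimately have "w \<in> F k" using w by (auto simp: F_def)
      moreover have "w \<in> T k" using w ka kl by (auto simp: T_def)
      moreover have "k \<in> {..K}" using kj j by simp
      ultimately show ?thesis by blast
    next
      case True
      then show ?thesis using w by blast
    qed
  qed
  have UTF: "(\<Union>k\<in>{..K}. T k \<inter> F k) \<in> events" using Tm Fm by (intro sets.finite_UN) auto
  have "prob {w\<in>space M. \<exists>j\<le>K. S j w > a + 2} \<le> prob ({w\<in>space M. \<exists>i<K. X i w > 1} \<union> (\<Union>k\<in>{..K}. T k \<inter> F k))"
    by (rule finite_measure_mono[OF sub sets.Un[OF bad UTF]])
  also have "\<dots> \<le> prob {w\<in>space M. \<exists>i<K. X i w > 1} + prob (\<Union>k\<in>{..K}. T k \<inter> F k)"
    by (rule measure_Un_le[OF bad UTF])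
  also have "prob (\<Union>k\<in>{..K}. T k \<inter> F k) \<le> (\<Sum>k\<le>K. prob (T k \<inter> F k))"
    using Tm Fm by (intro measure_UNION_le) auto
  also have "\<dots> \<le> (\<Sum>k\<le>K. prob (T k) * p)"
    using TF Fp by (intro sum_mono) (simp add: mult_left_mono)
  also have "\<dots> = prob (\<Union>k\<in>{..K}. T k) * p"
  proof -
    have "disjoint_family_on T {..K}"
      unfolding disjoint_family_on_def
    proof (intro ballI impI)
      fix m n assume "m \<noteq> (n::nat)"
      then show "T m \<inter> T n = {}" unfolding T_def by (cases m n rule: linorder_cases) force+
    qed
    then have "prob (\<Union>k\<in>{..K}. T k) = (\<Sum>k\<le>K. prob (T k))"
      using Tm by (intro finite_measure_finite_Union) auto
    then show ?thesis by (simp add: sum_distrib_right)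
  qed
  also have "prob (\<Union>k\<in>{..K}. T k) * p \<le> prob {w\<in>space M. \<exists>j\<le>K. S j w > a} * p"
    by (intro mult_right_mono finite_measure_mono Sev) (auto simp: T_def p_def)
  finally show ?thesis unfolding S_def p_def by simp
qed

end

section \<open>Spectrally negative Levy processes\<close>

text \<open>Only upward movement is controlled. Just before \<open>t\<close> the path is near its
  left limit \<open>l\<close>, from \<open>t\<close> on it is near \<open>f t \<le> l\<close>, so
  crossing \<open>t\<close> cannot raise it by more than \<open>\<epsilon>\<close>, however large
  the downward jump. Compactness makes this uniform.\<close>

lemma cadlag_no_jump_modulus:
  fixes f :: "real \<Rightarrow> real"
  assumes f: "cadlag f" and npj: "\<And>t l. 0 < t \<Longrightarrow> (f \<longlongrightarrow> l) (at_left t) \<Longrightarrow> f t \<le> l" and \<epsilon>: "0 < \<epsilon>"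
  obtains \<delta> where "0 < \<delta>" "\<And>s s'. 0 \<le> s \<Longrightarrow> s \<le> s' \<Longrightarrow> s \<le> T \<Longrightarrow> s' - s < \<delta> \<Longrightarrow> f s' - f s \<le> \<epsilon>"
proof -
  have loc: "\<exists>d>0. \<forall>s s'. 0 \<le> s \<longrightarrow> s \<le> s' \<longrightarrow> \<bar>s - t\<bar> < d \<longrightarrow> \<bar>s' - t\<bar> < d \<longrightarrow> f s' - f s \<le> \<epsilon>" if t: "0 \<le> t" for t
  proof -
    have "(f \<longlongrightarrow> f t) (at_right t)" using f t by (auto simp: cadlag_def)
    then have "\<forall>\<^sub>F s in at_right t. dist (f s) (f t) < \<epsilon> / 2" using \<epsilon> by (intro tendstoD) auto
    then obtain b where b: "b > t" "\<And>s. t < s \<Longrightarrow> s < b \<Longrightarrow> \<bar>f s - f t\<bar> < \<epsilon> / 2"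
      unfolding eventually_at_right_field dist_real_def by blast
    have r: "\<bar>f s - f t\<bar> < \<epsilon> / 2" if "t \<le> s" "s < b" for s
      using b(2)[of s] that \<epsilon> by (cases "s = t") auto
    show ?thesis
    proof (cases "t = 0")
      case True
      show ?thesis
      proof (intro exI[of _ b] conjI allI impI)
        fix s s' assume "0 \<le> s" "s \<le> s'" "\<bar>s - t\<bar> < b" "\<bar>s' - t\<bar> < b"
        then have "t \<le> s" "s < b" "t \<le> s'" "s' < b" using True by auto
        then have "\<bar>f s - f t\<bar> < \<epsilon> / 2" "\<bar>f s' - f t\<bar> < \<epsilon> / 2" using r by blast+
        then show "f s' - f s \<le> \<epsilon>" by linarith
      qed (use b True in simp)
    next
      case False
      then have t0: "0 < t" using t by simp
      then obtain l where l: "(f \<longlongrightarrow> l) (at_left t)" using f unfolding cadlag_def by (meson less_imp_le)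
      then have fl: "f t \<le> l" using npj t0 by auto
      have "\<forall>\<^sub>F s in at_left t. dist (f s) l < \<epsilon> / 2" using \<epsilon> l by (intro tendstoD) auto
      then obtain a where a: "a < t" "\<And>s. a < s \<Longrightarrow> s < t \<Longrightarrow> \<bar>f s - l\<bar> < \<epsilon> / 2"
        unfolding eventually_at_left_field dist_real_def by blast
      show ?thesis
      proof (intro exI[of _ "min (b - t) (t - a)"] conjI allI impI)
        fix s s' assume s: "0 \<le> s" "s \<le> s'" "\<bar>s - t\<bar> < min (b - t) (t - a)" "\<bar>s' - t\<bar> < min (b - t) (t - a)"
        have *: "a < s" "s < b" "a < s'" "s' < b" using s by (auto simp: abs_less_iff)
        show "f s' - f s \<le> \<epsilon>"
        proof (cases "s < t")
          case True
          then have "\<bar>f s - l\<bar> < \<epsilon> / 2" using * by (intro a)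
          moreover have "\<bar>f s' - l\<bar> < \<epsilon> / 2 \<or> \<bar>f s' - f t\<bar> < \<epsilon> / 2" using a(2)[of s'] r[of s'] * by linarith
          ultimately show ?thesis using fl by linarith
        next
          case False
          then have "t \<le> s" "t \<le> s'" using s by auto
          then have "\<bar>f s - f t\<bar> < \<epsilon> / 2" "\<bar>f s' - f t\<bar> < \<epsilon> / 2" using * r by blast+
          then show ?thesis by linarith
        qed
      qed (use a b in auto)
    qed
  qed
  then obtain d where d: "\<And>t. 0 \<le> t \<Longrightarrow> d t > 0"
    "\<And>t s s'. 0 \<le> t \<Longrightarrow> 0 \<le> s \<Longrightarrow> s \<le> s' \<Longrightarrow> \<bar>s - t\<bar> < d t \<Longrightarrow> \<bar>s' - t\<bar> < d t \<Longrightarrow> f s' - f s \<le> \<epsilon>"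
    by metis
  \<comment> \<open>A Lebesgue number of the cover of \<open>[0, T]\<close> by the balls of the
    local estimate. Only \<open>s\<close> has to lie in \<open>[0, T]\<close>; the ball around it
    contains \<open>s'\<close>.\<close>
  obtain e where e: "0 < e" "\<And>x. x \<in> {0..T} \<Longrightarrow> \<exists>G\<in>(\<lambda>t. ball t (d t)) ` {0..T}. ball x e \<subseteq> G"
  proof (rule Heine_Borel_lemma[of "{0..T}" "(\<lambda>t. ball t (d t)) ` {0..T}"])
    show "{0..T} \<subseteq> \<Union> ((\<lambda>t. ball t (d t)) ` {0..T})" using d(1) by force
  qed (auto intro: that)
  show thesis
  proof (rule that[OF e(1)])
    fix s s' assume s: "0 \<le> s" "s \<le> s'" "s \<le> T" "s' - s < e"
    then obtain t where t: "t \<in> {0..T}" "ball s e \<subseteq> ball t (d t)" using e(2)[of s] by auto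
    have "s \<in> ball s e" "s' \<in> ball s e" using s e by (auto simp: dist_real_def)
    then have "s \<in> ball t (d t)" "s' \<in> ball t (d t)" using t(2) by (blast intro: subsetD)+
    then show "f s' - f s \<le> \<epsilon>" using d(2)[of t s s'] t s by (auto simp: dist_real_def abs_minus_commute)
  qed
qed

lemma ennreal_le_suminf: "h j \<le> (\<Sum>j. h j)" for h :: "nat \<Rightarrow> ennreal"
  using sum_le_suminf[of h "{j}"] by simp

lemma (in prob_space) prob_tendsto_0_AE:
  assumes B: "\<And>n. B n \<in> events" and AE: "AE w in M. \<forall>\<^sub>F n in sequentially. w \<notin> B n"
  shows "(\<lambda>n. prob (B n)) \<longlonglongrightarrow> 0"
proof -
  have "(\<lambda>n. \<integral>w. indicator (B n) w \<partial>M) \<longlonglongrightarrow> (\<integral>w. (0::real) \<partial>M)"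
  proof (rule integral_dominated_convergence[where w="\<lambda>_. 1"])
    show "AE w in M. (\<lambda>n. indicator (B n) w :: real) \<longlonglongrightarrow> 0"
      using AE
    proof eventually_elim
      fix w assume "\<forall>\<^sub>F n in sequentially. w \<notin> B n"
      then have "\<forall>\<^sub>F n in sequentially. (indicator (B n) w :: real) = 0" by eventually_elim auto
      then show "(\<lambda>n. indicator (B n) w :: real) \<longlonglongrightarrow> 0" by (rule tendsto_eventually)
    qed
  qed (use B in \<open>auto simp: indicator_def\<close>)
  then show ?thesis using B by simp
qed

locale spectrally_negative_levy = prob_space N for N :: "'a measure" +
  fixes X :: "real \<Rightarrow> 'a \<Rightarrow> real"
  assumes levy: "levy_process N X" and npj: "no_positive_jumps N X"
begin

lemma X_measurable: "0 \<le> t \<Longrightarrow> X t \<in> borel_measurable N"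
  and X_0: "AE w in N. X 0 w = 0"
  and X_distr: "0 \<le> s \<Longrightarrow> 0 \<le> h \<Longrightarrow> distr N borel (\<lambda>w. X (s + h) w - X s w) = distr N borel (X h)"
  and X_cadlag: "AE w in N. cadlag (\<lambda>t. X t w)"
  using levy unfolding levy_process_def by blast+

lemma X_measurable' [measurable]: "X (real k / 2 ^ n) \<in> borel_measurable N" "X (real k) \<in> borel_measurable N"
  "X 0 \<in> borel_measurable N" "X 1 \<in> borel_measurable N" "X (1 / 2 ^ n) \<in> borel_measurable N"
  by (auto intro: X_measurable)

definition inc :: "nat \<Rightarrow> nat \<Rightarrow> 'a \<Rightarrow> real" where
  "inc n i w = X (real (Suc i) / 2 ^ n) w - X (real i / 2 ^ n) w"

lemma inc_measurable [measurable]: "inc n i \<in> borel_measurable N"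
  unfolding inc_def by measurable

lemma inc_indep: "indep_vars (\<lambda>_. borel) (inc n) {..<K}"
proof -
  have "(\<forall>(t :: nat \<Rightarrow> real) n. 0 \<le> t 0 \<and> (\<forall>i<n. t i \<le> t (Suc i)) \<longrightarrow>
        indep_vars (\<lambda>_. borel) (\<lambda>i w. X (t (Suc i)) w - X (t i) w) {..<n})"
    using levy unfolding levy_process_def by blast
  from this[rule_format, of "\<lambda>i. real i / 2 ^ n" K] show ?thesis
    unfolding inc_def by (auto simp: divide_right_mono)
qed

lemma inc_distr: "distr N borel (inc n i) = distr N borel (X (1 / 2 ^ n))"
  using X_distr[of "real i / 2 ^ n" "1 / 2 ^ n"] unfolding inc_def by (simp add: add_divide_distrib add.commute)

lemma psum_inc: "psum (\<lambda>i. inc n i w) k = X (real k / 2 ^ n) w - X 0 w"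
  by (induction k) (auto simp: inc_def)

text \<open>The absence of positive jumps enters the estimates through this lemma: with
  \<open>\<epsilon> = 1\<close> it feeds the overshoot bound, with \<open>\<epsilon>\<close> tending
  to 0 the lower bound on record sums. From which \<open>n\<close> on it holds depends on the
  path.\<close>

lemma inc_small:
  assumes "0 < \<epsilon>"
  shows "AE w in N. \<forall>m. \<forall>\<^sub>F n in sequentially. \<forall>k<m * 2 ^ n. inc n k w \<le> \<epsilon>"
  using X_cadlag npj unfolding no_positive_jumps_def
proof eventually_elim
  fix w assume c: "cadlag (\<lambda>t. X t w)" and j: "\<forall>t>0. \<forall>l. ((\<lambda>s. X s w) \<longlongrightarrow> l) (at_left t) \<longrightarrow> X t w \<le> l"
  show "\<forall>m. \<forall>\<^sub>F n in sequentially. \<forall>k<m * 2 ^ n. inc n k w \<le> \<epsilon>"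
  proof
    fix m :: nat
    obtain \<delta> where \<delta>: "0 < \<delta>" "\<And>s s'. 0 \<le> s \<Longrightarrow> s \<le> s' \<Longrightarrow> s \<le> real m \<Longrightarrow> s' - s < \<delta> \<Longrightarrow> X s' w - X s w \<le> \<epsilon>"
      using cadlag_no_jump_modulus[OF c _ assms, of "real m"] j by blast
    have "(\<lambda>n. (1/2::real) ^ n) \<longlonglongrightarrow> 0" by (rule LIMSEQ_power_zero) simp
    then have "\<forall>\<^sub>F n in sequentially. (1/2::real) ^ n < \<delta>" using \<delta>(1) by (rule order_tendstoD)
    then show "\<forall>\<^sub>F n in sequentially. \<forall>k<m * 2 ^ n. inc n k w \<le> \<epsilon>"
    proof eventually_elim
      fix n assume n: "(1/2::real) ^ n < \<delta>"
      show "\<forall>k<m * 2 ^ n. inc n k w \<le> \<epsilon>"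
      proof (intro allI impI)
        fix k assume "k < m * 2 ^ n"
        then have "real k \<le> real (m * 2 ^ n)" by (simp only: of_nat_le_iff less_imp_le)
        then have "real k / 2 ^ n \<le> real m" by (simp add: field_simps)
        then show "inc n k w \<le> \<epsilon>"
          unfolding inc_def using n by (intro \<delta>(2)) (auto simp: field_simps power_divide)
      qed
    qed
  qed
qed

lemma X_right_0: "AE w in N. \<exists>d>0. \<forall>t. 0 \<le> t \<longrightarrow> t < d \<longrightarrow> X t w \<le> 1"
  using X_cadlag X_0
proof eventually_elim
  fix w assume c: "cadlag (\<lambda>t. X t w)" and 0: "X 0 w = 0"
  have "((\<lambda>t. X t w) \<longlongrightarrow> 0) (at_right 0)" using c 0 by (auto simp: cadlag_def)
  then have "\<forall>\<^sub>F t in at_right 0. X t w < 1" by (rule order_tendstoD) simp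
  then obtain b where b: "b > 0" "\<And>t. 0 < t \<Longrightarrow> t < b \<Longrightarrow> X t w < 1"
    unfolding eventually_at_right_field by blast
  have "X t w \<le> 1" if "0 \<le> t" "t < b" for t
    using b(2)[of t] that 0 by (cases "t = 0") auto
  then show "\<exists>d>0. \<forall>t. 0 \<le> t \<longrightarrow> t < d \<longrightarrow> X t w \<le> 1" using b(1) by blast
qed

section \<open>Geometric tails and finite exponential moments\<close>

text \<open>\<open>s\<close> fixes the time interval, which starts at 0 and has length
  \<open>2 ^ -s\<close>; \<open>n\<close> only refines the grid on it.\<close>

definition grid_exceeds :: "nat \<Rightarrow> nat \<Rightarrow> real \<Rightarrow> 'a set" where
  "grid_exceeds s n a = {w\<in>space N. \<exists>k\<le>2 ^ n. X (real k / 2 ^ (s + n)) w > a}"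

definition exceeds :: "nat \<Rightarrow> real \<Rightarrow> 'a set" where
  "exceeds s a = (\<Union>n. grid_exceeds s n a)"

lemma grid_exceeds_events [measurable]: "grid_exceeds s n a \<in> events"
  unfolding grid_exceeds_def by measurable

lemma exceeds_events [measurable]: "exceeds s a \<in> events"
  unfolding exceeds_def by measurable

lemma grid_exceeds_incseq: "incseq (\<lambda>n. grid_exceeds s n a)"
proof (rule incseq_SucI)
  fix n
  show "grid_exceeds s n a \<subseteq> grid_exceeds s (Suc n) a"
  proof
    fix w assume "w \<in> grid_exceeds s n a"
    then obtain k where k: "w \<in> space N" "k \<le> 2 ^ n" "X (real k / 2 ^ (s + n)) w > a" by (auto simp: grid_exceeds_def)
    have "real (2 * k) / 2 ^ (s + Suc n) = real k / 2 ^ (s + n)" by simp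
    then have "X (real (2 * k) / 2 ^ (s + Suc n)) w > a" using k(3) by (simp only:)
    moreover have "2 * k \<le> 2 ^ Suc n" using k by simp
    ultimately show "w \<in> grid_exceeds s (Suc n) a" using k(1) unfolding grid_exceeds_def by blast
  qed
qed

text \<open>This geometric tail is what makes all exponential moments finite: its ratio tends to 0 with the
  length \<open>2\<^sup>-\<^sup>s\<close> of the time interval.\<close>

lemma exceeds_submult:
  assumes a: "0 \<le> a"
  shows "prob (exceeds s (a + 2)) \<le> prob (exceeds s a) * prob (exceeds s 1)"
proof -
  \<comment> \<open>On paths with a step above 1 the overshoot over a level is not controlled; their
    probability vanishes as the grid is refined.\<close>
  define bad where "bad n = {w\<in>space N. \<exists>i<2 ^ n. inc (s + n) i w > 1}" for n
  have bad_ev: "bad n \<in> events" for n unfolding bad_def by measurable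
  have bad0: "(\<lambda>n. prob (bad n)) \<longlonglongrightarrow> 0"
  proof (rule prob_tendsto_0_AE[OF bad_ev])
    show "AE w in N. \<forall>\<^sub>F n in sequentially. w \<notin> bad n"
      using inc_small[OF zero_less_one]
    proof eventually_elim
      fix w assume *: "\<forall>m. \<forall>\<^sub>F n in sequentially. \<forall>k<m * 2 ^ n. inc n k w \<le> 1"
      then have "\<forall>\<^sub>F n in sequentially. \<forall>k<1 * 2 ^ n. inc n k w \<le> 1" by blast
      then have "\<forall>\<^sub>F n in sequentially. \<forall>k<1 * 2 ^ (n + s). inc (n + s) k w \<le> 1"
        by (subst eventually_sequentially_seg[where P="\<lambda>n. \<forall>k<1 * 2 ^ n. inc n k w \<le> 1"])
      then show "\<forall>\<^sub>F n in sequentially. w \<notin> bad n"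
      proof eventually_elim
        fix n assume h: "\<forall>k<1 * 2 ^ (n + s). inc (n + s) k w \<le> 1"
        have "inc (s + n) i w \<le> 1" if "i < 2 ^ n" for i
        proof -
          have "(2::nat) ^ n \<le> 1 * 2 ^ (n + s)" by simp
          then show ?thesis using h that by (metis add.commute less_le_trans)
        qed
        then show "w \<notin> bad n" unfolding bad_def by (blast dest: leD)
      qed
    qed
  qed
  have eq: "prob (grid_exceeds s n b) = prob {w\<in>space N. \<exists>j\<le>2 ^ n. psum (\<lambda>i. inc (s + n) i w) j > b}" for n b
  proof (rule finite_measure_eq_AE)
    show "AE w in N. (w \<in> grid_exceeds s n b) = (w \<in> {w\<in>space N. \<exists>j\<le>2 ^ n. psum (\<lambda>i. inc (s + n) i w) j > b})"
      using X_0 by eventually_elim (simp add: grid_exceeds_def psum_inc)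
    show "{w\<in>space N. \<exists>j\<le>2 ^ n. psum (\<lambda>i. inc (s + n) i w) j > b} \<in> events"
      unfolding psum_inc by measurable
  qed measurable
  have step: "prob (grid_exceeds s n (a + 2)) \<le> prob (bad n) + prob (exceeds s a) * prob (exceeds s 1)" for n
  proof -
    have "prob (grid_exceeds s n (a + 2)) \<le> prob (bad n) + prob (grid_exceeds s n a) * prob (grid_exceeds s n 1)"
      using walk_overshoot[OF inc_indep[of "s + n" "2 ^ n"] inc_distr a] unfolding eq bad_def .
    also have "\<dots> \<le> prob (bad n) + prob (exceeds s a) * prob (exceeds s 1)"
      by (intro add_left_mono mult_mono finite_measure_mono) (auto simp: exceeds_def)
    finally show ?thesis .
  qed
  have "(\<lambda>n. prob (grid_exceeds s n (a + 2))) \<longlonglongrightarrow> prob (exceeds s (a + 2))"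
    unfolding exceeds_def by (rule finite_Lim_measure_incseq) (auto intro: grid_exceeds_incseq)
  moreover have "(\<lambda>n. prob (bad n) + prob (exceeds s a) * prob (exceeds s 1)) \<longlonglongrightarrow> 0 + prob (exceeds s a) * prob (exceeds s 1)"
    by (intro tendsto_add bad0 tendsto_const)
  ultimately show ?thesis
    using step by (simp add: LIMSEQ_le)
qed

lemma exceeds_power: "prob (exceeds s (2 * real j)) \<le> prob (exceeds s 1) ^ j"
proof (induction j)
  case (Suc j)
  have "prob (exceeds s (2 * real (Suc j))) = prob (exceeds s (2 * real j + 2))" by (simp add: algebra_simps)
  also have "\<dots> \<le> prob (exceeds s (2 * real j)) * prob (exceeds s 1)" by (rule exceeds_submult) simp
  also have "\<dots> \<le> prob (exceeds s 1) ^ j * prob (exceeds s 1)" by (intro mult_right_mono Suc) simp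
  finally show ?case by (simp add: mult.commute)
qed simp

lemma exceeds_tendsto_0: "(\<lambda>s. prob (exceeds s 1)) \<longlonglongrightarrow> 0"
proof (rule prob_tendsto_0_AE)
  show "AE w in N. \<forall>\<^sub>F s in sequentially. w \<notin> exceeds s 1"
    using X_right_0
  proof eventually_elim
    fix w assume "\<exists>d>0. \<forall>t. 0 \<le> t \<longrightarrow> t < d \<longrightarrow> X t w \<le> 1"
    then obtain d where d: "0 < d" "\<And>t. 0 \<le> t \<Longrightarrow> t < d \<Longrightarrow> X t w \<le> 1" by blast
    have "(\<lambda>n. (1/2::real) ^ n) \<longlonglongrightarrow> 0" by (rule LIMSEQ_power_zero) simp
    then have "\<forall>\<^sub>F n in sequentially. (1/2::real) ^ n < d" using d(1) by (rule order_tendstoD)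
    then show "\<forall>\<^sub>F s in sequentially. w \<notin> exceeds s 1"
    proof eventually_elim
      fix s assume s: "(1/2::real) ^ s < d"
      have "X (real k / 2 ^ (s + n)) w \<le> 1" if "k \<le> 2 ^ n" for n k
      proof (rule d(2))
        have "real k \<le> 2 ^ n" using that by (metis of_nat_le_iff of_nat_numeral of_nat_power)
        then have "real k / 2 ^ (s + n) \<le> (1/2) ^ s" by (simp add: field_simps power_add)
        then show "real k / 2 ^ (s + n) < d" using s by simp
      qed simp
      then show "w \<notin> exceeds s 1" unfolding exceeds_def grid_exceeds_def by (auto simp: not_less)
    qed
  qed
qed measurable

text \<open>Each factor of the geometric tail pays for a level difference of 2, so the moment of
  order \<open>u\<close> needs a tail ratio below \<open>exp (- (2 * u))\<close>. A sufficiently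
  short interval, depending on \<open>u\<close>, provides it; \<open>exp_moment_one_finite\<close>
  reaches time 1 by independence of increments.\<close>

lemma exp_moment_small:
  assumes u: "0 \<le> u"
  obtains s where "(\<integral>\<^sup>+w. ennreal (exp (u * X (1 / 2 ^ s) w)) \<partial>N) < \<infinity>"
proof -
  \<comment> \<open>Chosen so that \<open>exp (2 * u) * \<delta> = 1 / 2\<close>, the ratio of the
    majorizing series.\<close>
  define \<delta> where "\<delta> = exp (- (2 * u)) / 2"
  have "\<forall>\<^sub>F s in sequentially. prob (exceeds s 1) < \<delta>"
    using exceeds_tendsto_0 by (rule order_tendstoD) (simp add: \<delta>_def)
  then obtain s where s: "prob (exceeds s 1) < \<delta>" by (auto simp: eventually_sequentially)
  have pX: "prob {w\<in>space N. X (1 / 2 ^ s) w > 2 * real j} \<le> \<delta> ^ j" for j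
  proof -
    have "{w\<in>space N. X (1 / 2 ^ s) w > 2 * real j} \<subseteq> grid_exceeds s 0 (2 * real j)"
      by (auto simp: grid_exceeds_def intro!: exI[of _ 1])
    also have "\<dots> \<subseteq> exceeds s (2 * real j)" by (auto simp: exceeds_def)
    finally have "prob {w\<in>space N. X (1 / 2 ^ s) w > 2 * real j} \<le> prob (exceeds s (2 * real j))"
      by (intro finite_measure_mono) auto
    also have "\<dots> \<le> prob (exceeds s 1) ^ j" by (rule exceeds_power)
    also have "\<dots> \<le> \<delta> ^ j" using s by (intro power_mono) auto
    finally show ?thesis .
  qed
  have "(\<integral>\<^sup>+w. ennreal (exp (u * X (1 / 2 ^ s) w)) \<partial>N)
     \<le> (\<integral>\<^sup>+w. 1 + (\<Sum>j. ennreal (exp (2 * u * real (Suc j))) * indicator {w\<in>space N. X (1 / 2 ^ s) w > 2 * real j} w) \<partial>N)"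
  proof (intro nn_integral_mono)
    fix w assume w: "w \<in> space N"
    let ?x = "X (1 / 2 ^ s) w"
    show "ennreal (exp (u * ?x)) \<le> 1 + (\<Sum>j. ennreal (exp (2 * u * real (Suc j))) * indicator {w\<in>space N. X (1 / 2 ^ s) w > 2 * real j} w)"
    proof (cases "?x \<le> 0")
      case True
      then have "exp (u * ?x) \<le> 1" using u by (simp add: mult_nonneg_nonpos)
      then have "ennreal (exp (u * ?x)) \<le> 1" by simp
      then show ?thesis by (rule order_trans) simp
    next
      case False
      \<comment> \<open>The index of the strip \<open>2 * j < ?x \<le> 2 * (j + 1)\<close>; the
        ceiling is used because the lower inequality is the strict one.\<close>
      define j where "j = nat (\<lceil>?x / 2\<rceil> - 1)"
      have "0 < \<lceil>?x / 2\<rceil>" using False by simp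
      then have "real j = real_of_int \<lceil>?x / 2\<rceil> - 1" by (simp add: j_def)
      then have j: "2 * real j < ?x" "?x \<le> 2 * real (Suc j)" by (simp_all, linarith+)
      have "exp (u * ?x) \<le> exp (2 * u * real (Suc j))"
        using mult_left_mono[OF j(2) u] by (simp add: mult_ac)
      then have "ennreal (exp (u * ?x)) \<le> ennreal (exp (2 * u * real (Suc j))) * indicator {w\<in>space N. X (1 / 2 ^ s) w > 2 * real j} w"
        using j w by (simp add: ennreal_leI)
      also have "\<dots> \<le> (\<Sum>j. ennreal (exp (2 * u * real (Suc j))) * indicator {w\<in>space N. X (1 / 2 ^ s) w > 2 * real j} w)"
        by (rule ennreal_le_suminf)
      finally show ?thesis by (rule order_trans) simp
    qed
  qed
  also have "\<dots> = 1 + (\<Sum>j. ennreal (exp (2 * u * real (Suc j))) * emeasure N {w\<in>space N. X (1 / 2 ^ s) w > 2 * real j})"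
    by (subst nn_integral_add, simp, simp, subst nn_integral_suminf) (auto simp: emeasure_space_1 nn_integral_cmult_indicator)
  also have "\<dots> \<le> 1 + (\<Sum>j. ennreal (exp (2 * u) * (1/2) ^ j))"
  proof (intro add_left_mono suminf_le)
    fix j
    have "exp (2 * u * real (Suc j)) * prob {w\<in>space N. X (1 / 2 ^ s) w > 2 * real j} \<le> exp (2 * u * real (Suc j)) * \<delta> ^ j"
      by (intro mult_left_mono pX) simp
    also have "\<dots> = exp (2 * u) * (exp (2 * u) * \<delta>) ^ j"
      by (simp only: power_mult_distrib exp_of_nat_mult[symmetric] mult.assoc[symmetric] exp_add[symmetric]) (simp add: algebra_simps)
    also have "exp (2 * u) * \<delta> = 1 / 2" by (simp add: \<delta>_def exp_minus)
    finally show "ennreal (exp (2 * u * real (Suc j))) * emeasure N {w\<in>space N. X (1 / 2 ^ s) w > 2 * real j} \<le> ennreal (exp (2 * u) * (1/2) ^ j)"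
      by (simp only: emeasure_eq_measure ennreal_mult'[symmetric] exp_ge_zero ennreal_leI)
  qed auto
  also have "(\<Sum>j. ennreal (exp (2 * u) * (1/2) ^ j)) = ennreal (exp (2 * u) * 2)"
  proof (rule suminf_ennreal_eq)
    show "(\<lambda>j. exp (2 * u) * (1/2) ^ j) sums (exp (2 * u) * 2)"
      using sums_mult[OF geometric_sums[of "1/2::real"]] by simp
  qed simp
  also have "1 + ennreal (exp (2 * u) * 2) < \<infinity>" by simp
  finally show thesis by (rule that)
qed

lemma exp_moment_inc:
  "(\<integral>\<^sup>+w. ennreal (exp (u * inc n i w)) \<partial>N) = (\<integral>\<^sup>+w. ennreal (exp (u * X (1 / 2 ^ n) w)) \<partial>N)"
proof -
  have "(\<integral>\<^sup>+w. ennreal (exp (u * inc n i w)) \<partial>N) = (\<integral>\<^sup>+x. ennreal (exp (u * x)) \<partial>distr N borel (inc n i))"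
    by (subst nn_integral_distr) auto
  also have "\<dots> = (\<integral>\<^sup>+w. ennreal (exp (u * X (1 / 2 ^ n) w)) \<partial>N)"
    unfolding inc_distr by (subst nn_integral_distr) auto
  finally show ?thesis .
qed

lemma exp_moment_grid:
  "(\<integral>\<^sup>+w. ennreal (exp (u * X (real k / 2 ^ n) w)) \<partial>N) = (\<integral>\<^sup>+w. ennreal (exp (u * X (1 / 2 ^ n) w)) \<partial>N) ^ k"
proof -
  have "(\<integral>\<^sup>+w. ennreal (exp (u * X (real k / 2 ^ n) w)) \<partial>N) = (\<integral>\<^sup>+w. (\<Prod>i<k. ennreal (exp (u * inc n i w))) \<partial>N)"
  proof (rule nn_integral_cong_AE, use X_0 in eventually_elim)
    fix w assume "X 0 w = 0"
    then have "u * X (real k / 2 ^ n) w = (\<Sum>i<k. u * inc n i w)"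
      using psum_inc[of n w k] by (simp add: psum_def sum_distrib_left[symmetric])
    then show "ennreal (exp (u * X (real k / 2 ^ n) w)) = (\<Prod>i<k. ennreal (exp (u * inc n i w)))"
      by (simp add: exp_sum prod_ennreal)
  qed
  also have "\<dots> = (\<Prod>i<k. \<integral>\<^sup>+w. ennreal (exp (u * inc n i w)) \<partial>N)"
  proof (rule indep_vars_nn_integral)
    have "indep_vars (\<lambda>_. borel) (\<lambda>i. (\<lambda>x. ennreal (exp (u * x))) \<circ> inc n i) {..<k}"
      by (rule indep_vars_compose[OF inc_indep]) auto
    then show "indep_vars (\<lambda>_. borel) (\<lambda>i w. ennreal (exp (u * inc n i w))) {..<k}" by (simp add: comp_def)
  qed auto
  also have "\<dots> = (\<integral>\<^sup>+w. ennreal (exp (u * X (1 / 2 ^ n) w)) \<partial>N) ^ k"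
    by (simp add: exp_moment_inc)
  finally show ?thesis .
qed

lemma exp_moment_one_finite:
  assumes "0 \<le> u"
  shows "(\<integral>\<^sup>+w. ennreal (exp (u * X 1 w)) \<partial>N) < \<infinity>"
proof -
  obtain s where s: "(\<integral>\<^sup>+w. ennreal (exp (u * X (1 / 2 ^ s) w)) \<partial>N) < \<infinity>"
    using exp_moment_small[OF assms] by blast
  have "real (2 ^ s) / 2 ^ s = 1" by simp
  then show ?thesis
    using exp_moment_grid[of u "2 ^ s" s] s by (simp add: power_less_top_ennreal)
qed

lemma exp_integrable: "0 \<le> u \<Longrightarrow> integrable N (\<lambda>w. exp (u * X 1 w))"
  using exp_moment_one_finite[of u] by (intro integrableI_bounded) auto

abbreviation "\<psi> \<equiv> laplace_exponent N X"

definition mgf :: "real \<Rightarrow> real" where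
  "mgf u = (\<integral>w. exp (u * X 1 w) \<partial>N)"

lemma mgf_nn: "0 \<le> u \<Longrightarrow> (\<integral>\<^sup>+w. ennreal (exp (u * X 1 w)) \<partial>N) = ennreal (mgf u)"
  unfolding mgf_def by (intro nn_integral_eq_integral exp_integrable) auto

lemma mgf_pos:
  assumes "0 \<le> u"
  shows "0 < mgf u"
proof -
  have "0 \<le> mgf u" unfolding mgf_def by (rule integral_nonneg_AE) simp
  moreover have "mgf u \<noteq> 0"
  proof
    assume "mgf u = 0"
    then have "AE w in N. exp (u * X 1 w) = 0"
      unfolding mgf_def using exp_integrable[OF assms] by (subst (asm) integral_nonneg_eq_0_iff_AE) auto
    then show False by (simp add: AE_False)
  qed
  ultimately show ?thesis by simp
qed

lemma mgf_exp: "0 \<le> u \<Longrightarrow> mgf u = exp (\<psi> u)"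
  using mgf_pos[of u] by (simp add: laplace_exponent_def mgf_def)

text \<open>The time interval \<open>[0, 1]\<close> consists of \<open>2 ^ n\<close> independent
  increments with the same law, so the moment is the nonnegative root of order \<open>2 ^ n\<close>
  of \<open>exp (\<psi> u)\<close>.\<close>

lemma exp_moment_step:
  assumes u: "0 \<le> u"
  shows "(\<integral>\<^sup>+w. ennreal (exp (u * X (1 / 2 ^ n) w)) \<partial>N) = ennreal (exp (\<psi> u / 2 ^ n))"
proof -
  let ?I = "\<integral>\<^sup>+w. ennreal (exp (u * X (1 / 2 ^ n) w)) \<partial>N"
  have "real (2 ^ n) / 2 ^ n = 1" by simp
  then have p: "?I ^ (2 ^ n) = ennreal (exp (\<psi> u))"
    using exp_moment_grid[of u "2 ^ n" n] mgf_nn[OF u] mgf_exp[OF u] by simp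
  have fin: "?I \<noteq> \<infinity>"
    using p by (auto simp: power_eq_top_ennreal)
  then obtain r where r: "0 \<le> r" "?I = ennreal r" by (cases ?I) auto
  then have "ennreal (r ^ (2 ^ n)) = ennreal (exp (\<psi> u))" using p by (simp add: ennreal_power)
  then have "r ^ (2 ^ n) = exp (\<psi> u)" using r by simp
  also have "\<dots> = exp (real (2 ^ n) * (\<psi> u / 2 ^ n))" by simp
  also have "\<dots> = exp (\<psi> u / 2 ^ n) ^ (2 ^ n)" by (rule exp_of_nat_mult)
  finally have "r ^ (2 ^ n) = exp (\<psi> u / 2 ^ n) ^ (2 ^ n)" .
  then have "r = exp (\<psi> u / 2 ^ n)"
    by (rule power_eq_imp_eq_base) (use r in simp_all)
  then show ?thesis using r by simp
qed

lemma exp_moment_nat: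
  assumes u: "0 \<le> u"
  shows "(\<integral>\<^sup>+w. ennreal (exp (u * X (real m) w)) \<partial>N) = ennreal (exp (\<psi> u * m))"
proof -
  have "(\<integral>\<^sup>+w. ennreal (exp (u * X (real m) w)) \<partial>N) = ennreal (exp (\<psi> u)) ^ m"
    using exp_moment_grid[of u m 0] mgf_nn[OF u] mgf_exp[OF u] by simp
  also have "\<dots> = ennreal (exp (\<psi> u) ^ m)" by (simp add: ennreal_power)
  also have "exp (\<psi> u) ^ m = exp (\<psi> u * m)" by (rule exp_of_nat2_mult[symmetric])
  finally show ?thesis .
qed

end

text \<open>The \<open>Suc\<close> puts the grid point strictly above \<open>t\<close>, also when
  \<open>t\<close> is itself dyadic: the filter \<open>at_right t\<close>, in which cadlag paths
  converge, excludes \<open>t\<close>.\<close>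

definition dyadic_above :: "nat \<Rightarrow> real \<Rightarrow> nat" where
  "dyadic_above n t = Suc (nat \<lfloor>t * 2 ^ n\<rfloor>)"

lemma dyadic_above:
  assumes "0 \<le> t"
  shows "t < real (dyadic_above n t) / 2 ^ n" "real (dyadic_above n t) / 2 ^ n \<le> t + (1 / 2) ^ n"
proof -
  have *: "real (dyadic_above n t) = real_of_int \<lfloor>t * 2 ^ n\<rfloor> + 1"
    using assms by (simp add: dyadic_above_def)
  have "t * 2 ^ n < real_of_int \<lfloor>t * 2 ^ n\<rfloor> + 1" "real_of_int \<lfloor>t * 2 ^ n\<rfloor> \<le> t * 2 ^ n"
    by linarith+
  then show "t < real (dyadic_above n t) / 2 ^ n" "real (dyadic_above n t) / 2 ^ n \<le> t + (1 / 2) ^ n"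
    unfolding * by (simp add: pos_less_divide_eq)
      (simp add: pos_divide_le_eq add_divide_distrib power_one_over)
qed

lemma dyadic_above_mono: "s \<le> t \<Longrightarrow> dyadic_above n s \<le> dyadic_above n t"
  unfolding dyadic_above_def by (simp add: nat_mono floor_mono)

lemma filterlim_dyadic_above:
  assumes "0 \<le> t"
  shows "filterlim (\<lambda>n. real (dyadic_above n t) / 2 ^ n) (at_right t) sequentially"
proof (rule tendsto_imp_filterlim_at_right)
  have "(\<lambda>n. t + (1/2::real) ^ n) \<longlonglongrightarrow> t + 0" by (intro tendsto_add tendsto_const LIMSEQ_power_zero) simp
  then have "(\<lambda>n. t + (1/2::real) ^ n) \<longlonglongrightarrow> t" by simp
  then show "(\<lambda>n. real (dyadic_above n t) / 2 ^ n) \<longlonglongrightarrow> t"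
    by (rule tendsto_sandwich[where f="\<lambda>_. t", rotated 3])
      (intro always_eventually allI less_imp_le dyadic_above assms tendsto_const)+
  show "\<forall>\<^sub>F n in sequentially. t < real (dyadic_above n t) / 2 ^ n"
    by (intro always_eventually allI dyadic_above assms)
qed

text \<open>A majorant independent of \<open>h\<close> for differentiating under the integral. With
  \<open>\<bar>h\<bar> \<le> 1 / 2\<close> half of the exponent remains free to absorb the factor
  \<open>\<bar>x\<bar>\<close>.\<close>

lemma exp_diff_quotient_bound:
  fixes x h :: real
  assumes "\<bar>h\<bar> \<le> 1 / 2" "h \<noteq> 0"
  shows "\<bar>(exp (h * x) - 1) / h\<bar> \<le> 2 * exp \<bar>x\<bar>"
proof -
  have *: "\<bar>exp y - 1\<bar> \<le> \<bar>y\<bar> * exp \<bar>y\<bar>" for y :: real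
  proof (cases "0 \<le> y")
    case True
    have "1 + - y \<le> exp (- y)" by (rule exp_ge_add_one_self)
    then have "exp y * (1 - y) \<le> exp y * exp (- y)" by (intro mult_left_mono) auto
    then have "exp y - 1 \<le> y * exp y" by (simp add: exp_minus algebra_simps)
    then show ?thesis using True by simp
  next
    case False
    have "1 + y \<le> exp y" by (rule exp_ge_add_one_self)
    moreover have "- y * 1 \<le> - y * exp (- y)" using False by (intro mult_left_mono) auto
    ultimately have "1 - exp y \<le> - y * exp (- y)" by linarith
    then show ?thesis using False by simp
  qed
  have "\<bar>(exp (h * x) - 1) / h\<bar> \<le> (\<bar>h * x\<bar> * exp \<bar>h * x\<bar>) / \<bar>h\<bar>"
    unfolding abs_divide by (intro divide_right_mono *) simp
  also have "\<dots> = \<bar>x\<bar> * exp (\<bar>h\<bar> * \<bar>x\<bar>)" using assms by (simp add: abs_mult)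
  also have "\<dots> \<le> (2 * exp (\<bar>x\<bar> / 2)) * exp (\<bar>x\<bar> / 2)"
  proof (intro mult_mono)
    show "\<bar>x\<bar> \<le> 2 * exp (\<bar>x\<bar> / 2)" using exp_ge_add_one_self[of "\<bar>x\<bar> / 2"] by linarith
    show "exp (\<bar>h\<bar> * \<bar>x\<bar>) \<le> exp (\<bar>x\<bar> / 2)" using mult_right_mono[OF assms(1), of "\<bar>x\<bar>"] by simp
  qed auto
  also have "\<dots> = 2 * exp \<bar>x\<bar>" by (simp add: exp_add[symmetric])
  finally show ?thesis .
qed

section \<open>Derivative at 1, convexity and inverse of the Laplace exponent\<close>

context spectrally_negative_levy
begin

text \<open>Differentiation under the integral, with the moment of order 2 as majorant:
  \<open>exp x * exp \<bar>x\<bar>\<close> is at most \<open>1 + exp (2 * x)\<close>. The bound on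
  \<open>D\<close> comes from \<open>exp x - 1 \<le> x * exp x\<close> and later yields the sign of
  \<open>deriv \<psi> 1\<close>.\<close>

lemma mgf_has_derivative_1:
  obtains D where "(mgf has_real_derivative D) (at 1)" "mgf 1 - 1 \<le> D"
proof -
  define D where "D = (\<integral>w. X 1 w * exp (X 1 w) \<partial>N)"
  have bound: "exp x * (2 * exp \<bar>x\<bar>) \<le> 2 * (1 + exp (2 * x))" for x :: real
  proof -
    have "exp x * exp \<bar>x\<bar> = exp (x + \<bar>x\<bar>)" by (simp only: exp_add)
    also have "\<dots> \<le> 1 + exp (2 * x)" by (cases "0 \<le> x") auto
    finally show ?thesis by simp
  qed
  have int2: "integrable N (\<lambda>w. 2 * (1 + exp (2 * X 1 w)))"
    using exp_integrable[of 2] by (intro integrable_mult_right integrable_add) auto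
  have lin: "\<bar>x\<bar> \<le> 2 * exp \<bar>x\<bar>" for x :: real using exp_ge_add_one_self[of "\<bar>x\<bar>"] by linarith
  have intD: "integrable N (\<lambda>w. X 1 w * exp (X 1 w))"
  proof (rule Bochner_Integration.integrable_bound[OF int2])
    have "\<bar>x * exp x\<bar> \<le> \<bar>2 * (1 + exp (2 * x))\<bar>" for x :: real
    proof -
      have "\<bar>x * exp x\<bar> = exp x * \<bar>x\<bar>" by (simp add: abs_mult)
      also have "\<dots> \<le> exp x * (2 * exp \<bar>x\<bar>)" by (intro mult_left_mono lin) simp
      also note bound
      finally show ?thesis by (simp add: add_pos_pos less_imp_le)
    qed
    then show "AE w in N. norm (X 1 w * exp (X 1 w)) \<le> norm (2 * (1 + exp (2 * X 1 w)))" by simp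
  qed measurable
  \<comment> \<open>On this neighbourhood of 0 the orders \<open>1 + h\<close> stay nonnegative, so
    the moments are finite, and the uniform bound on difference quotients applies.\<close>
  have "((\<lambda>h. (mgf (1 + h) - mgf 1) / h) \<longlongrightarrow> D) (at 0 within {-(1/2)<..<1/2})"
    unfolding tendsto_at_iff_sequentially
  proof (intro allI impI)
    fix h :: "nat \<Rightarrow> real" assume h: "\<forall>i. h i \<in> {-(1/2)<..<1/2} - {0}" "h \<longlonglongrightarrow> 0"
    have h': "\<bar>h i\<bar> \<le> 1 / 2" "h i \<noteq> 0" "0 \<le> 1 + h i" for i using h(1)[rule_format, of i] by auto
    have "(\<lambda>i. \<integral>w. exp (X 1 w) * ((exp (h i * X 1 w) - 1) / h i) \<partial>N) \<longlonglongrightarrow> D"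
      unfolding D_def
    proof (rule integral_dominated_convergence[OF _ _ int2])
      have "(\<lambda>i. exp x * ((exp (h i * x) - 1) / h i)) \<longlonglongrightarrow> x * exp x" for x
      proof -
        have "((\<lambda>y. exp (y * x)) has_real_derivative x) (at 0)"
          by (auto intro!: derivative_eq_intros)
        then have "(\<lambda>y. (exp (y * x) - 1) / y) \<midarrow>0\<rightarrow> x" by (simp add: DERIV_def)
        then have "((\<lambda>y. (exp (y * x) - 1) / y) \<circ> h) \<longlonglongrightarrow> x"
          using h unfolding tendsto_at_iff_sequentially by auto
        then have "(\<lambda>i. exp x * ((exp (h i * x) - 1) / h i)) \<longlonglongrightarrow> exp x * x"
          by (intro tendsto_mult tendsto_const) (simp add: comp_def)
        then show ?thesis by (simp add: mult.commute)
      qed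
      then show "AE w in N. (\<lambda>i. exp (X 1 w) * ((exp (h i * X 1 w) - 1) / h i)) \<longlonglongrightarrow> X 1 w * exp (X 1 w)" by simp
      show "AE w in N. norm (exp (X 1 w) * ((exp (h i * X 1 w) - 1) / h i)) \<le> 2 * (1 + exp (2 * X 1 w))" for i
      proof (rule AE_I2)
        fix w
        have "norm (exp (X 1 w) * ((exp (h i * X 1 w) - 1) / h i)) = exp (X 1 w) * \<bar>(exp (h i * X 1 w) - 1) / h i\<bar>"
          by (simp add: abs_mult)
        also have "\<dots> \<le> exp (X 1 w) * (2 * exp \<bar>X 1 w\<bar>)"
          by (intro mult_left_mono exp_diff_quotient_bound h') simp
        also note bound
        finally show "norm (exp (X 1 w) * ((exp (h i * X 1 w) - 1) / h i)) \<le> 2 * (1 + exp (2 * X 1 w))" .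
      qed
    qed measurable
    moreover have "(\<integral>w. exp (X 1 w) * ((exp (h i * X 1 w) - 1) / h i) \<partial>N) = (mgf (1 + h i) - mgf 1) / h i" for i
    proof -
      have "exp (X 1 w) * ((exp (h i * X 1 w) - 1) / h i) = (exp ((1 + h i) * X 1 w) - exp (1 * X 1 w)) / h i" for w
        using h'(2)[of i] by (simp add: field_simps exp_add[symmetric])
      then have "(\<integral>w. exp (X 1 w) * ((exp (h i * X 1 w) - 1) / h i) \<partial>N)
          = (\<integral>w. (exp ((1 + h i) * X 1 w) - exp (1 * X 1 w)) / h i \<partial>N)" by (simp only:)
      also have "\<dots> = (mgf (1 + h i) - mgf 1) / h i"
        unfolding mgf_def integral_divide_zero
        by (subst Bochner_Integration.integral_diff) (use h'(3)[of i] exp_integrable[of "1 + h i"] exp_integrable[of 1] in auto)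
      finally show ?thesis .
    qed
    ultimately show "((\<lambda>h. (mgf (1 + h) - mgf 1) / h) \<circ> h) \<longlonglongrightarrow> D" by (simp only: comp_def)
  qed
  then have "(mgf has_real_derivative D) (at 1)"
    by (simp add: DERIV_def at_within_open[of 0 "{-(1/2)<..<1/2}"])
  moreover have "mgf 1 - 1 \<le> D"
  proof -
    have "mgf 1 - 1 = (\<integral>w. exp (1 * X 1 w) - 1 \<partial>N)"
      unfolding mgf_def using exp_integrable[of 1] by (subst Bochner_Integration.integral_diff) (auto simp: prob_space)
    also have "\<dots> \<le> D"
      unfolding D_def
    proof (rule integral_mono)
      fix w
      have "1 + - X 1 w \<le> exp (- X 1 w)" by (rule exp_ge_add_one_self)
      then have "exp (X 1 w) * (1 - X 1 w) \<le> exp (X 1 w) * exp (- X 1 w)" by (intro mult_left_mono) auto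
      then show "exp (1 * X 1 w) - 1 \<le> X 1 w * exp (X 1 w)" by (simp add: exp_minus algebra_simps)
    qed (use exp_integrable[of 1] intD in auto)
    finally show ?thesis .
  qed
  ultimately show thesis by (rule that)
qed

lemma psi_has_derivative_1:
  assumes "0 \<le> \<psi> 1"
  shows "(\<psi> has_real_derivative deriv \<psi> 1) (at 1)" "0 \<le> deriv \<psi> 1"
proof -
  obtain D where D: "(mgf has_real_derivative D) (at 1)" "mgf 1 - 1 \<le> D" by (rule mgf_has_derivative_1)
  have "\<psi> = (\<lambda>u. ln (mgf u))" by (auto simp: laplace_exponent_def mgf_def)
  then have d: "(\<psi> has_real_derivative (D / mgf 1)) (at 1)"
    using D(1) mgf_pos[of 1] by (auto intro!: derivative_eq_intros simp: field_simps)
  then have e: "deriv \<psi> 1 = D / mgf 1" by (rule DERIV_imp_deriv)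
  then show "(\<psi> has_real_derivative deriv \<psi> 1) (at 1)" using d by simp
  have "1 \<le> mgf 1" using mgf_exp[of 1] assms by simp
  then show "0 \<le> deriv \<psi> 1" unfolding e using D(2) by (intro divide_nonneg_nonneg) auto
qed

lemma mgf_0 [simp]: "mgf 0 = 1"
  by (simp add: mgf_def prob_space)

lemma mgf_convex:
  assumes "0 \<le> r" "r < a" "a < b"
  shows "(b - r) * mgf a \<le> (b - a) * mgf r + (a - r) * mgf b"
proof -
  have int: "integrable N (\<lambda>w. exp (r * X 1 w))" "integrable N (\<lambda>w. exp (a * X 1 w))" "integrable N (\<lambda>w. exp (b * X 1 w))"
    using assms by (auto intro: exp_integrable)
  have "(b - r) * mgf a = (\<integral>w. (b - r) * exp (a * X 1 w) \<partial>N)" by (simp add: mgf_def)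
  also have "\<dots> \<le> (\<integral>w. (b - a) * exp (r * X 1 w) + (a - r) * exp (b * X 1 w) \<partial>N)"
  proof (rule integral_mono)
    fix w
    let ?x = "X 1 w"
    define t where "t = (a - r) / (b - r)"
    have t: "0 \<le> t" "t \<le> 1" using assms by (auto simp: t_def)
    have bt: "(b - r) * t = a - r" using assms by (simp add: t_def)
    have "convex_on UNIV (exp :: real \<Rightarrow> real)" by (rule exp_convex)
    from convex_onD[OF this t, of "r * ?x" "b * ?x"]
    have "exp ((1 - t) * (r * ?x) + t * (b * ?x)) \<le> (1 - t) * exp (r * ?x) + t * exp (b * ?x)" by simp
    also have "(1 - t) * (r * ?x) + t * (b * ?x) = (r + t * (b - r)) * ?x" by (simp add: algebra_simps)
    also have "r + t * (b - r) = a" using bt by (simp add: mult.commute)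
    finally have "(b - r) * exp (a * ?x) \<le> (b - r) * ((1 - t) * exp (r * ?x) + t * exp (b * ?x))"
      using assms by (intro mult_left_mono) auto
    also have "\<dots> = ((b - r) * (1 - t)) * exp (r * ?x) + ((b - r) * t) * exp (b * ?x)" by (simp add: algebra_simps)
    also have "(b - r) * (1 - t) = b - a" unfolding right_diff_distrib bt by simp
    also note bt
    finally show "(b - r) * exp (a * ?x) \<le> (b - a) * exp (r * ?x) + (a - r) * exp (b * ?x)" .
  qed (use int in auto)
  also have "\<dots> = (b - a) * mgf r + (a - r) * mgf b"
    unfolding mgf_def using int by (subst Bochner_Integration.integral_add) auto
  finally show ?thesis .
qed

lemma mgf_continuous: "continuous_on {0..} mgf"
  unfolding continuous_on_sequentially
proof (intro allI impI ballI, elim conjE)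
  fix s :: "nat \<Rightarrow> real" and u assume u: "u \<in> {0..}" and s: "\<forall>n. s n \<in> {0..}" "s \<longlonglongrightarrow> u"
  obtain B where B: "\<And>n. s n \<le> B"
    using s(2) by (metis convergent_imp_Bseq convergentI Bseq_def abs_le_D1 real_norm_def)
  then have B0: "0 \<le> B" using s(1) by (meson atLeast_iff order_trans)
  show "(mgf \<circ> s) \<longlonglongrightarrow> mgf u"
    unfolding comp_def mgf_def
  proof (rule integral_dominated_convergence[where w="\<lambda>w. 1 + exp (B * X 1 w)"])
    show "AE w in N. (\<lambda>i. exp (s i * X 1 w)) \<longlonglongrightarrow> exp (u * X 1 w)"
      by (intro AE_I2 tendsto_intros s)
    show "AE w in N. norm (exp (s i * X 1 w)) \<le> 1 + exp (B * X 1 w)" for i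
    proof (rule AE_I2)
      fix w
      have "0 \<le> s i" "s i \<le> B" using s(1) B by auto
      then have "s i * X 1 w \<le> 0 \<or> s i * X 1 w \<le> B * X 1 w"
        by (cases "0 \<le> X 1 w") (auto simp: mult_right_mono mult_nonneg_nonpos)
      then have "exp (s i * X 1 w) \<le> 1 \<or> exp (s i * X 1 w) \<le> exp (B * X 1 w)" by auto
      then show "norm (exp (s i * X 1 w)) \<le> 1 + exp (B * X 1 w)"
        by (auto intro: add_increasing add_increasing2)
    qed
    show "integrable N (\<lambda>w. 1 + exp (B * X 1 w))" using exp_integrable[OF B0] by auto
  qed measurable
qed

text \<open>A bound on \<open>mgf\<close> bounds \<open>u \<mapsto> E e\<^bsup>uX(h)\<^esup>\<close> for every \<open>h = 2\<^sup>-\<^sup>n\<close>, which forces \<open>X(h) \<le> 0\<close>.\<close>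

lemma mgf_bounded_imp_nonincreasing:
  assumes C: "\<And>u. 0 \<le> u \<Longrightarrow> mgf u \<le> C"
  shows "nonincreasing_paths N X"
proof -
  have C1: "1 \<le> C" using C[of 0] by simp
  have X_le: "prob {w\<in>space N. X (1 / 2 ^ n) w > \<epsilon>} = 0" if \<epsilon>: "0 < \<epsilon>" for n \<epsilon>
  proof -
    let ?p = "prob {w\<in>space N. X (1 / 2 ^ n) w > \<epsilon>}"
    \<comment> \<open>Markov's inequality for \<open>exp (real i * X (1 / 2 ^ n) w)\<close>; the
      order \<open>i\<close> is sent to infinity afterwards.\<close>
    have "?p \<le> C * exp (- (real i * \<epsilon>))" for i :: nat
    proof -
      have "ennreal (exp (real i * \<epsilon>) * ?p) = (\<integral>\<^sup>+w. ennreal (exp (real i * \<epsilon>)) * indicator {w\<in>space N. X (1 / 2 ^ n) w > \<epsilon>} w \<partial>N)"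
        by (subst nn_integral_cmult_indicator) (auto simp: emeasure_eq_measure ennreal_mult')
      also have "\<dots> \<le> (\<integral>\<^sup>+w. ennreal (exp (real i * X (1 / 2 ^ n) w)) \<partial>N)"
        by (intro nn_integral_mono) (auto simp: indicator_def intro!: ennreal_leI mult_left_mono)
      also have "\<dots> = ennreal (exp (\<psi> (real i) / 2 ^ n))" by (rule exp_moment_step) simp
      \<comment> \<open>A root of \<open>mgf (real i)\<close> is at most \<open>mgf (real i)\<close>
        if that is at least 1, and at most 1 otherwise; both are bounded by
        \<open>C\<close>.\<close>
      also have "exp (\<psi> (real i) / 2 ^ n) \<le> C"
      proof (cases "0 \<le> \<psi> (real i)")
        case True
        have "\<psi> (real i) / 2 ^ n \<le> \<psi> (real i) / 1" using True by (intro divide_left_mono) auto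
        then have "exp (\<psi> (real i) / 2 ^ n) \<le> exp (\<psi> (real i))" by simp
        then show ?thesis using C[of "real i"] mgf_exp[of "real i"] by linarith
      next
        case False
        then have "exp (\<psi> (real i) / 2 ^ n) \<le> 1" by (simp add: divide_nonpos_pos)
        then show ?thesis using C1 by linarith
      qed
      finally have "exp (real i * \<epsilon>) * ?p \<le> C" using C1 by (simp add: ennreal_le_iff ennreal_leI)
      then show ?thesis by (simp add: exp_minus field_simps)
    qed
    moreover have "(\<lambda>i::nat. C * exp (- (real i * \<epsilon>))) \<longlonglongrightarrow> C * 0"
    proof (intro tendsto_mult tendsto_const)
      have "(\<lambda>i::nat. exp (- \<epsilon>) ^ i) \<longlonglongrightarrow> 0" using \<epsilon> by (intro LIMSEQ_power_zero) simp
      then show "(\<lambda>i::nat. exp (- (real i * \<epsilon>))) \<longlonglongrightarrow> 0" by (simp add: exp_of_nat_mult[symmetric])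
    qed
    ultimately have "?p \<le> 0" by (intro LIMSEQ_le_const[of "\<lambda>i::nat. C * exp (- (real i * \<epsilon>))"]) auto
    then show ?thesis by (simp add: measure_le_0_iff)
  qed
  have "AE w in N. inc n k w \<le> 0" for n k
  proof -
    have "AE w in N. inc n k w \<le> \<epsilon>" if "0 < \<epsilon>" for \<epsilon>
    proof -
      have "AE w in N. X (1 / 2 ^ n) w \<le> \<epsilon>"
        using X_le[OF that, of n] by (subst AE_iff_measurable[OF _ refl]) (auto simp: emeasure_eq_measure not_le)
      then have "AE x in distr N borel (X (1 / 2 ^ n)). x \<le> \<epsilon>" by (subst AE_distr_iff) auto
      then show ?thesis unfolding inc_distr[of n k, symmetric] by (subst (asm) AE_distr_iff) auto
    qed
    then have "AE w in N. \<forall>j::nat. inc n k w \<le> 1 / real (Suc j)"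
      unfolding AE_all_countable by simp
    then show ?thesis
    proof eventually_elim
      fix w assume *: "\<forall>j::nat. inc n k w \<le> 1 / real (Suc j)"
      show "inc n k w \<le> 0"
        by (rule LIMSEQ_le_const[OF LIMSEQ_inverse_real_of_nat]) (use * in \<open>auto simp: inverse_eq_divide\<close>)
    qed
  qed
  then have "AE w in N. \<forall>n k. inc n k w \<le> 0" by (simp add: AE_all_countable)
  then show ?thesis
    unfolding nonincreasing_paths_def using X_cadlag
  proof eventually_elim
    fix w assume i: "\<forall>n k. inc n k w \<le> 0" and c: "cadlag (\<lambda>t. X t w)"
    have dec: "X (real l / 2 ^ n) w \<le> X (real k / 2 ^ n) w" if "k \<le> l" for k l n
      using that i by (induction rule: dec_induct) (auto simp: inc_def intro: order_trans)
    show "\<forall>s t. 0 \<le> s \<longrightarrow> s \<le> t \<longrightarrow> X t w \<le> X s w"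
    proof (intro allI impI)
      fix s t :: real assume st: "0 \<le> s" "s \<le> t"
      have "(\<lambda>n. X (real (dyadic_above n r) / 2 ^ n) w) \<longlonglongrightarrow> X r w" if "0 \<le> r" for r
        using c that filterlim_compose[OF _ filterlim_dyadic_above[OF that], of "\<lambda>t. X t w"] by (auto simp: cadlag_def)
      then have "(\<lambda>n. X (real (dyadic_above n s) / 2 ^ n) w) \<longlonglongrightarrow> X s w" "(\<lambda>n. X (real (dyadic_above n t) / 2 ^ n) w) \<longlonglongrightarrow> X t w"
        using st by auto
      then show "X t w \<le> X s w"
        using dec dyadic_above_mono[OF st(2)] by (intro LIMSEQ_le[rotated, rotated]) auto
    qed
  qed
qed

text \<open>\<open>GREATEST\<close> and \<open>the_inv_into\<close> can be evaluated only once a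
  largest root exists and \<open>\<psi>\<close> is injective beyond it. Both are shown for
  \<open>mgf\<close>, where roots of \<open>\<psi>\<close> become points with value 1: by convexity
  and \<open>mgf 0 = 1\<close>, \<open>mgf\<close> cannot come back to 1 after exceeding it, and it
  is unbounded because the paths are not nonincreasing.\<close>

lemma psi_inverse_props:
  assumes ni: "\<not> nonincreasing_paths N X" and \<theta>: "0 \<le> \<theta>" "\<psi> 1 < \<theta>"
  shows "\<psi> (psi_inverse \<psi> \<theta>) = \<theta>" "1 < psi_inverse \<psi> \<theta>"
proof -
  have unb: "\<exists>u\<ge>0. C < mgf u" for C
    using mgf_bounded_imp_nonincreasing[of C] ni by (auto simp: not_le[symmetric])
  have psi0: "\<psi> u = 0 \<longleftrightarrow> mgf u = 1" if "0 \<le> u" for u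
    using mgf_exp[OF that] by simp
  obtain u1 where u1: "0 \<le> u1" "1 < mgf u1" using unb by auto
  \<comment> \<open>If \<open>mgf b \<le> 1\<close>, the chord from 0 to \<open>b\<close> would keep
    \<open>mgf u1\<close> at or below 1.\<close>
  have big: "1 < mgf b" if "u1 \<le> b" for b
  proof (cases "u1 = b")
    case False
    have u10: "u1 \<noteq> 0" using u1 by auto
    show ?thesis
    proof (rule ccontr)
      assume "\<not> 1 < mgf b"
      then have "mgf b \<le> 1" by simp
      have "b * mgf u1 \<le> (b - u1) + u1 * mgf b"
        using mgf_convex[of 0 u1 b] that False u1 u10 by simp
      also have "\<dots> \<le> (b - u1) + u1 * 1" using u1 \<open>mgf b \<le> 1\<close> by (intro add_left_mono mult_left_mono) auto
      finally have "b * mgf u1 \<le> b * 1" by simp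
      then show False using u1 u10 that by (simp add: mult_le_cancel_left)
    qed
  qed (use u1 in simp)
  let ?Z = "{u\<in>{0..u1}. mgf u = 1}"
  have "compact ?Z"
  proof -
    have "closed ?Z"
      by (intro continuous_closed_preimage_constant continuous_on_subset[OF mgf_continuous]) auto
    then show ?thesis using bounded_subset[of "{0..u1}" ?Z] by (simp add: compact_eq_bounded_closed subset_iff)
  qed
  moreover have "0 \<in> ?Z" using u1 by simp
  then have "?Z \<noteq> {}" by blast
  ultimately obtain r where r: "r \<in> ?Z" "\<And>u. u \<in> ?Z \<Longrightarrow> u \<le> r" using compact_attains_sup[of ?Z] by blast
  have r': "u \<le> r" if "0 \<le> u" "mgf u = 1" for u
  proof (cases "u1 \<le> u")
    case True
    then show ?thesis using big[of u] that by simp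
  next
    case False
    then show ?thesis using that by (intro r(2)) simp
  qed
  have lr: "largest_root \<psi> = r"
    unfolding largest_root_def by (rule Greatest_equality) (use r r' psi0 in auto)
  have above: "1 < mgf u" if "r < u" for u
  proof (rule ccontr)
    assume "\<not> 1 < mgf u"
    moreover have u0: "0 \<le> u" using that r by auto
    ultimately have l: "mgf u \<le> 1" by simp
    have "\<exists>x. u \<le> x \<and> x \<le> max u u1 \<and> mgf x = 1"
      by (rule IVT') (use l big[of "max u u1"] u0 in \<open>auto intro!: continuous_on_subset[OF mgf_continuous]\<close>)
    then obtain x where "u \<le> x" "mgf x = 1" by blast
    then show False using r'[of x] u0 that by linarith
  qed
  have strict: "mgf a < mgf b" if "r \<le> a" "a < b" for a b
  proof (cases "a = r")
    case True
    then show ?thesis using above[of b] that r by auto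
  next
    case False
    then have ra: "r < a" using that by simp
    have rp: "0 \<le> r" "mgf r = 1" using r by auto
    have "(b - r) * mgf a \<le> (b - a) * mgf r + (a - r) * mgf b" using rp ra that by (intro mgf_convex)
    also have "\<dots> < (b - a) * mgf b + (a - r) * mgf b"
      using above[of b] rp ra that by simp
    also have "\<dots> = (b - r) * mgf b" by (simp add: algebra_simps)
    finally show ?thesis using ra that by simp
  qed
  have r0: "0 \<le> r" using r by auto
  have psi_strict: "\<psi> a < \<psi> b" if "r \<le> a" "a < b" for a b
    using strict[OF that] mgf_exp[of a] mgf_exp[of b] that r0 by simp
  have inj: "inj_on \<psi> {r..}"
    by (rule linorder_inj_onI) (use psi_strict in \<open>fastforce+\<close>)
  obtain u2 where u2: "0 \<le> u2" "exp \<theta> < mgf u2" using unb by auto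
  \<comment> \<open>Between 0 and \<open>r\<close> convexity keeps \<open>mgf\<close> at or below
    its end values 1, whereas \<open>mgf u2 > exp \<theta> \<ge> 1\<close>.\<close>
  have ru2: "r \<le> u2"
  proof (rule ccontr)
    assume h: "\<not> r \<le> u2"
    have "1 < mgf u2" using u2 \<theta> by (smt (verit) exp_ge_add_one_self)
    have "u2 \<noteq> 0" using \<open>1 < mgf u2\<close> by auto
    have "r * mgf u2 \<le> (r - u2) * 1 + u2 * mgf r"
      using mgf_convex[of 0 u2 r] h u2 \<open>u2 \<noteq> 0\<close> by simp
    also have "\<dots> = r * 1" using r by simp
    finally show False using \<open>1 < mgf u2\<close> h u2 by (simp add: mult_le_cancel_left)
  qed
  have "\<exists>x. r \<le> x \<and> x \<le> u2 \<and> mgf x = exp \<theta>"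
    by (rule IVT') (use r u2 ru2 \<theta> in \<open>auto intro!: continuous_on_subset[OF mgf_continuous]\<close>)
  then obtain x where x: "r \<le> x" "mgf x = exp \<theta>" by auto
  then have "\<psi> x = \<theta>" using mgf_exp[of x] r0 by simp
  then have mem: "\<theta> \<in> \<psi> ` {r..}" using x by auto
  define q where "q = psi_inverse \<psi> \<theta>"
  have q: "\<psi> q = \<theta>" unfolding q_def psi_inverse_def lr by (rule f_the_inv_into_f[OF inj mem])
  then show "\<psi> (psi_inverse \<psi> \<theta>) = \<theta>" by (simp add: q_def)
  have qr: "r \<le> q"
    using the_inv_into_into[OF inj mem subset_refl] unfolding q_def psi_inverse_def lr by simp
  \<comment> \<open>\<open>q\<close> lies on the increasing branch, so \<open>q \<le> 1\<close>
    would force \<open>\<psi> q \<le> \<psi> 1 < \<theta>\<close>.\<close>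
  show "1 < psi_inverse \<psi> \<theta>"
    unfolding q_def[symmetric]
  proof (rule ccontr)
    assume "\<not> 1 < q"
    then have "q = 1 \<or> q < 1" by auto
    then show False using psi_strict[OF qr, of 1] q \<theta>(2) by auto
  qed
qed

end

section \<open>The exponential of the maximum of the killed process\<close>

context spectrally_negative_levy
begin

abbreviation walk :: "nat \<Rightarrow> 'a \<Rightarrow> nat \<Rightarrow> real" where
  "walk n w \<equiv> psum (\<lambda>i. inc n i w)"

definition grid_max :: "nat \<Rightarrow> 'a \<Rightarrow> nat \<Rightarrow> real" where
  "grid_max n w = run_max (walk n w)"

text \<open>The mean exponential of the maximum of the killed process over the grid points of
  \<open>[0, m]\<close>: a rise at step \<open>Suc k\<close> counts only if the path is still alive,
  which has probability \<open>exp (- (\<theta> * Suc k / 2 ^ n))\<close>. The proof of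
  \<open>killed_gain\<close> establishes this reading.\<close>

definition grid_gain :: "real \<Rightarrow> nat \<Rightarrow> nat \<Rightarrow> ennreal" where
  "grid_gain \<theta> n m = 1 + (\<Sum>k<m * 2 ^ n. \<integral>\<^sup>+w. ennreal ((1 / exp (\<theta> / 2 ^ n)) ^ Suc k *
     (exp (grid_max n w (Suc k)) - exp (grid_max n w k))) \<partial>N)"

lemma grid_max_measurable [measurable]: "(\<lambda>w. grid_max n w k) \<in> borel_measurable N"
  unfolding grid_max_def by (intro measurable_run_max) (simp add: psum_inc)

lemma record_sum_measurable: "(\<lambda>w. record_sum q (walk n w) K) \<in> borel_measurable N"
  unfolding record_sum_def grid_max_def[symmetric] by measurable

text \<open>At the integer time \<open>m\<close> the weight is the same for every mesh, so in the
  limit over \<open>n\<close> only the record sum varies.\<close>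

lemma esscher_inc:
  assumes "X 0 w = 0"
  shows "esscher q (exp (\<theta> / 2 ^ n)) (m * 2 ^ n) (\<lambda>i. inc n i w) = exp (q * X (real m) w - \<theta> * m)"
proof -
  have "(1 / exp (\<theta> / 2 ^ n)) ^ (m * 2 ^ n) = exp (- (\<theta> / 2 ^ n)) ^ (m * 2 ^ n)"
    by (simp add: exp_minus inverse_eq_divide)
  also have "\<dots> = exp (real (m * 2 ^ n) * (- (\<theta> / 2 ^ n)))" by (rule exp_of_nat_mult[symmetric])
  also have "real (m * 2 ^ n) * (- (\<theta> / 2 ^ n)) = - (\<theta> * m)" by simp
  finally show ?thesis
    using assms unfolding esscher_def psum_inc by (simp add: exp_diff exp_minus field_simps)
qed

lemma exp_moment_inc_step:
  "0 \<le> u \<Longrightarrow> (\<integral>\<^sup>+w. ennreal (exp (u * inc n i w)) \<partial>N) = ennreal (exp (\<psi> u / 2 ^ n))"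
  by (simp add: exp_moment_inc exp_moment_step)

lemma tilted_mean:
  fixes m :: nat and \<theta> :: real
  shows "0 \<le> u \<Longrightarrow> (\<integral>\<^sup>+w. ennreal (exp (u * X (real m) w - \<theta> * m)) \<partial>N) = ennreal (exp ((\<psi> u - \<theta>) * m))"
proof -
  assume u: "0 \<le> u"
  have "(\<integral>\<^sup>+w. ennreal (exp (u * X (real m) w - \<theta> * m)) \<partial>N) = (\<integral>\<^sup>+w. ennreal (exp (u * X (real m) w)) * ennreal (exp (- (\<theta> * m))) \<partial>N)"
    by (intro nn_integral_cong) (simp add: ennreal_mult'[symmetric] exp_add[symmetric])
  also have "\<dots> = ennreal (exp (\<psi> u * m)) * ennreal (exp (- (\<theta> * m)))"
    by (subst nn_integral_multc) (auto simp: exp_moment_nat[OF u])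
  also have "\<dots> = ennreal (exp ((\<psi> u - \<theta>) * m))"
    by (simp add: ennreal_mult'[symmetric] exp_add[symmetric] algebra_simps)
  finally show ?thesis .
qed

lemma grid_gain_eq:
  assumes q: "0 \<le> q" "\<psi> q = \<theta>"
  shows "grid_gain \<theta> n m = 1 + (\<integral>\<^sup>+w. ennreal (exp (q * X (real m) w - \<theta> * m)) * ennreal (record_sum q (walk n w) (m * 2 ^ n)) \<partial>N)"
proof -
  have "grid_gain \<theta> n m = 1 + (\<integral>\<^sup>+w. ennreal (esscher q (exp (\<theta> / 2 ^ n)) (m * 2 ^ n) (\<lambda>i. inc n i w)) * ennreal (record_sum q (walk n w) (m * 2 ^ n)) \<partial>N)"
    unfolding grid_gain_def grid_max_def
    by (subst walk_exp_max_identity[OF inc_indep]) (use q exp_moment_inc_step[of q] in auto)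
  also have "(\<integral>\<^sup>+w. ennreal (esscher q (exp (\<theta> / 2 ^ n)) (m * 2 ^ n) (\<lambda>i. inc n i w)) * ennreal (record_sum q (walk n w) (m * 2 ^ n)) \<partial>N)
     = (\<integral>\<^sup>+w. ennreal (exp (q * X (real m) w - \<theta> * m)) * ennreal (record_sum q (walk n w) (m * 2 ^ n)) \<partial>N)"
    by (rule nn_integral_cong_AE, use X_0 in eventually_elim) (simp add: esscher_inc)
  finally show ?thesis .
qed

lemma grid_gain_upper:
  assumes q: "1 < q" "\<psi> q = \<theta>"
  shows "grid_gain \<theta> n m \<le> ennreal (q / (q - 1))"
proof -
  have "record_sum q (walk n w) K \<le> 1 / (q - 1)" for w K
  proof -
    have "record_sum q (walk n w) K \<le> record_limit q (run_max (walk n w) K)"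
      using q by (intro record_sum_le) auto
    also have "\<dots> \<le> 1 / (q - 1)" using q by (simp add: record_limit_def divide_right_mono)
    finally show ?thesis .
  qed
  then have "grid_gain \<theta> n m \<le> 1 + (\<integral>\<^sup>+w. ennreal (exp (q * X (real m) w - \<theta> * m)) * ennreal (1 / (q - 1)) \<partial>N)"
    unfolding grid_gain_eq[OF order_trans[OF zero_le_one less_imp_le[OF q(1)]] q(2)]
    by (intro add_left_mono nn_integral_mono mult_left_mono ennreal_leI) auto
  also have "\<dots> = 1 + ennreal (1 / (q - 1))"
    using tilted_mean[where u=q and m=m and \<theta>=\<theta>] q by (subst nn_integral_multc) auto
  also have "\<dots> = ennreal (1 + 1 / (q - 1))"
    using q by (simp add: ennreal_plus[symmetric] del: ennreal_plus flip: ennreal_1)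
  also have "1 + 1 / (q - 1) = q / (q - 1)" using q by (simp add: field_simps)
  finally show ?thesis .
qed

text \<open>The condition on \<open>v\<close> says that the secant of \<open>\<psi>\<close> over
  \<open>[1, 1 + v]\<close> has slope at most \<open>c\<close>; small \<open>v\<close> satisfy it
  when \<open>c\<close> exceeds the derivative at 1. The drift per grid step is
  \<open>c / 2 ^ n\<close>, which adds up to \<open>c * m\<close> for every mesh.\<close>

lemma grid_gain_upper_critical:
  assumes \<theta>: "\<psi> 1 = \<theta>" and c: "0 \<le> c" and v: "0 < v" "\<psi> (1 + v) \<le> \<theta> + c * v"
  shows "grid_gain \<theta> n m \<le> ennreal (1 + c * m + 1 / v)"
proof -
  let ?\<phi> = "exp (\<psi> 1 / 2 ^ n)"
  have "grid_gain \<theta> n m = 1 + (\<integral>\<^sup>+w. ennreal (esscher 1 ?\<phi> (m * 2 ^ n) (\<lambda>i. inc n i w)) * ennreal (record_sum 1 (walk n w) (m * 2 ^ n)) \<partial>N)"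
    unfolding grid_gain_def grid_max_def
    by (subst walk_exp_max_identity[OF inc_indep]) (use \<theta> exp_moment_inc_step[of 1] in auto)
  also have "\<dots> \<le> 1 + (\<integral>\<^sup>+w. ennreal (esscher 1 ?\<phi> (m * 2 ^ n) (\<lambda>i. inc n i w)) * ennreal (run_max (walk n w) (m * 2 ^ n)) \<partial>N)"
  proof (intro add_left_mono nn_integral_mono mult_left_mono ennreal_leI)
    fix w
    show "record_sum 1 (walk n w) (m * 2 ^ n) \<le> run_max (walk n w) (m * 2 ^ n)"
      using record_sum_le[of 1 "walk n w" "m * 2 ^ n"] by (simp add: record_limit_def)
  qed simp
  also have "\<dots> \<le> 1 + ennreal (c / 2 ^ n * real (m * 2 ^ n) + 1 / v)"
  proof (intro add_left_mono walk_tilted_max_bound[OF inc_indep, where \<phi>'="exp (\<psi> (1 + v) / 2 ^ n)"])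
    have "\<psi> (1 + v) / 2 ^ n \<le> (\<theta> + c * v) / 2 ^ n" using v by (intro divide_right_mono) auto
    then show "exp (\<psi> (1 + v) / 2 ^ n) \<le> ?\<phi> * exp (v * (c / 2 ^ n))"
      by (simp add: exp_add[symmetric] \<theta> add_divide_distrib mult.commute)
  qed (use c v exp_moment_inc_step[of 1] exp_moment_inc_step[of "1 + v"] in auto)
  also have "\<dots> = ennreal (1 + (c / 2 ^ n * real (m * 2 ^ n) + 1 / v))"
    using c v by (subst ennreal_plus) (auto simp del: ennreal_plus)
  also have "c / 2 ^ n * real (m * 2 ^ n) = c * m" by simp
  finally show ?thesis by (simp add: add.assoc)
qed

text \<open>Fatou's lemma as the mesh is refined. The running maximum is first bounded below by
  \<open>max 0 (X (real m) w)\<close>, which does not depend on the mesh, so no limit of grid maxima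
  has to be identified.\<close>

lemma grid_gain_lower:
  assumes q: "1 \<le> q" "\<psi> q = \<theta>" and g: "\<And>n. grid_gain \<theta> n m \<le> 1 + g"
  shows "(\<integral>\<^sup>+w. ennreal (exp (q * X (real m) w - \<theta> * m)) * ennreal (record_limit q (max 0 (X (real m) w))) \<partial>N) \<le> g"
proof -
  have q0: "0 \<le> q" using q by simp
  let ?E = "\<lambda>w. ennreal (exp (q * X (real m) w - \<theta> * m))"
  let ?R = "\<lambda>n w. record_sum q (walk n w) (m * 2 ^ n)"
  have "(\<integral>\<^sup>+w. ?E w * ennreal (record_limit q (max 0 (X (real m) w))) \<partial>N) \<le> (\<integral>\<^sup>+w. liminf (\<lambda>n. ?E w * ennreal (?R n w)) \<partial>N)"
  proof (rule nn_integral_mono_AE)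
    \<comment> \<open>The step bounds \<open>1 / Suc j\<close> keep the exceptional set null for all
      \<open>j\<close> at once; \<open>j\<close> tending to infinity removes the loss factor of
      \<open>record_sum_ge\<close>.\<close>
    have "AE w in N. \<forall>j. \<forall>m. \<forall>\<^sub>F n in sequentially. \<forall>k<m * 2 ^ n. inc n k w \<le> 1 / real (Suc j)"
      unfolding AE_all_countable[of "\<lambda>j w. \<forall>m. \<forall>\<^sub>F n in sequentially. \<forall>k<m * 2 ^ n. inc n k w \<le> 1 / real (Suc j)"]
      by (intro allI inc_small) simp
    then show "AE w in N. ?E w * ennreal (record_limit q (max 0 (X (real m) w))) \<le> liminf (\<lambda>n. ?E w * ennreal (?R n w))"
      using X_0
    proof eventually_elim
      fix w assume small: "\<forall>j. \<forall>m. \<forall>\<^sub>F n in sequentially. \<forall>k<m * 2 ^ n. inc n k w \<le> 1 / real (Suc j)" and X0: "X 0 w = 0"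
      let ?l = "record_limit q (max 0 (X (real m) w))"
      have l0: "0 \<le> ?l" using record_limit_mono[of 0 "max 0 (X (real m) w)" q] q by simp
      have "?E w * ennreal (exp (- (q * (1 / real (Suc j)))) * ?l) \<le> liminf (\<lambda>n. ?E w * ennreal (?R n w))" for j
      proof (rule Liminf_bounded)
        show "\<forall>\<^sub>F n in sequentially. ?E w * ennreal (exp (- (q * (1 / real (Suc j)))) * ?l) \<le> ?E w * ennreal (?R n w)"
          using small[rule_format, of m j]
        proof eventually_elim
          fix n assume s: "\<forall>k<m * 2 ^ n. inc n k w \<le> 1 / real (Suc j)"
          let ?S = "walk n w"
          have "max 0 (X (real m) w) \<le> run_max ?S (m * 2 ^ n)"
            using run_max_ge[of 0 "m * 2 ^ n" ?S] run_max_ge[of "m * 2 ^ n" "m * 2 ^ n" ?S] X0 by (simp add: psum_inc)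
          then have "exp (- (q * (1 / real (Suc j)))) * ?l \<le> exp (- (q * (1 / real (Suc j)))) * record_limit q (run_max ?S (m * 2 ^ n))"
            using q by (intro mult_left_mono record_limit_mono) auto
          also have "\<dots> \<le> ?R n w"
            using q s by (intro record_sum_ge) auto
          finally show "?E w * ennreal (exp (- (q * (1 / real (Suc j)))) * ?l) \<le> ?E w * ennreal (?R n w)"
            by (intro mult_left_mono ennreal_leI) auto
        qed
      qed
      moreover have "(\<lambda>j. ?E w * ennreal (exp (- (q * (1 / real (Suc j)))) * ?l)) \<longlonglongrightarrow> ?E w * ennreal (exp (- (q * 0)) * ?l)"
      proof -
        have "(\<lambda>j. 1 / real (Suc j)) \<longlonglongrightarrow> 0" using LIMSEQ_inverse_real_of_nat by (simp add: inverse_eq_divide)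
        then have "(\<lambda>j. ennreal (exp (q * X (real m) w - \<theta> * m) * (exp (- (q * (1 / real (Suc j)))) * ?l)))
           \<longlonglongrightarrow> ennreal (exp (q * X (real m) w - \<theta> * m) * (exp (- (q * 0)) * ?l))"
          by (intro tendsto_ennrealI tendsto_intros)
        then show ?thesis by (simp only: ennreal_mult' exp_ge_zero)
      qed
      ultimately show "?E w * ennreal ?l \<le> liminf (\<lambda>n. ?E w * ennreal (?R n w))"
        using LIMSEQ_le_const2[of "\<lambda>j. ?E w * ennreal (exp (- (q * (1 / real (Suc j)))) * ?l)" "?E w * ennreal ?l"] by auto
    qed
  qed
  also have "\<dots> \<le> liminf (\<lambda>n. \<integral>\<^sup>+w. ?E w * ennreal (?R n w) \<partial>N)"
    using record_sum_measurable by (intro nn_integral_liminf) measurable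
  also have "\<dots> \<le> liminf (\<lambda>n. g)"
  proof (intro Liminf_mono always_eventually allI)
    fix n
    show "(\<integral>\<^sup>+w. ?E w * ennreal (?R n w) \<partial>N) \<le> g"
      using g[of n] unfolding grid_gain_eq[OF q0 q(2)] by (simp add: ennreal_add_left_cancel_le)
  qed
  also have "\<dots> = g" by (simp add: Liminf_const)
  finally show ?thesis .
qed

text \<open>Multiply \<open>pt\<close> at \<open>x = X (real m) w\<close> by the weight for
  \<open>q\<close>. The exponential term turns into the weight for \<open>p\<close>, whose mean is
  \<open>exp ((\<psi> p - \<theta>) * m)\<close>, and the other term is controlled by
  \<open>grid_gain_lower\<close>. It is used with \<open>p = 1\<close> when \<open>q > 1\<close>,
  and with \<open>p\<close> slightly below 1 when \<open>q = 1\<close>.\<close>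

lemma grid_gain_lower_tilt:
  assumes q: "1 \<le> q" "\<psi> q = \<theta>" and p: "0 \<le> p" "p \<le> q"
    and g: "\<And>n. grid_gain \<theta> n m \<le> ennreal g" "1 \<le> g"
    and pt: "\<And>x. 1 \<le> (q - p) * record_limit q (max 0 x) + exp (- ((q - p) * x))"
  shows "1 - exp ((\<psi> p - \<theta>) * m) \<le> (q - p) * (g - 1)"
proof -
  let ?E = "\<lambda>u w. exp (u * X (real m) w - \<theta> * m)" and ?l = "\<lambda>w. record_limit q (max 0 (X (real m) w))"
  have "1 + ennreal (g - 1) = ennreal g" using g(2) by (simp flip: ennreal_plus ennreal_1)
  then have I: "(\<integral>\<^sup>+w. ennreal (?E q w) * ennreal (?l w) \<partial>N) \<le> ennreal (g - 1)"
    using q g(1) by (intro grid_gain_lower) auto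
  have l0: "0 \<le> record_limit q (max 0 x)" for x using record_limit_mono[of 0 "max 0 x" q] q by simp
  have [measurable]: "?l \<in> borel_measurable N"
    unfolding record_limit_def by simp
  have "1 = (\<integral>\<^sup>+w. ennreal (?E q w) \<partial>N)"
    using tilted_mean[where u=q and m=m and \<theta>=\<theta>] q by simp
  also have "\<dots> \<le> (\<integral>\<^sup>+w. ennreal (q - p) * (ennreal (?E q w) * ennreal (?l w)) + ennreal (?E p w) \<partial>N)"
  proof (intro nn_integral_mono)
    fix w
    let ?x = "X (real m) w"
    have "?E q w * 1 \<le> ?E q w * ((q - p) * ?l w + exp (- ((q - p) * ?x)))"
      by (intro mult_left_mono pt) simp
    also have "\<dots> = (q - p) * (?E q w * ?l w) + exp ((q * ?x - \<theta> * m) + - ((q - p) * ?x))"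
      unfolding exp_add by (simp add: algebra_simps)
    also have "(q * ?x - \<theta> * m) + - ((q - p) * ?x) = p * ?x - \<theta> * m" by (simp add: algebra_simps)
    finally have "ennreal (?E q w) \<le> ennreal ((q - p) * (?E q w * ?l w) + ?E p w)" by (simp add: ennreal_leI)
    also have "\<dots> = ennreal (q - p) * (ennreal (?E q w) * ennreal (?l w)) + ennreal (?E p w)"
      using p l0 by (simp only: ennreal_plus mult_nonneg_nonneg exp_ge_zero ennreal_mult' diff_ge_0_iff_ge)
    finally show "ennreal (?E q w) \<le> ennreal (q - p) * (ennreal (?E q w) * ennreal (?l w)) + ennreal (?E p w)" .
  qed
  also have "\<dots> = ennreal (q - p) * (\<integral>\<^sup>+w. ennreal (?E q w) * ennreal (?l w) \<partial>N) + ennreal (exp ((\<psi> p - \<theta>) * m))"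
    using tilted_mean[OF p(1), where m=m and \<theta>=\<theta>] by (simp add: nn_integral_add nn_integral_cmult)
  also have "\<dots> \<le> ennreal (q - p) * ennreal (g - 1) + ennreal (exp ((\<psi> p - \<theta>) * m))"
    by (intro add_right_mono mult_left_mono I) simp
  also have "\<dots> = ennreal ((q - p) * (g - 1) + exp ((\<psi> p - \<theta>) * m))"
    using p g(2) by (simp add: ennreal_mult')
  finally have "ennreal 1 \<le> ennreal ((q - p) * (g - 1) + exp ((\<psi> p - \<theta>) * m))"
    unfolding ennreal_1 .
  then show ?thesis
    using p g(2) by (subst (asm) ennreal_le_iff) (auto intro!: add_nonneg_nonneg mult_nonneg_nonneg)
qed

text \<open>With \<open>p = 1\<close> the pointwise inequality is an equality for
  \<open>x \<ge> 0\<close>, and for negative \<open>x\<close> the exponential alone exceeds 1. In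
  the application \<open>\<psi> 1 < \<theta>\<close>, so the bound tends to
  \<open>q / (q - 1)\<close>.\<close>

lemma grid_gain_lower_supercritical:
  assumes q: "1 < q" "\<psi> q = \<theta>" and g: "\<And>n. grid_gain \<theta> n m \<le> ennreal g" "1 \<le> g"
  shows "(q - exp ((\<psi> 1 - \<theta>) * m)) / (q - 1) \<le> g"
proof -
  have "1 \<le> (q - 1) * record_limit q (max 0 x) + exp (- ((q - 1) * x))" for x
  proof (cases "0 \<le> x")
    case False
    then have "0 \<le> - ((q - 1) * x)" using q by (simp add: mult_nonneg_nonpos)
    then show ?thesis using False by (simp add: max_def)
  qed (use q in \<open>simp add: record_limit_def\<close>)
  then have "1 - exp ((\<psi> 1 - \<theta>) * m) \<le> (q - 1) * (g - 1)"
    using q by (intro grid_gain_lower_tilt g) auto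
  then show ?thesis using q by (simp add: pos_divide_le_eq algebra_simps)
qed

text \<open>The tilted mean of \<open>X (real m)\<close> is not computed. The inequality
  \<open>1 - exp (- (\<epsilon> * x)) \<le> \<epsilon> * max 0 x\<close> is integrated with
  \<open>p = 1 - \<epsilon>\<close> and divided by \<open>\<epsilon>\<close>; the limit at 0 is a
  derivative of \<open>\<psi>\<close>.\<close>

lemma grid_gain_lower_critical:
  assumes \<theta>: "\<psi> 1 = \<theta>" "0 \<le> \<theta>" and g: "\<And>n. grid_gain \<theta> n m \<le> ennreal g" "1 \<le> g"
  shows "1 + deriv \<psi> 1 * m \<le> g"
proof -
  let ?Q = "\<lambda>\<epsilon>. (1 - exp ((\<psi> (1 - \<epsilon>) - \<theta>) * m)) / \<epsilon>"
  have quot: "?Q \<epsilon> \<le> g - 1" if \<epsilon>: "0 < \<epsilon>" "\<epsilon> < 1" for \<epsilon>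
  proof -
    have "1 \<le> (1 - (1 - \<epsilon>)) * record_limit 1 (max 0 x) + exp (- ((1 - (1 - \<epsilon>)) * x))" for x
    proof -
      have "1 + - (\<epsilon> * x) \<le> exp (- (\<epsilon> * x))" by (rule exp_ge_add_one_self)
      moreover have "\<epsilon> * x \<le> \<epsilon> * max 0 x" using \<epsilon> by (intro mult_left_mono) auto
      ultimately show ?thesis by (simp add: record_limit_def)
    qed
    then have "1 - exp ((\<psi> (1 - \<epsilon>) - \<theta>) * m) \<le> (1 - (1 - \<epsilon>)) * (g - 1)"
      using \<theta> \<epsilon> by (intro grid_gain_lower_tilt g) auto
    then have "1 - exp ((\<psi> (1 - \<epsilon>) - \<theta>) * m) \<le> (g - 1) * \<epsilon>" by (simp add: mult.commute)
    then show ?thesis by (simp only: pos_divide_le_eq[OF \<epsilon>(1)])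
  qed
  have "((\<lambda>\<epsilon>. 1 - exp ((\<psi> (1 - \<epsilon>) - \<theta>) * m)) has_real_derivative deriv \<psi> 1 * m) (at 0)"
  proof -
    have "((\<lambda>\<epsilon>. 1 - \<epsilon>) has_real_derivative -1) (at 0)" by (auto intro!: derivative_eq_intros)
    then have "((\<lambda>\<epsilon>. \<psi> (1 - \<epsilon>)) has_real_derivative deriv \<psi> 1 * -1) (at 0)"
      by (intro DERIV_chain2[of \<psi>]) (use psi_has_derivative_1 \<theta> in auto)
    then show ?thesis by (auto intro!: derivative_eq_intros simp: \<theta>)
  qed
  then have "(?Q \<longlongrightarrow> deriv \<psi> 1 * m) (at 0)" by (simp add: DERIV_def \<theta>)
  then have "(?Q \<longlongrightarrow> deriv \<psi> 1 * m) (at_right 0)" by (rule filterlim_mono) (auto simp: at_le)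
  moreover have "\<forall>\<^sub>F \<epsilon> in at_right 0. ?Q \<epsilon> \<le> g - 1"
    unfolding eventually_at_right_field using quot by (intro exI[of _ 1]) auto
  ultimately have "deriv \<psi> 1 * m \<le> g - 1" by (intro tendsto_upperbound) auto
  then show ?thesis by simp
qed

end

section \<open>Exceedance masses and suprema over dyadic times\<close>

definition ereal_exp :: "ereal \<Rightarrow> ennreal" where
  "ereal_exp z = (if z = \<infinity> then \<infinity> else if z = - \<infinity> then 0 else ennreal (exp (real_of_ereal z)))"

lemma ereal_exp_simps [simp]:
  "ereal_exp (ereal x) = ennreal (exp x)" "ereal_exp (- \<infinity>) = 0" "ereal_exp \<infinity> = \<infinity>"
  by (auto simp: ereal_exp_def)

lemma ereal_exp_measurable [measurable]: "ereal_exp \<in> borel_measurable borel"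
  unfolding ereal_exp_def by measurable

lemma sets_exp_intensity [measurable_cong, simp]: "sets exp_intensity = sets borel"
  and space_exp_intensity [simp]: "space exp_intensity = UNIV"
  by (simp_all add: exp_intensity_def)

lemma emeasure_exp_intensity_greaterThan: "emeasure exp_intensity {a<..} = ennreal (exp (- a))"
proof -
  have "emeasure exp_intensity {a<..} = (\<integral>\<^sup>+u. ennreal (exp (- u)) * indicator {a<..} u \<partial>lborel)"
    unfolding exp_intensity_def by (subst emeasure_density) auto
  also have "\<dots> = (\<integral>\<^sup>+u. ennreal (exp (- u)) * indicator {a..} u \<partial>lborel)"
  proof (rule nn_integral_cong_AE)
    have "AE u in lborel. u \<noteq> a" by (rule AE_lborel_singleton)
    then show "AE u in lborel. ennreal (exp (- u)) * indicator {a<..} u = ennreal (exp (- u)) * indicator {a..} u"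
      by eventually_elim (auto simp: indicator_def)
  qed
  also have "\<dots> = ennreal (- 0 - (- exp (- a)))"
  proof (rule nn_integral_FTC_atLeast)
    show "((\<lambda>u. - exp (- u)) \<longlongrightarrow> - 0) (at_top :: real filter)"
      by (intro tendsto_minus filterlim_compose[OF exp_at_bot] filterlim_uminus_at_bot_at_top)
  qed (auto intro!: derivative_eq_intros)
  finally show ?thesis by simp
qed

text \<open>Identifies \<open>ereal_exp z\<close> as the mass of a set that grows with
  \<open>z\<close>; monotonicity and continuity along increasing sequences, infinite values
  included, are then properties of a measure.\<close>

lemma emeasure_exp_intensity_exceed: "emeasure exp_intensity {u. ereal u + z > 0} = ereal_exp z"
proof (cases z)
  case (real x)
  have "{u. ereal u + z > 0} = {- x<..}" using real by (auto simp: zero_ereal_def)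
  then show ?thesis using real by (simp add: emeasure_exp_intensity_greaterThan)
next
  case PInf
  have "ennreal (real n) \<le> emeasure exp_intensity UNIV" for n
  proof -
    have "real n \<le> exp (real n)" using exp_ge_add_one_self[of "real n"] by linarith
    then have "ennreal (real n) \<le> ennreal (exp (- (- real n)))" by (simp add: ennreal_leI)
    also have "\<dots> = emeasure exp_intensity {- real n<..}" by (simp add: emeasure_exp_intensity_greaterThan)
    also have "\<dots> \<le> emeasure exp_intensity UNIV" by (rule emeasure_mono) auto
    finally show ?thesis .
  qed
  then have "(SUP n. ennreal (real n)) \<le> emeasure exp_intensity UNIV" by (intro SUP_least) auto
  then have "emeasure exp_intensity UNIV = \<infinity>"
    by (simp add: ennreal_of_nat_eq_real_of_nat[symmetric] ennreal_SUP_of_nat_eq_top top_unique)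
  moreover have "{u. ereal u + z > 0} = UNIV" using PInf by auto
  ultimately show ?thesis using PInf by simp
qed simp

lemma ereal_exp_mono: "a \<le> b \<Longrightarrow> ereal_exp a \<le> ereal_exp b"
  unfolding emeasure_exp_intensity_exceed[symmetric]
  by (intro emeasure_mono) (auto intro: less_le_trans add_left_mono)

lemma sigma_finite_exp_intensity: "sigma_finite_measure exp_intensity"
proof (rule sigma_finite_measure.intro, intro exI conjI ballI)
  let ?A = "range (\<lambda>n::nat. {- real n<..})"
  show "countable ?A" by simp
  show "?A \<subseteq> sets exp_intensity" by auto
  show "\<Union>?A = space exp_intensity"
    by auto (metis reals_Archimedean2 minus_less_iff)
  show "emeasure exp_intensity a \<noteq> \<infinity>" if "a \<in> ?A" for a
    using that by (auto simp: emeasure_exp_intensity_greaterThan)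
qed

lemma ereal_exp_SUP:
  fixes z :: "nat \<Rightarrow> ereal"
  assumes "incseq z"
  shows "ereal_exp (SUP n. z n) = (SUP n. ereal_exp (z n))"
proof -
  let ?E = "\<lambda>z. {u. ereal u + z > 0}"
  have m: "?E x \<in> sets exp_intensity" for x by simp
  have iff: "ereal u + x > 0 \<longleftrightarrow> ereal (- u) < x" for u x by (cases x) (auto simp: zero_ereal_def)
  have "(SUP n. emeasure exp_intensity (?E (z n))) = emeasure exp_intensity (\<Union>n. ?E (z n))"
  proof (rule SUP_emeasure_incseq)
    show "incseq (\<lambda>n. ?E (z n))"
      using assms unfolding iff by (auto simp: incseq_def intro: less_le_trans)
  qed (use m in auto)
  also have "(\<Union>n. ?E (z n)) = ?E (SUP n. z n)" unfolding iff by (auto simp: less_SUP_iff)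
  finally show ?thesis by (simp add: emeasure_exp_intensity_exceed)
qed

definition grid_sup :: "nat \<Rightarrow> nat \<Rightarrow> (real \<Rightarrow> ereal) \<Rightarrow> ereal" where
  "grid_sup n m y = (SUP k\<in>{..m * 2 ^ n}. y (real k / 2 ^ n))"

definition dyadic_sup :: "nat \<Rightarrow> (real \<Rightarrow> ereal) \<Rightarrow> ereal" where
  "dyadic_sup m y = (SUP n. grid_sup n m y)"

lemma grid_sup_incseq: "incseq (\<lambda>n. grid_sup n m y)"
proof (rule incseq_SucI)
  fix n
  show "grid_sup n m y \<le> grid_sup (Suc n) m y"
    unfolding grid_sup_def
  proof (rule SUP_mono)
    fix k assume "k \<in> {..m * 2 ^ n}"
    then have "2 * k \<in> {..m * 2 ^ Suc n}" by simp
    moreover have "real (2 * k) / 2 ^ Suc n = real k / 2 ^ n" by simp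
    ultimately show "\<exists>j\<in>{..m * 2 ^ Suc n}. y (real k / 2 ^ n) \<le> y (real j / 2 ^ Suc n)"
      by (metis order_refl)
  qed
qed

lemma dyadic_sup_mono: "m \<le> m' \<Longrightarrow> dyadic_sup m y \<le> dyadic_sup m' y"
  unfolding dyadic_sup_def grid_sup_def by (intro SUP_mono' SUP_subset_mono) auto

lemma grid_sup_measurable [measurable]: "grid_sup n m \<in> borel_measurable (PiM {0..} (\<lambda>_. borel))"
  unfolding grid_sup_def by (intro borel_measurable_SUP measurable_component_singleton) auto

lemma dyadic_sup_measurable [measurable]: "dyadic_sup m \<in> borel_measurable (PiM {0..} (\<lambda>_. borel))"
  unfolding dyadic_sup_def by (intro borel_measurable_SUP grid_sup_measurable) auto

lemma dyadic_sup_cong: "(\<And>t. 0 \<le> t \<Longrightarrow> y t = y' t) \<Longrightarrow> dyadic_sup m y = dyadic_sup m y'"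
  unfolding dyadic_sup_def grid_sup_def by (intro SUP_cong refl) auto

lemma dyadic_sup_restrict [simp]: "dyadic_sup m (restrict y {0..}) = dyadic_sup m y"
  by (rule dyadic_sup_cong) auto

text \<open>For \<open>t < m\<close> dyadic points just above \<open>t\<close> approximate
  \<open>y t\<close> by right-continuity. The right endpoint has no such points inside the interval,
  but being an integer it lies on every grid.\<close>

lemma cadlag_SUP_dyadic:
  fixes y :: "real \<Rightarrow> ereal"
  assumes "cadlag y"
  shows "(SUP t\<in>{0..real m}. y t) = dyadic_sup m y"
proof (rule antisym)
  have grid: "y (real k / 2 ^ n) \<le> dyadic_sup m y" if "k \<le> m * 2 ^ n" for k n
    unfolding dyadic_sup_def grid_sup_def using that by (intro SUP_upper2[of n] SUP_upper) auto
  show "(SUP t\<in>{0..real m}. y t) \<le> dyadic_sup m y"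
  proof (rule SUP_least)
    fix t assume t: "t \<in> {0..real m}"
    show "y t \<le> dyadic_sup m y"
    proof (cases "t = real m")
      case True
      then show ?thesis using grid[of m 0] by simp
    next
      case False
      then have tm: "t < real m" using t by simp
      have t0: "0 \<le> t" using t by simp
      have fl: "filterlim (\<lambda>n. real (dyadic_above n t) / 2 ^ n) (at_right t) sequentially"
        by (rule filterlim_dyadic_above[OF t0])
      have "(y \<longlongrightarrow> y t) (at_right t)" using assms t0 by (auto simp: cadlag_def)
      then have lim: "(\<lambda>n. y (real (dyadic_above n t) / 2 ^ n)) \<longlonglongrightarrow> y t"
        by (rule filterlim_compose) (rule fl)
      have "\<forall>\<^sub>F s in at_right t. s < real m" using tm by (auto simp: eventually_at_right_field)
      then have "\<forall>\<^sub>F n in sequentially. real (dyadic_above n t) / 2 ^ n < real m"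
        by (rule eventually_compose_filterlim) (rule fl)
      then have "\<forall>\<^sub>F n in sequentially. y (real (dyadic_above n t) / 2 ^ n) \<le> dyadic_sup m y"
      proof eventually_elim
        fix n assume "real (dyadic_above n t) / 2 ^ n < real m"
        then have "real (dyadic_above n t) \<le> real (m * 2 ^ n)" by (simp add: pos_divide_less_eq)
        then show "y (real (dyadic_above n t) / 2 ^ n) \<le> dyadic_sup m y"
          by (intro grid) (simp only: of_nat_le_iff)
      qed
      then show ?thesis using lim by (intro tendsto_upperbound[OF lim]) auto
    qed
  qed
  show "dyadic_sup m y \<le> (SUP t\<in>{0..real m}. y t)"
    unfolding dyadic_sup_def grid_sup_def
  proof (intro SUP_least SUP_upper)
    fix n k assume "k \<in> {..m * 2 ^ n}"
    then have "real k \<le> real (m * 2 ^ n)" by (simp only: of_nat_le_iff atMost_iff)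
    then show "real k / 2 ^ n \<in> {0..real m}" by (simp add: pos_divide_le_eq)
  qed
qed

section \<open>Killing at an exponential time\<close>

lemma prob_space_killing_time: "0 \<le> \<theta> \<Longrightarrow> prob_space (killing_time \<theta>)"
  unfolding killing_time_def
  by (auto intro!: prob_space_return prob_space.prob_space_distr prob_space_exponential_density)

lemma sets_killing_time [measurable_cong, simp]: "sets (killing_time \<theta>) = sets borel"
  and space_killing_time [simp]: "space (killing_time \<theta>) = UNIV"
  by (simp_all add: killing_time_def)

lemma killing_time_gt:
  assumes "0 \<le> \<theta>" "0 \<le> s"
  shows "emeasure (killing_time \<theta>) {e. ereal s < e} = ennreal (exp (- (\<theta> * s)))"
proof (cases "\<theta> = 0")
  case False
  then have \<theta>: "0 < \<theta>" using assms by simp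
  let ?D = "density lborel (exponential_density \<theta>)"
  interpret D: prob_space ?D by (rule prob_space_exponential_density[OF \<theta>])
  have "distributed ?D lborel (\<lambda>x. x) (exponential_density \<theta>)"
    by (auto simp: distributed_def distr_id2)
  from D.exponential_distributedD_gt[OF this assms(2) \<theta>]
  have "measure ?D {x. s < x} = exp (- s * \<theta>)" by simp
  then have "emeasure ?D {x. s < x} = ennreal (exp (- (\<theta> * s)))"
    by (simp add: D.emeasure_eq_measure mult.commute)
  moreover have "{e. ereal s < e} \<in> sets borel" by simp
  moreover have "ereal -` {e. ereal s < e} \<inter> space ?D = {x. s < x}" by auto
  ultimately show ?thesis
    using False unfolding killing_time_def by (simp add: emeasure_distr)
qed (simp add: killing_time_def)

lemma SUP_atMost_Suc:
  "(SUP k\<in>{..Suc K}. f k) = max (SUP k\<in>{..K}. f k) (f (Suc K) :: ereal)"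
  by (simp add: atMost_Suc max.commute)

text \<open>The living grid times form an initial segment, after which the supremum stays frozen; so
  its exponential telescopes over the living steps. The condition \<open>0 < e\<close> makes time 0
  belong to them.\<close>

lemma killed_grid_sup:
  assumes e: "0 < e" and h: "0 < (h::real)"
  shows "ereal_exp (SUP k\<in>{..K}. if ereal (real k * h) < e then ereal (s k) else - \<infinity>)
    = ennreal (exp (s 0)) + (\<Sum>k<K. ennreal (exp (run_max s (Suc k)) - exp (run_max s k)) * indicator {e. ereal (real (Suc k) * h) < e} e)"
proof -
  let ?f = "\<lambda>k. if ereal (real k * h) < e then ereal (s k) else - \<infinity>"
  have alive: "(SUP k\<in>{..K}. ?f k) = ereal (run_max s K)" if "ereal (real K * h) < e" for K
    using that
  proof (induction K)
    case (Suc K)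
    have "ereal (real K * h) \<le> ereal (real (Suc K) * h)" using h by simp
    then have "ereal (real K * h) < e" using Suc.prems by (rule le_less_trans)
    then have "(SUP k\<in>{..K}. ?f k) = ereal (run_max s K)" by (rule Suc.IH)
    then show ?case unfolding SUP_atMost_Suc using Suc.prems by (simp del: of_nat_Suc)
  qed (use e in \<open>simp add: zero_ereal_def\<close>)
  show ?thesis
  proof (induction K)
    case 0
    then show ?case using e by (simp add: zero_ereal_def[symmetric])
  next
    case (Suc K)
    show ?case
    proof (cases "ereal (real (Suc K) * h) < e")
      case True
      have "ereal (real K * h) \<le> ereal (real (Suc K) * h)" using h by simp
      then have K: "ereal (real K * h) < e" using True by (rule le_less_trans)
      have "ereal_exp (SUP k\<in>{..Suc K}. ?f k) = ennreal (exp (run_max s K) + (exp (run_max s (Suc K)) - exp (run_max s K)))"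
        unfolding alive[OF True] by (simp del: run_max.simps)
      also have "\<dots> = ereal_exp (SUP k\<in>{..K}. ?f k) + ennreal (exp (run_max s (Suc K)) - exp (run_max s K))"
        unfolding alive[OF K] by (subst ennreal_plus) auto
      finally show ?thesis unfolding Suc.IH using True by (simp add: add.assoc del: of_nat_Suc run_max.simps)
    next
      case False
      then have "(SUP k\<in>{..Suc K}. ?f k) = (SUP k\<in>{..K}. ?f k)"
        unfolding SUP_atMost_Suc by (simp add: max_def del: of_nat_Suc)
      then show ?thesis using Suc.IH False by (simp del: of_nat_Suc run_max.simps)
    qed
  qed
qed

context spectrally_negative_levy
begin

lemma killed_measurable: "0 \<le> t \<Longrightarrow> killed X t \<in> borel_measurable (N \<Otimes>\<^sub>M killing_time \<theta>)"
  unfolding killed_def using X_measurable[of t] by measurable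

text \<open>Integrating the killing time first turns the survival indicators of
  \<open>killed_grid_sup\<close> into the discount factors of \<open>grid_gain\<close>. Grid suprema
  increase with \<open>n\<close>, so monotone convergence passes to the dyadic supremum.\<close>

lemma killed_gain:
  assumes \<theta>: "0 \<le> \<theta>"
  shows "(\<integral>\<^sup>+v. ereal_exp (dyadic_sup m (\<lambda>t. killed X t v)) \<partial>(N \<Otimes>\<^sub>M killing_time \<theta>)) = (SUP n. grid_gain \<theta> n m)"
proof -
  let ?P = "N \<Otimes>\<^sub>M killing_time \<theta>"
  interpret \<kappa>: prob_space "killing_time \<theta>" by (rule prob_space_killing_time[OF \<theta>])
  interpret P: pair_prob_space N "killing_time \<theta>" ..
  have km: "(\<lambda>v. grid_sup n m (\<lambda>t. killed X t v)) \<in> borel_measurable ?P" for n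
    unfolding grid_sup_def by (intro borel_measurable_SUP killed_measurable) auto
  have grid: "(\<integral>\<^sup>+v. ereal_exp (grid_sup n m (\<lambda>t. killed X t v)) \<partial>?P) = grid_gain \<theta> n m" for n
  proof -
    let ?K = "m * 2 ^ n"
    let ?M = "\<lambda>w. run_max (\<lambda>k. X (real k / 2 ^ n) w)"
    let ?D = "\<lambda>w k. ennreal (exp (?M w (Suc k)) - exp (?M w k))" and ?t = "\<lambda>k. real (Suc k) * (1 / 2 ^ n)"
    let ?I = "\<lambda>w. \<integral>\<^sup>+e. ereal_exp (grid_sup n m (\<lambda>t. killed X t (w, e))) \<partial>killing_time \<theta>"
    have Mm[measurable]: "(\<lambda>w. ?M w k) \<in> borel_measurable N" for k by (intro measurable_run_max) simp
    have int_sum: "(\<integral>\<^sup>+e. c + (\<Sum>k<?K. a k * indicator (A k) e) \<partial>killing_time \<theta>) = c + (\<Sum>k<?K. a k * emeasure (killing_time \<theta>) (A k))"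
      if [measurable]: "\<And>k. A k \<in> sets borel" for c and a :: "nat \<Rightarrow> ennreal" and A
    proof -
      have "(\<integral>\<^sup>+e. c + (\<Sum>k<?K. a k * indicator (A k) e) \<partial>killing_time \<theta>)
        = (\<integral>\<^sup>+e. c \<partial>killing_time \<theta>) + (\<integral>\<^sup>+e. (\<Sum>k<?K. a k * indicator (A k) e) \<partial>killing_time \<theta>)"
        by (rule nn_integral_add) measurable
      also have "(\<integral>\<^sup>+e. (\<Sum>k<?K. a k * indicator (A k) e) \<partial>killing_time \<theta>) = (\<Sum>k<?K. a k * emeasure (killing_time \<theta>) (A k))"
        by (subst nn_integral_sum) (auto simp: nn_integral_cmult_indicator)
      finally show ?thesis using \<kappa>.emeasure_space_1 by simp
    qed
    have pos: "AE e in killing_time \<theta>. 0 < e"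
    proof -
      have "emeasure (killing_time \<theta>) {e. 0 < e} = 1" using killing_time_gt[OF \<theta>, of 0] by (simp add: zero_ereal_def)
      then have "\<kappa>.prob {e \<in> space (killing_time \<theta>). 0 < e} = 1" by (simp add: \<kappa>.emeasure_eq_measure)
      then show ?thesis by (subst (asm) \<kappa>.prob_Collect_eq_1) auto
    qed
    have "(\<integral>\<^sup>+v. ereal_exp (grid_sup n m (\<lambda>t. killed X t v)) \<partial>?P)
      = (\<integral>\<^sup>+w. \<integral>\<^sup>+e. ereal_exp (grid_sup n m (\<lambda>t. killed X t (w, e))) \<partial>killing_time \<theta> \<partial>N)"
      by (rule \<kappa>.nn_integral_fst[symmetric]) (use km in measurable)
    also have "\<dots> = (\<integral>\<^sup>+w. ennreal (exp (X 0 w)) + (\<Sum>k<?K. ?D w k * ennreal (exp (- (\<theta> * (?t k))))) \<partial>N)"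
    proof (intro nn_integral_cong)
      fix w
      have "?I w
         = (\<integral>\<^sup>+e. ennreal (exp (X 0 w)) + (\<Sum>k<?K. ?D w k * indicator {e. ereal (?t k) < e} e) \<partial>killing_time \<theta>)"
        using pos
      proof (intro nn_integral_cong_AE, eventually_elim)
        fix e :: ereal assume "0 < e"
        from killed_grid_sup[OF this, of "1 / 2 ^ n" "\<lambda>k. X (real k / 2 ^ n) w" ?K]
        show "ereal_exp (grid_sup n m (\<lambda>t. killed X t (w, e))) = ennreal (exp (X 0 w)) + (\<Sum>k<?K. ?D w k * indicator {e. ereal (?t k) < e} e)"
          unfolding grid_sup_def killed_def by (simp del: run_max.simps of_nat_Suc)
      qed
      also have "\<dots> = ennreal (exp (X 0 w)) + (\<Sum>k<?K. ?D w k * emeasure (killing_time \<theta>) {e. ereal (?t k) < e})"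
        by (rule int_sum) simp
      also have "\<dots> = ennreal (exp (X 0 w)) + (\<Sum>k<?K. ?D w k * ennreal (exp (- (\<theta> * (?t k)))))"
        by (intro arg_cong2[where f="(+)"] refl sum.cong arg_cong2[where f="(*)"] killing_time_gt \<theta>) simp
      finally show "?I w
         = ennreal (exp (X 0 w)) + (\<Sum>k<?K. ?D w k * ennreal (exp (- (\<theta> * (?t k)))))" .
    qed
    also have "\<dots> = (\<integral>\<^sup>+w. 1 + (\<Sum>k<?K. ennreal ((1 / exp (\<theta> / 2 ^ n)) ^ Suc k * (exp (grid_max n w (Suc k)) - exp (grid_max n w k)))) \<partial>N)"
    proof (rule nn_integral_cong_AE, use X_0 in eventually_elim)
      fix w assume X0: "X 0 w = 0"
      have "grid_max n w = ?M w" unfolding grid_max_def by (rule ext, rule run_max_cong) (simp add: psum_inc X0)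
      moreover have "exp (- (\<theta> * (?t k))) = (1 / exp (\<theta> / 2 ^ n)) ^ Suc k" for k
      proof -
        have "(1 / exp (\<theta> / 2 ^ n)) ^ Suc k = exp (- (\<theta> / 2 ^ n)) ^ Suc k" by (simp only: exp_minus inverse_eq_divide)
        also have "\<dots> = exp (real (Suc k) * (- (\<theta> / 2 ^ n)))" by (rule exp_of_nat_mult[symmetric])
        finally show ?thesis by (simp add: algebra_simps)
      qed
      moreover have "ennreal (a - b) * ennreal c = ennreal (c * (a - b))" if "b \<le> a" "0 \<le> c" for a b c
        using that by (simp add: ennreal_mult'[symmetric] mult.commute)
      ultimately show "ennreal (exp (X 0 w)) + (\<Sum>k<?K. ?D w k * ennreal (exp (- (\<theta> * (?t k)))))
        = 1 + (\<Sum>k<?K. ennreal ((1 / exp (\<theta> / 2 ^ n)) ^ Suc k * (exp (grid_max n w (Suc k)) - exp (grid_max n w k))))"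
        using X0 by (simp add: run_max_Suc_ge del: run_max.simps power_Suc)
    qed
    also have "\<dots> = grid_gain \<theta> n m"
      unfolding grid_gain_def
      by (subst nn_integral_add, simp, simp del: run_max.simps power_Suc, subst nn_integral_sum)
        (simp_all add: emeasure_space_1 del: run_max.simps power_Suc)
    finally show ?thesis .
  qed
  have "(\<integral>\<^sup>+v. ereal_exp (dyadic_sup m (\<lambda>t. killed X t v)) \<partial>?P)
    = (\<integral>\<^sup>+v. (SUP n. ereal_exp (grid_sup n m (\<lambda>t. killed X t v))) \<partial>?P)"
    unfolding dyadic_sup_def by (intro nn_integral_cong ereal_exp_SUP grid_sup_incseq)
  also have "\<dots> = (SUP n. \<integral>\<^sup>+v. ereal_exp (grid_sup n m (\<lambda>t. killed X t v)) \<partial>?P)"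
  proof (rule nn_integral_monotone_convergence_SUP)
    show "incseq (\<lambda>n v. ereal_exp (grid_sup n m (\<lambda>t. killed X t v)))"
      using grid_sup_incseq by (auto simp: incseq_def le_fun_def intro!: ereal_exp_mono)
    show "(\<lambda>v. ereal_exp (grid_sup n m (\<lambda>t. killed X t v))) \<in> borel_measurable ?P" for n
      using km[of n] by measurable
  qed
  finally show ?thesis by (simp add: grid)
qed

end

section \<open>The extremal index\<close>

text \<open>Supplies both independence hypotheses of \<open>marked_poisson_void\<close>: the marks
  use distinct members \<open>r i\<close> of one independent family, and the points use a further
  member \<open>p\<close>.\<close>

lemma (in prob_space) indep_marks:
  fixes G :: "'i \<Rightarrow> 'a measure" and r :: "nat \<Rightarrow> 'i"
  assumes ind: "indep_sets (\<lambda>k. sets (G k)) UNIV" and sp: "\<And>k. space (G k) = space M"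
    and r: "inj r" "p \<notin> range r"
    and P: "\<And>i. P i \<in> measurable (G p) \<mu>" and Z: "\<And>i. Z i \<in> measurable (G (r i)) \<nu>"
  shows "indep_vars (\<lambda>_. \<nu>) Z (UNIV :: nat set)"
    and "distr M (PiM UNIV (\<lambda>_. \<mu>) \<Otimes>\<^sub>M PiM UNIV (\<lambda>_. \<nu>)) (\<lambda>w. (\<lambda>i. P i w, \<lambda>i. Z i w))
      = distr M (PiM UNIV (\<lambda>_. \<mu>)) (\<lambda>w i. P i w) \<Otimes>\<^sub>M distr M (PiM UNIV (\<lambda>_. \<nu>)) (\<lambda>w i. Z i w)"
proof -
  have stable: "Int_stable (sets (G k))" for k by (rule sets.Int_stable)
  have pow: "sets (G k) \<subseteq> Pow (space M)" for k using sets.sets_into_space[of _ "G k"] sp by auto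
  have self: "sigma_sets (space M) (sets (G k)) = sets (G k)" for k
    using sets.sigma_sets_eq[of "G k"] sp by simp
  have "indep_sets (\<lambda>j. sigma_sets (space M) (\<Union>i\<in>{r j}. sets (G i))) (UNIV :: nat set)"
    by (rule indep_sets_collect_sigma[OF indep_sets_mono_index[OF _ ind] stable])
      (use r in \<open>auto simp: disjoint_family_on_def inj_def\<close>)
  then have "indep_sets (\<lambda>j. sets (G (r j))) (UNIV :: nat set)" by (simp add: self)
  then show "indep_vars (\<lambda>_. \<nu>) Z (UNIV :: nat set)"
    by (rule indep_setsD_vars) (use sp Z in auto)
  define H where "H = sigma (space M) (\<Union>i. sets (G (r i)))"
  have Hsub: "(\<Union>i. sets (G (r i))) \<subseteq> Pow (space M)" using pow by blast
  have H: "sets H = sigma_sets (space M) (\<Union>i. sets (G (r i)))" "space H = space M"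
    using Hsub by (auto simp: H_def space_measure_of_conv)
  have "indep_sets (\<lambda>b. sigma_sets (space M) (\<Union>i\<in>(if b then {p} else range r). sets (G i))) UNIV"
    by (rule indep_sets_collect_sigma[OF indep_sets_mono_index[OF _ ind] stable])
      (use r in \<open>auto simp: disjoint_family_on_def\<close>)
  moreover have "(\<lambda>b. sigma_sets (space M) (\<Union>i\<in>(if b then {p} else range r). sets (G i))) = case_bool (sets (G p)) (sets H)"
    by (auto simp: fun_eq_iff self H split: bool.split)
  ultimately have "indep_set (sets (G p)) (sets H)" by (simp add: indep_set_def)
  then show "distr M (PiM UNIV (\<lambda>_. \<mu>) \<Otimes>\<^sub>M PiM UNIV (\<lambda>_. \<nu>)) (\<lambda>w. (\<lambda>i. P i w, \<lambda>i. Z i w))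
      = distr M (PiM UNIV (\<lambda>_. \<mu>)) (\<lambda>w i. P i w) \<Otimes>\<^sub>M distr M (PiM UNIV (\<lambda>_. \<nu>)) (\<lambda>w i. Z i w)"
  proof (rule indep_setD_joint_distr[OF _ sp H(2)])
    show "(\<lambda>w i. P i w) \<in> measurable (G p) (PiM UNIV (\<lambda>_. \<mu>))"
      by (rule measurable_PiM_single'[OF P]) (auto simp: PiE_iff intro: measurable_space[OF P])
    have ZH: "Z i \<in> measurable H \<nu>" for i
    proof (rule measurableI)
      fix A assume "A \<in> sets \<nu>"
      then have "Z i -` A \<inter> space M \<in> sets (G (r i))" using measurable_sets[OF Z] sp by metis
      then show "Z i -` A \<inter> space H \<in> sets H" unfolding H by (auto intro: sigma_sets.Basic)
    qed (use measurable_space[OF Z] sp H in auto)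
    show "(\<lambda>w i. Z i w) \<in> measurable H (PiM UNIV (\<lambda>_. \<nu>))"
      by (rule measurable_PiM_single'[OF ZH]) (auto simp: PiE_iff intro: measurable_space[OF ZH])
  qed
qed

lemma path_functional_measurable:
  fixes Y :: "real \<Rightarrow> 'w \<Rightarrow> ereal"
  assumes F: "F \<in> borel_measurable (PiM {0..} (\<lambda>_. borel))" "\<And>y. F (restrict y {0..}) = F y"
  shows "(\<lambda>w. F (\<lambda>t. Y t w)) \<in> borel_measurable (sigma (space M) (events_of M borel {0..} Y))"
proof -
  have "(\<lambda>w. \<lambda>t\<in>{0..}. Y t w) \<in> measurable (sigma (space M) (events_of M borel {0..} Y)) (PiM {0..} (\<lambda>_. borel))"
    by (intro measurable_restrict measurable_coordinates_events_of) auto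
  from measurable_compose[OF this F(1)] show ?thesis by (simp add: F(2))
qed

text \<open>The copies agree in law only on the product space over \<open>{0..}\<close>, so only
  functionals measurable there can be transported. This is why suprema over real intervals are first
  reduced to dyadic ones.\<close>

lemma copy_of_killed_distr:
  assumes Y: "copy_of_killed M Y N X \<theta>"
    and X: "\<And>t. 0 \<le> t \<Longrightarrow> killed X t \<in> borel_measurable (N \<Otimes>\<^sub>M killing_time \<theta>)"
    and F: "F \<in> borel_measurable (PiM {0..} (\<lambda>_. borel))" "\<And>y. F (restrict y {0..}) = F y"
  shows "distr M borel (\<lambda>w. F (\<lambda>t. Y t w)) = distr (N \<Otimes>\<^sub>M killing_time \<theta>) borel (\<lambda>v. F (\<lambda>t. killed X t v))"
proof -
  have 1: "(\<lambda>w. \<lambda>t\<in>{0..}. Y t w) \<in> measurable M (PiM {0..} (\<lambda>_. borel))"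
    using Y by (intro measurable_restrict) (auto simp: copy_of_killed_def)
  have 2: "(\<lambda>v. \<lambda>t\<in>{0..}. killed X t v) \<in> measurable (N \<Otimes>\<^sub>M killing_time \<theta>) (PiM {0..} (\<lambda>_. borel))"
    using X by (intro measurable_restrict) auto
  have "distr M borel (\<lambda>w. F (\<lambda>t. Y t w)) = distr (distr M (PiM {0..} (\<lambda>_. borel)) (\<lambda>w. \<lambda>t\<in>{0..}. Y t w)) borel F"
    by (subst distr_distr[OF F(1) 1]) (simp add: comp_def F(2))
  also have "\<dots> = distr (distr (N \<Otimes>\<^sub>M killing_time \<theta>) (PiM {0..} (\<lambda>_. borel)) (\<lambda>v. \<lambda>t\<in>{0..}. killed X t v)) borel F"
    using Y by (simp add: copy_of_killed_def)
  also have "\<dots> = distr (N \<Otimes>\<^sub>M killing_time \<theta>) borel (\<lambda>v. F (\<lambda>t. killed X t v))"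
    by (subst distr_distr[OF F(1) 2]) (simp add: comp_def F(2))
  finally show ?thesis .
qed

lemma measurable_fst_borel: "fst \<in> borel_measurable (borel :: (real \<times> real) measure)"
  and measurable_snd_borel: "snd \<in> borel_measurable (borel :: (real \<times> real) measure)"
  unfolding borel_prod[symmetric] by simp_all

text \<open>Tonelli: for a fixed mark \<open>z\<close> the points \<open>u\<close> with
  \<open>ereal u + z > 0\<close> have mass \<open>ereal_exp z\<close>. Thus the mean exponential of
  a mark is the intensity of marked points above level 0.\<close>

lemma intensity_of_exceedance:
  assumes "prob_space \<nu>" and \<nu>: "sets \<nu> = sets (borel :: ereal measure)"
  shows "(\<integral>\<^sup>+u. emeasure \<nu> {z. ereal u + z > 0} \<partial>exp_intensity) = (\<integral>\<^sup>+z. ereal_exp z \<partial>\<nu>)"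
    and "(\<lambda>u. emeasure \<nu> {z. ereal u + z > 0}) \<in> borel_measurable exp_intensity"
proof -
  interpret \<nu>: prob_space \<nu> by fact
  interpret E: sigma_finite_measure exp_intensity by (rule sigma_finite_exp_intensity)
  interpret pair_sigma_finite exp_intensity \<nu> ..
  note \<nu>[measurable_cong]
  have sp: "space \<nu> = UNIV" using sets_eq_imp_space_eq[OF \<nu>] by simp
  let ?K = "{x \<in> space (exp_intensity \<Otimes>\<^sub>M \<nu>). ereal (fst x) + snd x > 0}"
  have K: "?K \<in> sets (exp_intensity \<Otimes>\<^sub>M \<nu>)" by measurable
  have eqs: "Pair u -` ?K = {z. ereal u + z > 0}" "(\<lambda>u. (u, z)) -` ?K = {u. ereal u + z > 0}" for u z
    by (auto simp: space_pair_measure sp)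
  show "(\<lambda>u. emeasure \<nu> {z. ereal u + z > 0}) \<in> borel_measurable exp_intensity"
    using \<nu>.measurable_emeasure_Pair[OF K] by (simp only: eqs)
  have "(\<integral>\<^sup>+u. emeasure \<nu> (Pair u -` ?K) \<partial>exp_intensity) = (\<integral>\<^sup>+z. emeasure exp_intensity ((\<lambda>u. (u, z)) -` ?K) \<partial>\<nu>)"
    using \<nu>.emeasure_pair_measure_alt[OF K] emeasure_pair_measure_alt2[OF K] by simp
  then show "(\<integral>\<^sup>+u. emeasure \<nu> {z. ereal u + z > 0} \<partial>exp_intensity) = (\<integral>\<^sup>+z. ereal_exp z \<partial>\<nu>)"
    by (simp only: eqs emeasure_exp_intensity_exceed)
qed

lemma sigma_finite_birth: "sigma_finite_measure (density (restrict_space lborel {0::real<..}) (\<lambda>_. ennreal \<theta>))"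
proof -
  interpret L: sigma_finite_measure "restrict_space lborel {0::real<..}"
    by (intro sigma_finite_measure_restrict_space lborel.sigma_finite_measure_axioms) auto
  show ?thesis
    using L.sigma_finite_iff_density_finite[of "\<lambda>_. ennreal \<theta>"] by simp
qed

lemma sigma_finite_birth_intensity: "sigma_finite_measure (birth_intensity \<theta> {0::real<..})"
proof -
  interpret D: sigma_finite_measure "density (restrict_space lborel {0::real<..}) (\<lambda>_. ennreal \<theta>)" by (rule sigma_finite_birth)
  interpret E: sigma_finite_measure exp_intensity by (rule sigma_finite_exp_intensity)
  interpret pair_sigma_finite "density (restrict_space lborel {0::real<..}) (\<lambda>_. ennreal \<theta>)" exp_intensity ..
  show ?thesis unfolding birth_intensity_def by (rule sigma_finite_measure_axioms)
qed

lemma birth_intensity_of_exceedance: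
  assumes "prob_space \<nu>" "sets \<nu> = sets (borel :: ereal measure)" and c: "0 \<le> c" and \<theta>: "0 \<le> \<theta>"
  shows "(\<integral>\<^sup>+p. emeasure \<nu> {z. fst p \<le> c \<and> ereal (snd p) + z > 0} \<partial>birth_intensity \<theta> {0<..}) = ennreal (\<theta> * c) * (\<integral>\<^sup>+z. ereal_exp z \<partial>\<nu>)"
proof -
  let ?D = "density (restrict_space lborel {0<..}) (\<lambda>_. ennreal \<theta>)"
  let ?I = "\<lambda>u. emeasure \<nu> {z. ereal u + z > 0}"
  interpret E: sigma_finite_measure exp_intensity by (rule sigma_finite_exp_intensity)
  note I = intensity_of_exceedance[OF assms(1,2)]
  have Im[measurable]: "?I \<in> borel_measurable borel" using I(2) by (simp cong: measurable_cong_sets)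
  have cD[measurable]: "{..c} \<inter> {0<..} \<in> sets ?D" by (simp add: sets_restrict_space_iff)
  have "(\<integral>\<^sup>+p. emeasure \<nu> {z. fst p \<le> c \<and> ereal (snd p) + z > 0} \<partial>birth_intensity \<theta> {0<..})
    = (\<integral>\<^sup>+p. indicator ({..c} \<inter> {0<..}) (fst p) * ?I (snd p) \<partial>(?D \<Otimes>\<^sub>M exp_intensity))"
    unfolding birth_intensity_def
    by (intro nn_integral_cong) (auto simp: indicator_def space_pair_measure space_restrict_space)
  also have "\<dots> = (\<integral>\<^sup>+t. \<integral>\<^sup>+u. indicator ({..c} \<inter> {0<..}) t * ?I u \<partial>exp_intensity \<partial>?D)"
    by (subst E.nn_integral_fst[symmetric])
      (auto intro!: borel_measurable_times_ennreal measurable_compose[OF measurable_fst borel_measurable_indicator[OF cD]]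
        measurable_compose[OF measurable_snd I(2)])
  also have "\<dots> = (\<integral>\<^sup>+t. indicator ({..c} \<inter> {0<..}) t * (\<integral>\<^sup>+z. ereal_exp z \<partial>\<nu>) \<partial>?D)"
    by (subst nn_integral_cmult) (use I in auto)
  also have "\<dots> = emeasure ?D ({..c} \<inter> {0<..}) * (\<integral>\<^sup>+z. ereal_exp z \<partial>\<nu>)"
    using cD by (subst nn_integral_multc) auto
  also have "emeasure ?D ({..c} \<inter> {0<..}) = ennreal (\<theta> * c)"
  proof -
    have "emeasure ?D ({..c} \<inter> {0<..}) = (\<integral>\<^sup>+t. ennreal \<theta> * indicator ({..c} \<inter> {0<..}) t \<partial>restrict_space lborel {0<..})"
      using cD by (subst emeasure_density) auto
    also have "\<dots> = ennreal \<theta> * emeasure (restrict_space lborel {0<..}) ({..c} \<inter> {0<..})"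
      using cD by (subst nn_integral_cmult_indicator) auto
    also have "emeasure (restrict_space lborel {0<..}) ({..c} \<inter> {0<..}) = emeasure lborel {0<..c}"
      by (subst emeasure_restrict_space) (auto intro!: arg_cong[where f="emeasure lborel"])
    finally show ?thesis using c \<theta> by (simp add: ennreal_mult')
  qed
  finally show ?thesis .
qed

section \<open>Void probabilities of the points and of the births\<close>

locale spectrally_negative_lbr = levy_brown_resnick M N \<xi> N' \<xi>' \<theta>p \<theta>m U Bp Bm Lp Lm LBp LBm
  for M :: "'w measure" and N :: "'a measure" and \<xi> and N' :: "'b measure" and \<xi>' \<theta>p \<theta>m U Bp Bm Lp Lm LBp LBm +
  assumes npj: "no_positive_jumps N \<xi>"
begin

sublocale L: spectrally_negative_levy N \<xi>
  using levy npj by (intro spectrally_negative_levy.intro spectrally_negative_levy_axioms.intro)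
    (auto simp: levy_process_def)

text \<open>The function \<open>g\<close> of the overview at integer times, see
  \<open>nn_integral_\<nu>_dyadic\<close>.\<close>

definition gain :: "nat \<Rightarrow> ennreal" where
  "gain m = (SUP n. L.grid_gain \<theta>m n m)"

text \<open>The functional whose mean exponential is \<open>g\<close> at infinity; births in
  \<open>[0, T]\<close> have different remaining times, and their whole life bounds them
  all.\<close>

definition total_sup :: "(real \<Rightarrow> ereal) \<Rightarrow> ereal" where
  "total_sup y = (SUP m. dyadic_sup m y)"

lemma total_sup_measurable: "total_sup \<in> borel_measurable (PiM {0..} (\<lambda>_. borel))"
  unfolding total_sup_def by (intro borel_measurable_SUP) auto

lemma total_sup_restrict: "total_sup (restrict y {0..}) = total_sup y"
  by (simp add: total_sup_def)

definition \<nu> :: "((real \<Rightarrow> ereal) \<Rightarrow> ereal) \<Rightarrow> ereal measure" where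
  "\<nu> F = distr (N \<Otimes>\<^sub>M killing_time \<theta>m) borel (\<lambda>v. F (\<lambda>t. killed \<xi> t v))"

lemma sets_\<nu> [simp]: "sets (\<nu> F) = sets borel"
  by (simp add: \<nu>_def)

context
  fixes F :: "(real \<Rightarrow> ereal) \<Rightarrow> ereal"
  assumes F: "F \<in> borel_measurable (PiM {0..} (\<lambda>_. borel))" "\<And>y. F (restrict y {0..}) = F y"
begin

lemma path_functional_law:
  "distr M borel (\<lambda>w. F (\<lambda>t. Lp i t w)) = \<nu> F" "distr M borel (\<lambda>w. F (\<lambda>t. LBp i t w)) = \<nu> F"
  unfolding \<nu>_def by (intro copy_of_killed_distr law_Lp law_LBp L.killed_measurable F; assumption)+

lemma killed_functional_measurable: "(\<lambda>v. F (\<lambda>t. killed \<xi> t v)) \<in> borel_measurable (N \<Otimes>\<^sub>M killing_time \<theta>m)"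
proof -
  have "(\<lambda>v. \<lambda>t\<in>{0..}. killed \<xi> t v) \<in> measurable (N \<Otimes>\<^sub>M killing_time \<theta>m) (PiM {0..} (\<lambda>_. borel))"
    by (intro measurable_restrict L.killed_measurable) auto
  from measurable_compose[OF this F(1)] show ?thesis by (simp add: F(2))
qed

lemma prob_space_\<nu>: "prob_space (\<nu> F)"
proof -
  interpret \<kappa>: prob_space "killing_time \<theta>m" by (rule prob_space_killing_time[OF rates(2)])
  interpret P: pair_prob_space N "killing_time \<theta>m" ..
  show ?thesis unfolding \<nu>_def by (rule P.prob_space_distr[OF killed_functional_measurable])
qed

lemma nn_integral_\<nu>: "(\<integral>\<^sup>+z. ereal_exp z \<partial>\<nu> F) = (\<integral>\<^sup>+v. ereal_exp (F (\<lambda>t. killed \<xi> t v)) \<partial>(N \<Otimes>\<^sub>M killing_time \<theta>m))"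
  unfolding \<nu>_def by (rule nn_integral_distr[OF killed_functional_measurable]) simp

end

lemma nn_integral_\<nu>_dyadic: "(\<integral>\<^sup>+z. ereal_exp z \<partial>\<nu> (dyadic_sup m)) = gain m"
  unfolding gain_def nn_integral_\<nu>[OF dyadic_sup_measurable dyadic_sup_restrict] by (rule L.killed_gain[OF rates(2)])

lemma nn_integral_\<nu>_total: "(\<integral>\<^sup>+z. ereal_exp z \<partial>\<nu> total_sup) = (SUP m. gain m)"
proof -
  have inc: "incseq (\<lambda>m. dyadic_sup m y)" for y by (auto simp: incseq_def dyadic_sup_mono)
  have "(\<integral>\<^sup>+z. ereal_exp z \<partial>\<nu> total_sup) = (\<integral>\<^sup>+v. (SUP m. ereal_exp (dyadic_sup m (\<lambda>t. killed \<xi> t v))) \<partial>(N \<Otimes>\<^sub>M killing_time \<theta>m))"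
    by (subst nn_integral_\<nu>[OF total_sup_measurable total_sup_restrict]) (simp add: total_sup_def ereal_exp_SUP[OF inc])
  also have "\<dots> = (SUP m. \<integral>\<^sup>+v. ereal_exp (dyadic_sup m (\<lambda>t. killed \<xi> t v)) \<partial>(N \<Otimes>\<^sub>M killing_time \<theta>m))"
  proof (rule nn_integral_monotone_convergence_SUP)
    show "incseq (\<lambda>m v. ereal_exp (dyadic_sup m (\<lambda>t. killed \<xi> t v)))"
      using inc by (auto simp: incseq_def le_fun_def intro!: ereal_exp_mono)
    show "(\<lambda>v. ereal_exp (dyadic_sup m (\<lambda>t. killed \<xi> t v))) \<in> borel_measurable (N \<Otimes>\<^sub>M killing_time \<theta>m)" for m
      by (intro measurable_compose[OF killed_functional_measurable ereal_exp_measurable] dyadic_sup_measurable dyadic_sup_restrict)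
  qed
  also have "\<dots> = (SUP m. gain m)" by (simp add: gain_def L.killed_gain rates)
  finally show ?thesis .
qed

text \<open>The same case distinction as in the assumption \<open>independent\<close>, wrapped in
  \<open>sigma\<close> so that measurability with respect to one ingredient can be stated.\<close>

definition sources :: "ingredient \<Rightarrow> 'w measure" where
  "sources k = sigma (space M) (case k of
            Points \<Rightarrow> events_of M borel UNIV U
          | Births_plus \<Rightarrow> events_of M borel (point_indices \<theta>p) Bp
          | Births_minus \<Rightarrow> events_of M borel (point_indices \<theta>m) Bm
          | Path_plus i \<Rightarrow> events_of M borel {0..} (Lp i)
          | Path_minus i \<Rightarrow> events_of M borel {0..} (Lm i)
          | Birth_path_plus i \<Rightarrow> events_of M borel {0..} (LBp i)
          | Birth_path_minus i \<Rightarrow> events_of M borel {0..} (LBm i))"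

lemma sources_indep: "indep_sets (\<lambda>k. sets (sources k)) UNIV"
  using independent
  by (rule back_subst[where P="\<lambda>F. indep_sets F UNIV"])
    (auto simp: fun_eq_iff sources_def events_of_sigma split: ingredient.split)

lemma space_sources [simp]: "space (sources k) = space M"
  by (simp add: sources_def space_measure_of_conv)

lemma U_sources: "U i \<in> measurable (sources Points) borel"
  unfolding sources_def by (simp, rule measurable_coordinates_events_of) auto

text \<open>The space of \<open>birth_intensity\<close> is an open half-plane, so measurability into
  it includes positivity of the birth times, which comes from the Poisson assumption.\<close>

lemma Bp_sources:
  assumes "0 < \<theta>p"
  shows "Bp i \<in> measurable (sources Births_plus) (birth_intensity \<theta>p {0<..})"
proof -
  have i: "i \<in> point_indices \<theta>p" using assms by (simp add: point_indices_def)
  have b: "Bp i \<in> measurable (sources Births_plus) borel"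
    unfolding sources_def by (simp, rule measurable_coordinates_events_of) (use i in auto)
  have pos: "0 < fst (Bp i w)" if "w \<in> space M" for w
  proof -
    have "Bp i \<in> measurable M (birth_intensity \<theta>p {0<..})" using ppp_plus i by (auto simp: poisson_point_process_def)
    from measurable_space[OF this that] show ?thesis
      by (auto simp: birth_intensity_def space_pair_measure space_restrict_space)
  qed
  have f: "(\<lambda>w. fst (Bp i w)) \<in> measurable (sources Births_plus) (restrict_space lborel {0<..})"
    using pos measurable_compose[OF b measurable_fst_borel]
    by (intro measurable_restrict_space2) auto
  have "(\<lambda>w. (fst (Bp i w), snd (Bp i w))) \<in> measurable (sources Births_plus) (restrict_space lborel {0<..} \<Otimes>\<^sub>M borel)"
    using f measurable_compose[OF b measurable_snd_borel] by (intro measurable_Pair) auto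
  moreover have "sets (birth_intensity \<theta>p {0<..}) = sets (restrict_space lborel {0<..} \<Otimes>\<^sub>M borel)"
    unfolding birth_intensity_def by (intro sets_pair_measure_cong) auto
  ultimately show ?thesis by (simp cong: measurable_cong_sets)
qed

definition points_void :: "((real \<Rightarrow> ereal) \<Rightarrow> ereal) \<Rightarrow> 'w set" where
  "points_void F = {w\<in>space M. \<forall>i. \<not> ereal (U i w) + F (\<lambda>t. Lp i t w) > 0}"

text \<open>The cut-off \<open>c\<close> is \<open>T - s\<close> in the lower bound, so that the
  first \<open>s\<close> time units of each counted path fall into \<open>[0, T]\<close>, and the
  full horizon in the upper bound.\<close>

definition births_void :: "real \<Rightarrow> ((real \<Rightarrow> ereal) \<Rightarrow> ereal) \<Rightarrow> 'w set" where
  "births_void c F = {w\<in>space M. \<forall>i. \<not> (fst (Bp i w) \<le> c \<and> ereal (snd (Bp i w)) + F (\<lambda>t. LBp i t w) > 0)}"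

context
  fixes F :: "(real \<Rightarrow> ereal) \<Rightarrow> ereal"
  assumes F: "F \<in> borel_measurable (PiM {0..} (\<lambda>_. borel))" "\<And>y. F (restrict y {0..}) = F y"
begin

lemma Lp_sources: "(\<lambda>w. F (\<lambda>t. Lp i t w)) \<in> borel_measurable (sources (Path_plus i))"
  unfolding sources_def using path_functional_measurable[OF F] by simp

lemma LBp_sources: "(\<lambda>w. F (\<lambda>t. LBp i t w)) \<in> borel_measurable (sources (Birth_path_plus i))"
  unfolding sources_def using path_functional_measurable[OF F] by simp

lemma prob_points_void:
  assumes g: "(\<integral>\<^sup>+z. ereal_exp z \<partial>\<nu> F) = ennreal g" "0 \<le> g"
  shows "prob (points_void F) = exp (- g)"
proof -
  let ?K = "{x \<in> space (exp_intensity \<Otimes>\<^sub>M borel). ereal (fst x) + snd x > 0}"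
  have Um: "U i \<in> measurable (sources Points) exp_intensity" for i
    using U_sources[of i] by (simp add: measurable_cong_sets[OF refl sets_exp_intensity])
  have "inj Path_plus" "Points \<notin> range Path_plus" by (auto simp: inj_def)
  note marks = indep_marks[OF sources_indep space_sources this Um Lp_sources]
  have "prob {w\<in>space M. \<forall>i. (U i w, F (\<lambda>t. Lp i t w)) \<notin> ?K} = exp (- g)"
  proof (rule marked_poisson_void[OF ppp sigma_finite_exp_intensity marks(1) path_functional_law(1)[OF F] marks(2)])
    show "?K \<in> sets (exp_intensity \<Otimes>\<^sub>M borel)" by measurable
    show "(\<integral>\<^sup>+p. emeasure (\<nu> F) {z. (p, z) \<in> ?K} \<partial>exp_intensity) = ennreal g"
      using intensity_of_exceedance(1)[OF prob_space_\<nu>[OF F] sets_\<nu>] g by (simp add: space_pair_measure)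
  qed (rule g)
  then show ?thesis by (simp add: points_void_def space_pair_measure)
qed

lemma prob_births_void:
  assumes \<theta>p: "0 < \<theta>p" and c: "0 \<le> c" and g: "(\<integral>\<^sup>+z. ereal_exp z \<partial>\<nu> F) = ennreal g" "0 \<le> g"
  shows "prob (births_void c F) = exp (- (\<theta>p * c * g))"
proof -
  let ?\<mu> = "birth_intensity \<theta>p {0<..}"
  have I: "point_indices \<theta>p = UNIV" using \<theta>p by (simp add: point_indices_def)
  have sm: "sets ?\<mu> = sets (restrict_space borel {0<..} \<Otimes>\<^sub>M borel)"
    unfolding birth_intensity_def by (intro sets_pair_measure_cong) (auto simp: sets_restrict_space)
  have id1: "(\<lambda>t. t) \<in> measurable (restrict_space borel {0<..}) (borel :: real measure)"
    by (rule measurable_restrict_space1) simp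
  have fm: "(\<lambda>x. fst (fst x)) \<in> borel_measurable (?\<mu> \<Otimes>\<^sub>M (borel :: ereal measure))"
    "(\<lambda>x. snd (fst x)) \<in> borel_measurable (?\<mu> \<Otimes>\<^sub>M (borel :: ereal measure))"
    unfolding measurable_cong_sets[OF sets_pair_measure_cong[OF sm refl] refl]
    by (rule measurable_compose[OF measurable_compose[OF measurable_fst measurable_fst] id1],
        rule measurable_compose[OF measurable_fst measurable_snd])
  note fm[measurable]
  let ?K = "{x \<in> space (?\<mu> \<Otimes>\<^sub>M borel). fst (fst x) \<le> c \<and> ereal (snd (fst x)) + snd x > 0}"
  have "inj Birth_path_plus" "Births_plus \<notin> range Birth_path_plus" by (auto simp: inj_def)
  note marks = indep_marks[OF sources_indep space_sources this Bp_sources[OF \<theta>p] LBp_sources]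
  have Bs: "Bp i w \<in> space ?\<mu>" if "w \<in> space M" for i w
    using measurable_space[OF Bp_sources[OF \<theta>p]] that by simp
  have "prob {w\<in>space M. \<forall>i. (Bp i w, F (\<lambda>t. LBp i t w)) \<notin> ?K} = exp (- (\<theta>p * c * g))"
  proof (rule marked_poisson_void[OF ppp_plus[unfolded I] sigma_finite_birth_intensity marks(1) path_functional_law(2)[OF F] marks(2)])
    show "?K \<in> sets (?\<mu> \<Otimes>\<^sub>M borel)" by measurable
    have "(\<integral>\<^sup>+p. emeasure (\<nu> F) {z. (p, z) \<in> ?K} \<partial>?\<mu>) = (\<integral>\<^sup>+p. emeasure (\<nu> F) {z. fst p \<le> c \<and> ereal (snd p) + z > 0} \<partial>?\<mu>)"
      by (intro nn_integral_cong) (simp add: space_pair_measure)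
    also have "\<dots> = ennreal (\<theta>p * c) * ennreal g"
      unfolding g(1)[symmetric] using \<theta>p by (intro birth_intensity_of_exceedance[OF prob_space_\<nu>[OF F] sets_\<nu> c]) simp
    also have "\<dots> = ennreal (\<theta>p * c * g)" using g c \<theta>p by (simp add: ennreal_mult')
    finally show "(\<integral>\<^sup>+p. emeasure (\<nu> F) {z. (p, z) \<in> ?K} \<partial>?\<mu>) = ennreal (\<theta>p * c * g)" .
    show "0 \<le> \<theta>p * c * g" using g c \<theta>p by simp
  qed
  moreover have "{w\<in>space M. \<forall>i. (Bp i w, F (\<lambda>t. LBp i t w)) \<notin> ?K}
      = births_void c F"
    using Bs by (auto simp: births_void_def space_pair_measure)
  ultimately show ?thesis by simp
qed

end

lemma points_births_indep:
  assumes F: "F \<in> borel_measurable (PiM {0..} (\<lambda>_. borel))" "\<And>y. F (restrict y {0..}) = F y"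
    and G: "G \<in> borel_measurable (PiM {0..} (\<lambda>_. borel))" "\<And>y. G (restrict y {0..}) = G y"
    and \<theta>p: "0 < \<theta>p"
  shows "prob (points_void F \<inter> births_void c G)
   = prob (points_void F) * prob (births_void c G)"
proof -
  define I where "I b = (if b then insert Points (range Path_plus) else insert Births_plus (range Birth_path_plus))" for b
  define H where "H b = sigma (space M) (\<Union>k\<in>I b. sets (sources k))" for b
  have pow: "(\<Union>k\<in>I b. sets (sources k)) \<subseteq> Pow (space M)" for b
    using sets.sets_into_space[of _ "sources k" for k] by force
  have H: "sets (H b) = sigma_sets (space M) (\<Union>k\<in>I b. sets (sources k))" "space (H b) = space M" for b
    using pow by (auto simp: H_def space_measure_of_conv)
  have ind: "indep_sets (\<lambda>b. sigma_sets (space M) (\<Union>k\<in>I b. sets (sources k))) UNIV"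
    by (rule indep_sets_collect_sigma[OF indep_sets_mono_index[OF _ sources_indep] sets.Int_stable])
      (auto simp: disjoint_family_on_def I_def split: if_splits)
  have eqb: "(\<lambda>b. sets (H b)) = case_bool (sets (H True)) (sets (H False))" by (auto simp: fun_eq_iff split: bool.split)
  have "indep_set (sets (H True)) (sets (H False))"
    using ind unfolding indep_set_def H(1)[symmetric] eqb .
  moreover have sub: "f \<in> measurable (H b) S" if "k \<in> I b" "f \<in> measurable (sources k) S" for f b k S
  proof (rule measurableI)
    fix A assume "A \<in> sets S"
    then have "f -` A \<inter> space M \<in> sets (sources k)" using measurable_sets[OF that(2)] by simp
    then show "f -` A \<inter> space (H b) \<in> sets (H b)" unfolding H using that(1) by (auto intro: sigma_sets.Basic)
  qed (use measurable_space[OF that(2)] H in auto)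
  moreover have "points_void F \<in> sets (H True)"
  proof -
    have [measurable]: "U i \<in> borel_measurable (H True)" "(\<lambda>w. F (\<lambda>t. Lp i t w)) \<in> borel_measurable (H True)" for i
      by (rule sub[OF _ U_sources], simp add: I_def, rule sub[OF _ Lp_sources[OF F]], simp add: I_def)
    have "{w\<in>space (H True). \<forall>i. \<not> ereal (U i w) + F (\<lambda>t. Lp i t w) > 0} \<in> sets (H True)" by measurable
    then show ?thesis by (simp add: points_void_def births_void_def H(2))
  qed
  moreover have "births_void c G \<in> sets (H False)"
  proof -
    have b: "Bp i \<in> borel_measurable (H False)" for i
    proof (rule sub)
      show "Births_plus \<in> I False" by (simp add: I_def)
      show "Bp i \<in> borel_measurable (sources Births_plus)"
        unfolding sources_def by (simp, rule measurable_coordinates_events_of) (use \<theta>p in \<open>auto simp: point_indices_def\<close>)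
    qed
    have [measurable]: "(\<lambda>w. fst (Bp i w)) \<in> borel_measurable (H False)" "(\<lambda>w. snd (Bp i w)) \<in> borel_measurable (H False)"
      "(\<lambda>w. G (\<lambda>t. LBp i t w)) \<in> borel_measurable (H False)" for i
      by (rule measurable_compose[OF b measurable_fst_borel], rule measurable_compose[OF b measurable_snd_borel],
          rule sub[OF _ LBp_sources[OF G]], simp add: I_def)
    have "{w\<in>space (H False). \<forall>i. \<not> (fst (Bp i w) \<le> c \<and> ereal (snd (Bp i w)) + G (\<lambda>t. LBp i t w) > 0)} \<in> sets (H False)" by measurable
    then show ?thesis by (simp add: points_void_def births_void_def H(2))
  qed
  ultimately show ?thesis by (simp add: indep_sets2_eq)
qed

section \<open>The event that the process stays below level 0\<close>

lemma add_le_0_iff: "ereal u + z \<le> 0 \<longleftrightarrow> z \<le> ereal (- u)"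
  by (cases z) (auto simp: zero_ereal_def)

abbreviation "\<eta> \<equiv> lbr_process \<theta>p \<theta>m U Bp Bm Lp Lm LBp LBm"

text \<open>At \<open>t \<ge> 0\<close> the two-sided paths show their forward half, and the paths
  attached to \<open>Bm\<close> have the value \<open>- \<infinity>\<close> because their time marks
  are negative.\<close>

lemma eta_le_0_iff:
  assumes w: "w \<in> space M" and t: "0 \<le> t"
  shows "\<eta> t w \<le> 0 \<longleftrightarrow> (\<forall>i. ereal (U i w) + Lp i t w \<le> 0) \<and>
    (\<forall>i\<in>point_indices \<theta>p. fst (Bp i w) \<le> t \<longrightarrow> ereal (snd (Bp i w)) + LBp i (t - fst (Bp i w)) w \<le> 0)"
proof -
  have neg: "fst (Bm i w) < 0" if "i \<in> point_indices \<theta>m" for i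
  proof -
    have "Bm i \<in> measurable M (birth_intensity \<theta>m {..<0})" using ppp_minus that by (auto simp: poisson_point_process_def)
    from measurable_space[OF this w] show ?thesis
      by (auto simp: birth_intensity_def space_pair_measure space_restrict_space)
  qed
  have m: "(case Bm i w of (T, u) \<Rightarrow> if t < T then ereal u + LBm i (T - t) w else - \<infinity>) \<le> 0" if "i \<in> point_indices \<theta>m" for i
    using neg[OF that] t by (auto split: prod.split)
  have p: "(case Bp i w of (T, u) \<Rightarrow> if t < T then - \<infinity> else ereal u + LBp i (t - T) w) \<le> 0
      \<longleftrightarrow> (fst (Bp i w) \<le> t \<longrightarrow> ereal (snd (Bp i w)) + LBp i (t - fst (Bp i w)) w \<le> 0)" for i
    by (auto split: prod.split)
  show ?thesis
    unfolding lbr_process_def Let_def Sup_le_iff ball_Un ball_simps two_sided_def using t m by (simp add: p)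
qed

text \<open>One level suffices: at \<open>x = - ln (\<Theta> T)\<close> the Gumbel law in the
  theorem says that this event has probability \<open>exp (- \<Theta> T)\<close>.\<close>

definition below_0 :: "real \<Rightarrow> 'w set" where
  "below_0 T = {w\<in>space M. (SUP t\<in>{0..T}. \<eta> t w) \<le> 0}"

lemma cadlag_SUP_le_0:
  assumes "cadlag y"
  shows "(\<forall>t\<in>{0..real m}. ereal u + y t \<le> 0) \<longleftrightarrow> \<not> ereal u + dyadic_sup m y > 0"
  using cadlag_SUP_dyadic[OF assms, of m, symmetric] unfolding not_less add_le_0_iff by (simp add: SUP_le_iff)

lemma cadlag_paths:
  assumes "w \<in> space M"
  shows "cadlag (\<lambda>t. Lp i t w)" "cadlag (\<lambda>t. LBp i t w)"
  using paths_plus[OF assms] by blast+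

lemma below_0_no_births:
  assumes "\<theta>p = 0"
  shows "below_0 (real m) = points_void (dyadic_sup m)"
proof (intro set_eqI)
  fix w
  show "w \<in> below_0 (real m) \<longleftrightarrow> w \<in> points_void (dyadic_sup m)"
  proof (cases "w \<in> space M")
    case True
    have "w \<in> below_0 (real m) \<longleftrightarrow> (\<forall>t\<in>{0..real m}. \<eta> t w \<le> 0)"
      using True by (simp add: below_0_def SUP_le_iff)
    also have "\<dots> \<longleftrightarrow> (\<forall>t\<in>{0..real m}. \<forall>i. ereal (U i w) + Lp i t w \<le> 0)"
    proof (rule ball_cong[OF refl])
      fix t assume "t \<in> {0..real m}"
      then show "\<eta> t w \<le> 0 \<longleftrightarrow> (\<forall>i. ereal (U i w) + Lp i t w \<le> 0)"
        using eta_le_0_iff[OF True, of t] assms by (simp add: point_indices_def)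
    qed
    also have "\<dots> \<longleftrightarrow> (\<forall>i. \<not> ereal (U i w) + dyadic_sup m (\<lambda>t. Lp i t w) > 0)"
      unfolding cadlag_SUP_le_0[OF cadlag_paths(1)[OF True], symmetric] by blast
    finally show ?thesis using True by (simp add: points_void_def)
  qed (simp add: below_0_def points_void_def)
qed

text \<open>A path born by time \<open>T - s\<close> spends its first \<open>s\<close> time units
  inside \<open>[0, T]\<close>, so it must stay below 0 during them. Discarding all other
  constraints bounds \<open>\<Theta> T\<close> from below.\<close>

lemma below_0_subset:
  assumes \<theta>p: "0 < \<theta>p" and s: "real s \<le> T"
  shows "below_0 T \<subseteq> births_void (T - real s) (dyadic_sup s)"
proof
  fix w assume w: "w \<in> below_0 T"
  then have wM: "w \<in> space M" and le: "\<And>t. t \<in> {0..T} \<Longrightarrow> \<eta> t w \<le> 0" by (auto simp: below_0_def SUP_le_iff)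
  have "\<not> ereal (snd (Bp i w)) + dyadic_sup s (\<lambda>t. LBp i t w) > 0" if i: "fst (Bp i w) \<le> T - real s" for i
    unfolding cadlag_SUP_le_0[OF cadlag_paths(2)[OF wM], symmetric]
  proof
    fix r assume r: "r \<in> {0..real s}"
    let ?t = "fst (Bp i w) + r"
    have "0 < fst (Bp i w)"
    proof -
      have "Bp i \<in> measurable M (birth_intensity \<theta>p {0<..})"
        using ppp_plus \<theta>p by (auto simp: poisson_point_process_def point_indices_def)
      from measurable_space[OF this wM] show ?thesis
        by (auto simp: birth_intensity_def space_pair_measure space_restrict_space)
    qed
    then have "?t \<in> {0..T}" using r i by simp
    from le[OF this] have "\<forall>i\<in>point_indices \<theta>p. fst (Bp i w) \<le> ?t \<longrightarrow> ereal (snd (Bp i w)) + LBp i (?t - fst (Bp i w)) w \<le> 0"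
      using \<open>?t \<in> {0..T}\<close> eta_le_0_iff[OF wM, of ?t] by simp
    moreover have "i \<in> point_indices \<theta>p" using \<theta>p by (simp add: point_indices_def)
    moreover have "fst (Bp i w) \<le> ?t" using r by simp
    ultimately have "ereal (snd (Bp i w)) + LBp i (?t - fst (Bp i w)) w \<le> 0" by blast
    then show "ereal (snd (Bp i w)) + LBp i r w \<le> 0" by simp
  qed
  then show "w \<in> births_void (T - real s) (dyadic_sup s)"
    using wM unfolding births_void_def by blast
qed

text \<open>A birth in \<open>[0, m]\<close> is visible for an amount of time that depends on its
  birth time; requiring its whole future to stay below 0 removes this dependence and bounds
  \<open>\<Theta>\<close> from above.\<close>

lemma below_0_superset:
  "points_void (dyadic_sup m) \<inter> births_void (real m) total_sup \<subseteq> below_0 (real m)"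
proof
  fix w assume w: "w \<in> points_void (dyadic_sup m) \<inter> births_void (real m) total_sup"
  then have wM: "w \<in> space M" by (simp add: points_void_def)
  have V: "ereal (U i w) + Lp i t w \<le> 0" if "t \<in> {0..real m}" for i t
  proof -
    have "\<not> ereal (U i w) + dyadic_sup m (\<lambda>t. Lp i t w) > 0" using w unfolding points_void_def by blast
    then show ?thesis using that unfolding cadlag_SUP_le_0[OF cadlag_paths(1)[OF wM], symmetric] by blast
  qed
  have B: "ereal (snd (Bp i w)) + LBp i (t - fst (Bp i w)) w \<le> 0" if t: "t \<in> {0..real m}" "fst (Bp i w) \<le> t" for i t
  proof -
    let ?r = "t - fst (Bp i w)"
    obtain k :: nat where k: "?r \<le> real k" using real_arch_simple by blast
    have "LBp i ?r w \<le> dyadic_sup k (\<lambda>t. LBp i t w)"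
      using k t by (subst cadlag_SUP_dyadic[OF cadlag_paths(2)[OF wM], symmetric]) (auto intro!: SUP_upper)
    also have "\<dots> \<le> total_sup (\<lambda>t. LBp i t w)" unfolding total_sup_def by (rule SUP_upper) simp
    also have "\<dots> \<le> ereal (- snd (Bp i w))"
      using w t by (simp add: births_void_def not_less add_le_0_iff[symmetric])
    finally show ?thesis by (simp add: add_le_0_iff)
  qed
  show "w \<in> below_0 (real m)"
    unfolding below_0_def using wM V B by (auto simp: SUP_le_iff eta_le_0_iff)
qed

lemma gain_ge_1: "1 \<le> gain m"
proof -
  have "1 \<le> L.grid_gain \<theta>m 0 m" by (simp add: L.grid_gain_def)
  also have "\<dots> \<le> gain m" unfolding gain_def by (rule SUP_upper) simp
  finally show ?thesis .
qed

lemma gain_real: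
  assumes "gain m \<le> ennreal C"
  obtains g where "gain m = ennreal g" "1 \<le> g" "g \<le> C" "\<And>n. L.grid_gain \<theta>m n m \<le> ennreal g"
proof -
  have "gain m \<noteq> \<infinity>" using assms by (auto simp: top_unique)
  then obtain g where g: "gain m = ennreal g" "0 \<le> g" by (cases "gain m") auto
  have "ennreal 1 \<le> ennreal g" using gain_ge_1[of m] unfolding g ennreal_1 .
  then have "1 \<le> g" using g by (subst (asm) ennreal_le_iff) auto
  moreover have "0 \<le> C"
  proof (rule ccontr)
    assume "\<not> 0 \<le> C"
    then have "ennreal C = 0" by (simp add: ennreal_neg)
    then show False using assms gain_ge_1[of m] by simp
  qed
  then have "g \<le> C" using assms unfolding g by (simp add: ennreal_le_iff)
  moreover have "L.grid_gain \<theta>m n m \<le> ennreal g" for n unfolding g(1)[symmetric] gain_def by (rule SUP_upper) simp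
  ultimately show thesis using g that by blast
qed

end

section \<open>The limit of \<open>\<Theta> T / T\<close>\<close>

lemma tendsto_affine_quotient: "((\<lambda>T::real. (a * T + b) / T) \<longlongrightarrow> a) at_top"
proof -
  have "((\<lambda>T::real. a + b / T) \<longlongrightarrow> a + 0) at_top"
    by (intro tendsto_add tendsto_const tendsto_divide_0[OF tendsto_const] filterlim_at_top_imp_at_infinity filterlim_ident)
  moreover have "\<forall>\<^sub>F T::real in at_top. a + b / T = (a * T + b) / T"
    using eventually_gt_at_top[of 0] by eventually_elim (simp add: field_simps)
  ultimately show ?thesis by (simp add: tendsto_cong)
qed

text \<open>The constant \<open>K\<close> may depend on the slope \<open>a\<close> and may be
  unbounded as \<open>a\<close> approaches \<open>l\<close>, as \<open>1 / v\<close> can be in the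
  case without births.\<close>

lemma tendsto_quotient_affine_bounds:
  fixes \<Theta> :: "real \<Rightarrow> real"
  assumes lower: "\<And>a. a < l \<Longrightarrow> \<exists>K. \<forall>\<^sub>F T in at_top. a * T + K \<le> \<Theta> T"
    and upper: "\<And>a. l < a \<Longrightarrow> \<exists>K. \<forall>\<^sub>F T in at_top. \<Theta> T \<le> a * T + K"
  shows "((\<lambda>T. \<Theta> T / T) \<longlongrightarrow> l) at_top"
proof (rule order_tendstoI)
  fix a assume "a < l"
  then obtain b where b: "a < b" "b < l" using dense by blast
  then obtain K where K: "\<forall>\<^sub>F T in at_top. b * T + K \<le> \<Theta> T" using lower by blast
  show "\<forall>\<^sub>F T in at_top. a < \<Theta> T / T"
    using K order_tendstoD(1)[OF tendsto_affine_quotient b(1), of K] eventually_gt_at_top[of 0]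
  proof eventually_elim
    case (elim T)
    then show ?case by (smt (verit) divide_right_mono)
  qed
next
  fix a assume "l < a"
  then obtain b where b: "l < b" "b < a" using dense by blast
  then obtain K where K: "\<forall>\<^sub>F T in at_top. \<Theta> T \<le> b * T + K" using upper by blast
  show "\<forall>\<^sub>F T in at_top. \<Theta> T / T < a"
    using K order_tendstoD(2)[OF tendsto_affine_quotient b(2), of K] eventually_gt_at_top[of 0]
  proof eventually_elim
    case (elim T)
    then show ?case by (smt (verit) divide_right_mono)
  qed
qed

theorem theorem1p16:
  fixes M :: "'w measure"
    and N :: "'a measure" and \<xi> :: "real \<Rightarrow> 'a \<Rightarrow> real"
    and N' :: "'b measure" and \<xi>' :: "real \<Rightarrow> 'b \<Rightarrow> real"
    and \<theta>p \<theta>m :: real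
    and U :: "nat \<Rightarrow> 'w \<Rightarrow> real"
    and Bp Bm :: "nat \<Rightarrow> 'w \<Rightarrow> real \<times> real"
    and Lp Lm LBp LBm :: "nat \<Rightarrow> real \<Rightarrow> 'w \<Rightarrow> ereal"
    and \<eta> :: "real \<Rightarrow> 'w \<Rightarrow> ereal"
    and \<psi> \<Theta> :: "real \<Rightarrow> real"
  assumes "levy_brown_resnick M N \<xi> N' \<xi>' \<theta>p \<theta>m U Bp Bm Lp Lm LBp LBm"
    and "no_positive_jumps N \<xi>"
    and "\<theta>p > 0 \<Longrightarrow> \<not> nonincreasing_paths N \<xi>"
    and "\<psi> = laplace_exponent N \<xi>"
    and "\<psi> 1 = \<theta>m - \<theta>p"
    and "\<eta> = lbr_process \<theta>p \<theta>m U Bp Bm Lp Lm LBp LBm"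
    and "\<And>T. T > 0 \<Longrightarrow> \<Theta> T > 0"
    and "\<And>T x. T > 0 \<Longrightarrow>
           measure M {w \<in> space M. (SUP t\<in>{0..T}. \<eta> t w) - ereal (ln (\<Theta> T)) \<le> ereal x} = exp (- exp (- x))"
  shows "((\<lambda>T. \<Theta> T / T) \<longlongrightarrow>
           (if \<theta>p = 0 then deriv \<psi> 1
            else psi_inverse \<psi> \<theta>m / (psi_inverse \<psi> \<theta>m - 1) * \<theta>p)) at_top"
proof -
  interpret spectrally_negative_lbr M N \<xi> N' \<xi>' \<theta>p \<theta>m U Bp Bm Lp Lm LBp LBm
    using assms(1,2) by (intro spectrally_negative_lbr.intro spectrally_negative_lbr_axioms.intro)
  note psi = assms(4) and psi1 = assms(5)[unfolded assms(4)] and eta = assms(6)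
  have void: "prob (below_0 T) = exp (- \<Theta> T)" if T: "0 < T" for T
  proof -
    have "x - ereal r \<le> ereal (- r) \<longleftrightarrow> x \<le> 0" for x r by (cases x) (auto simp: zero_ereal_def)
    then show ?thesis
      using assms(8)[OF T, of "- ln (\<Theta> T)"] assms(7)[OF T] by (simp add: below_0_def eta)
  qed
  \<comment> \<open>Sets outside \<open>events\<close> have measure 0 by convention, so the positive
    probability already shows that this event, a supremum over uncountably many times, is
    measurable.\<close>
  have below_ev: "below_0 T \<in> events" if "0 < T" for T
    using void[OF that] by (metis exp_not_eq_zero measure_notin_sets)
  have mono: "\<Theta> T \<le> \<Theta> T'" if "0 < T" "T \<le> T'" for T T'
  proof -
    have "below_0 T' \<subseteq> below_0 T"
      unfolding below_0_def using that by (auto simp: SUP_le_iff)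
    then have "prob (below_0 T') \<le> prob (below_0 T)" using below_ev[OF that(1)] by (intro finite_measure_mono)
    then show ?thesis using void[of T] void[of T'] that by simp
  qed
  \<comment> \<open>Monotonicity of \<open>\<Theta>\<close> extends a bound from integers to real
    \<open>T\<close>; rounding up adds at most 1 to \<open>T\<close>, hence the extra
    \<open>c\<close>. Integers appear as \<open>Suc m\<close> because \<open>\<Theta>\<close> is
    specified at positive arguments.\<close>
  have up: "\<forall>\<^sub>F T in at_top. \<Theta> T \<le> c * T + (c + K)" if c: "0 \<le> c" and *: "\<And>m. \<Theta> (real (Suc m)) \<le> c * real (Suc m) + K" for c K
    using eventually_gt_at_top[of 0]
  proof eventually_elim
    fix T :: real assume T: "0 < T"
    define m where "m = nat \<lfloor>T\<rfloor>"
    have "real m = real_of_int \<lfloor>T\<rfloor>" using T by (simp add: m_def)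
    then have m: "real m \<le> T" "T \<le> real (Suc m)" by (simp, linarith+)
    have "\<Theta> T \<le> \<Theta> (real (Suc m))" by (rule mono[OF T m(2)])
    also have "\<dots> \<le> c * real (Suc m) + K" by (rule *)
    also have "\<dots> \<le> c * (T + 1) + K" using c m by (intro add_right_mono mult_left_mono) auto
    finally show "\<Theta> T \<le> c * T + (c + K)" by (simp add: algebra_simps)
  qed
  show ?thesis
  proof (cases "\<theta>p = 0")
    case True
    have psi1': "L.\<psi> 1 = \<theta>m" using psi1 True by simp
    let ?d = "deriv L.\<psi> 1"
    have d: "(L.\<psi> has_real_derivative ?d) (at 1)" "0 \<le> ?d"
      using L.psi_has_derivative_1 rates psi1' by auto
    \<comment> \<open>A slope \<open>c\<close> above the derivative dominates some secant of
      \<open>\<psi>\<close> to the right of 1. Its length \<open>v\<close> depends on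
      \<open>c\<close>, and so does the constant \<open>1 + 1 / v\<close>.\<close>
    have gainC: "\<exists>K\<ge>0. \<forall>m. gain m \<le> ennreal (c * real m + K)" if c: "?d < c" for c
    proof -
      have "((\<lambda>h. (L.\<psi> (1 + h) - L.\<psi> 1) / h) \<longlongrightarrow> ?d) (at_right 0)"
        using d(1) unfolding DERIV_def by (rule filterlim_mono) (auto simp: at_le)
      then have "\<forall>\<^sub>F h in at_right 0. (L.\<psi> (1 + h) - L.\<psi> 1) / h < c" using c by (rule order_tendstoD)
      then obtain b where b: "0 < b" "\<And>h. 0 < h \<Longrightarrow> h < b \<Longrightarrow> (L.\<psi> (1 + h) - L.\<psi> 1) / h < c"
        unfolding eventually_at_right_field by blast
      define v where "v = b / 2"
      have v: "0 < v" "(L.\<psi> (1 + v) - L.\<psi> 1) / v < c" using b(1) b(2)[of v] by (auto simp: v_def)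
      then have "L.\<psi> (1 + v) \<le> \<theta>m + c * v" using psi1' by (simp add: pos_divide_less_eq)
      then have "gain m \<le> ennreal (1 + c * real m + 1 / v)" for m
        unfolding gain_def using v c d by (intro SUP_least L.grid_gain_upper_critical psi1') auto
      then show ?thesis using v by (intro exI[of _ "1 + 1 / v"]) (auto simp: add_ac)
    qed
    have val: "gain (Suc m) = ennreal (\<Theta> (real (Suc m)))" "1 + ?d * real (Suc m) \<le> \<Theta> (real (Suc m))" for m
    proof -
      \<comment> \<open>Any slope above \<open>?d\<close> would do; the bound serves to make
        \<open>gain\<close> finite.\<close>
      obtain K where K: "\<And>m. gain m \<le> ennreal ((?d + 1) * real m + K)" using gainC[of "?d + 1"] by auto
      obtain g where g: "gain (Suc m) = ennreal g" "1 \<le> g" "\<And>n. L.grid_gain \<theta>m n (Suc m) \<le> ennreal g"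
        using gain_real[OF K[of "Suc m"]] by metis
      have "prob (below_0 (real (Suc m))) = exp (- g)"
        unfolding below_0_no_births[OF True]
        using g nn_integral_\<nu>_dyadic[of "Suc m"] by (intro prob_points_void dyadic_sup_measurable dyadic_sup_restrict) auto
      then have "\<Theta> (real (Suc m)) = g" using void[of "real (Suc m)"] by simp
      then show "gain (Suc m) = ennreal (\<Theta> (real (Suc m)))" "1 + ?d * real (Suc m) \<le> \<Theta> (real (Suc m))"
        using g L.grid_gain_lower_critical[OF psi1' rates(2) g(3) g(2)] by auto
    qed
    have "((\<lambda>T. \<Theta> T / T) \<longlongrightarrow> ?d) at_top"
    proof (rule tendsto_quotient_affine_bounds)
      fix a assume a: "a < ?d"
      \<comment> \<open>\<open>T\<close> is compared with its integer part, which is at least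
        \<open>T - 1\<close>; this produces the constant \<open>1 - ?d\<close>.\<close>
      have "\<forall>\<^sub>F T in at_top. a * T + (1 - ?d) \<le> \<Theta> T"
        using eventually_ge_at_top[of 1]
      proof eventually_elim
        fix T :: real assume T: "1 \<le> T"
        define m where "m = nat (\<lfloor>T\<rfloor> - 1)"
        have "1 \<le> \<lfloor>T\<rfloor>" using T by simp
        then have m: "real (Suc m) = real_of_int \<lfloor>T\<rfloor>" by (simp add: m_def)
        then have m': "real (Suc m) \<le> T" "T - 1 \<le> real (Suc m)" by linarith+
        have "a * T \<le> ?d * T" using a T by (intro mult_right_mono) auto
        then have "a * T + (1 - ?d) \<le> 1 + ?d * (T - 1)" by (simp add: algebra_simps)
        also have "\<dots> \<le> 1 + ?d * real (Suc m)" using d m' by (intro add_left_mono mult_left_mono) auto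
        also have "\<dots> \<le> \<Theta> (real (Suc m))" by (rule val)
        also have "\<dots> \<le> \<Theta> T" using m' by (intro mono) auto
        finally show "a * T + (1 - ?d) \<le> \<Theta> T" .
      qed
      then show "\<exists>K. \<forall>\<^sub>F T in at_top. a * T + K \<le> \<Theta> T" by blast
    next
      fix a assume a: "?d < a"
      then obtain K where K: "0 \<le> K" "\<And>m. gain m \<le> ennreal (a * real m + K)" using gainC by blast
      have "\<Theta> (real (Suc m)) \<le> a * real (Suc m) + K" for m
      proof -
        have "ennreal (\<Theta> (real (Suc m))) \<le> ennreal (a * real (Suc m) + K)" using K(2)[of "Suc m"] unfolding val .
        then show ?thesis using K(1) a d by (subst (asm) ennreal_le_iff) (auto intro!: add_nonneg_nonneg mult_nonneg_nonneg)
      qed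
      then show "\<exists>K. \<forall>\<^sub>F T in at_top. \<Theta> T \<le> a * T + K" using up[of a K] a d by (intro exI[of _ "a + K"]) auto
    qed
    then show ?thesis using True by (simp add: psi)
  next
    case False
    then have \<theta>p: "0 < \<theta>p" using rates by simp
    define q where "q = psi_inverse L.\<psi> \<theta>m"
    \<comment> \<open>Since \<open>L.\<psi> 1 = \<theta>m - \<theta>p < \<theta>m\<close>, the tilt
      that matches the killing rate lies strictly beyond 1.\<close>
    have q: "L.\<psi> q = \<theta>m" "1 < q"
      unfolding q_def using L.psi_inverse_props[OF assms(3)[OF \<theta>p] rates(2)] psi1 \<theta>p by auto
    define Q where "Q = q / (q - 1)"
    have Q0: "0 < Q" using q by (simp add: Q_def)
    have gainQ: "gain m \<le> ennreal Q" for m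
      unfolding gain_def Q_def by (intro SUP_least L.grid_gain_upper q)
    define g where "g m = enn2real (gain m)" for m
    have g: "gain m = ennreal (g m)" "g m \<le> Q" "1 \<le> g m" "(q - exp (- (\<theta>p * real m))) / (q - 1) \<le> g m" for m
    proof -
      obtain h where h: "gain m = ennreal h" "1 \<le> h" "h \<le> Q" "\<And>n. L.grid_gain \<theta>m n m \<le> ennreal h"
        using gain_real[OF gainQ] by metis
      have "g m = h" using h by (simp add: g_def)
      moreover have "(q - exp (- (\<theta>p * real m))) / (q - 1) \<le> h"
        using L.grid_gain_lower_supercritical[OF q(2,1) h(4,2)] psi1 by simp
      ultimately show "gain m = ennreal (g m)" "g m \<le> Q" "1 \<le> g m" "(q - exp (- (\<theta>p * real m))) / (q - 1) \<le> g m"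
        using h by auto
    qed
    \<comment> \<open>The void event of the births is measurable because its probability is
      positive, as for \<open>below_ev\<close>; monotonicity of the measure requires this.\<close>
    have low: "\<theta>p * (T - real s) * g s \<le> \<Theta> T" if "real s \<le> T" "0 < T" for s T
    proof -
      have "exp (- \<Theta> T) \<le> exp (- (\<theta>p * (T - real s) * g s))"
        unfolding void[OF that(2), symmetric]
        using prob_births_void[OF dyadic_sup_measurable dyadic_sup_restrict \<theta>p, of "T - real s" s "g s"]
          nn_integral_\<nu>_dyadic[of s] g[of s] that measure_notin_sets
          finite_measure_mono[OF below_0_subset[OF \<theta>p that(1)]]
        by (smt (verit) exp_gt_zero)
      then show ?thesis by simp
    qed
    \<comment> \<open>Points and births are independent, so their exponents add: at most
      \<open>Q\<close> from the points, and at most \<open>\<theta>p * Q\<close> per unit of time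
      from the births.\<close>
    have high: "\<Theta> (real (Suc m)) \<le> \<theta>p * Q * real (Suc m) + Q" for m
    proof -
      have "(SUP m. gain m) \<le> ennreal Q" by (intro SUP_least gainQ)
      then obtain G where G: "(SUP m. gain m) = ennreal G" "0 \<le> G" "G \<le> Q"
        using Q0 by (cases "SUP m. gain m") (auto simp: top_unique)
      have "exp (- g (Suc m)) * exp (- (\<theta>p * real (Suc m) * G)) \<le> exp (- \<Theta> (real (Suc m)))"
      proof -
        have "exp (- g (Suc m)) * exp (- (\<theta>p * real (Suc m) * G))
          = prob (points_void (dyadic_sup (Suc m))) * prob (births_void (real (Suc m)) total_sup)"
          using g[of "Suc m"] G nn_integral_\<nu>_dyadic[of "Suc m"] nn_integral_\<nu>_total
          by (subst prob_points_void[OF dyadic_sup_measurable dyadic_sup_restrict, where g="g (Suc m)"], simp, simp,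
              subst prob_births_void[OF total_sup_measurable total_sup_restrict \<theta>p, where g=G]) auto
        also have "\<dots> = prob (points_void (dyadic_sup (Suc m)) \<inter> births_void (real (Suc m)) total_sup)"
          by (rule points_births_indep[OF dyadic_sup_measurable dyadic_sup_restrict total_sup_measurable total_sup_restrict \<theta>p, symmetric])
        also have "\<dots> \<le> prob (below_0 (real (Suc m)))"
          by (intro finite_measure_mono below_0_superset below_ev) simp
        finally show ?thesis using void[of "real (Suc m)"] by simp
      qed
      then have "\<Theta> (real (Suc m)) \<le> g (Suc m) + \<theta>p * real (Suc m) * G" by (simp add: exp_add[symmetric])
      also have "\<dots> \<le> Q + \<theta>p * real (Suc m) * Q" using g[of "Suc m"] G \<theta>p by (intro add_mono mult_left_mono) auto
      finally show ?thesis by (simp add: algebra_simps)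
    qed
    have "((\<lambda>T. \<Theta> T / T) \<longlongrightarrow> \<theta>p * Q) at_top"
    proof (rule tendsto_quotient_affine_bounds)
      fix a assume a: "a < \<theta>p * Q"
      \<comment> \<open>\<open>g s\<close> tends to \<open>Q\<close> as \<open>s\<close> grows, so
        some fixed \<open>s\<close> already gives a slope above \<open>a\<close>; the births lost
        between \<open>T - s\<close> and \<open>T\<close> cost only a constant.\<close>
      have "(\<lambda>s. exp (- \<theta>p) ^ s) \<longlonglongrightarrow> 0" using \<theta>p by (intro LIMSEQ_power_zero) simp
      then have "(\<lambda>s. exp (- (\<theta>p * real s))) \<longlonglongrightarrow> 0" by (simp add: exp_of_nat_mult[symmetric] mult.commute)
      then have "(\<lambda>s. \<theta>p * ((q - exp (- (\<theta>p * real s))) / (q - 1))) \<longlonglongrightarrow> \<theta>p * ((q - 0) / (q - 1))"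
        using q by (intro tendsto_intros) auto
      then have "\<forall>\<^sub>F s in sequentially. a < \<theta>p * ((q - exp (- (\<theta>p * real s))) / (q - 1))"
        by (rule order_tendstoD) (use a in \<open>simp add: Q_def\<close>)
      then obtain s where s: "a < \<theta>p * ((q - exp (- (\<theta>p * real s))) / (q - 1))" by (auto simp: eventually_sequentially)
      have ag: "a \<le> \<theta>p * g s"
        using s mult_left_mono[OF g(4)[of s], of \<theta>p] \<theta>p by simp
      have "\<forall>\<^sub>F T in at_top. a * T + (- (\<theta>p * real s * g s)) \<le> \<Theta> T"
        using eventually_ge_at_top[of "real s + 1"]
      proof eventually_elim
        fix T assume T: "real s + 1 \<le> T"
        then have "0 \<le> T" by linarith
        with ag have "a * T \<le> (\<theta>p * g s) * T" by (rule mult_right_mono)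
        then have "a * T + (- (\<theta>p * real s * g s)) \<le> \<theta>p * (T - real s) * g s" by (simp add: algebra_simps)
        also have "\<dots> \<le> \<Theta> T" using T by (intro low) auto
        finally show "a * T + (- (\<theta>p * real s * g s)) \<le> \<Theta> T" .
      qed
      then show "\<exists>K. \<forall>\<^sub>F T in at_top. a * T + K \<le> \<Theta> T" by blast
    next
      fix a assume a: "\<theta>p * Q < a"
      have "\<Theta> (real (Suc m)) \<le> a * real (Suc m) + Q" for m
        using high[of m] mult_right_mono[of "\<theta>p * Q" a "real (Suc m)"] a by linarith
      moreover have "0 \<le> a" using a \<theta>p Q0 by (meson less_imp_le mult_pos_pos less_trans)
      ultimately show "\<exists>K. \<forall>\<^sub>F T in at_top. \<Theta> T \<le> a * T + K" using up[of a Q] by blast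
    qed
    moreover have "(if \<theta>p = 0 then deriv \<psi> 1 else psi_inverse \<psi> \<theta>m / (psi_inverse \<psi> \<theta>m - 1) * \<theta>p) = \<theta>p * Q"
      using False by (simp add: psi q_def[symmetric] Q_def)
    ultimately show ?thesis by simp
  qed
qed

end
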